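(* In the online vertex-weighted stochastic matching problem with independent (not necessarily identical) arrivals, the independent estimator, i.e. the fractional algorithm with $x_{u,j}(t_j)=\Pr_{\tilde{\mathbf{t}}_{-j}}[(u,v_j)\in\mathsf{OPT}(t_j,\tilde{\mathbf{t}}_{-j})]$ (types of all other vertices resampled independently), is $0.718$-competitive, and the integral algorithm obtained by rounding it with the OCS is $0.666$-competitive. Moreover, the independent estimator achieves the best competitive ratio among all subset-resampling estimators.
   Context: Problem: a finite set $L$ of offline vertices with weights $w_u\ge 0$; online vertices $v_1,\dots,v_n$ arriving in this (fixed) order; the type $t_j$ of $v_j$ is drawn independently from a known distribution $D_j$ with finite support $T_j$, a type specifying the offline neighbours of the vertex. $\mathbf{t}_I=(t_i)_{i\in I}$, $\mathbf{t}_{-j}$ = all types except $t_j$. $\mathsf{OPT}(\mathbf{t})$ is a maximum-weight matching (weight $=\sum$ of $w_u$ over matched offline $u$) of the realized graph chosen by a fixed (possibly randomized) rule. A fractional online algorithm on arrival of $v_j$ chooses $x_j\in[0,1]^L$ depending on $t_1,\dots,t_j$, with $x_{u,j}>0$ only for neighbours $u$ of $v_j$ and $\sum_u x_{u,j}\le1$; with $y_u=\sum_j x_{u,j}$ its value is $\sum_u w_u\min(y_u,1)$. A subset-resampling estimator fixes, for each $j$, an index set $I_j\subseteq\{1,\dots,j\}$ with $j\in I_j$ and uses $x_{u,j}=\Pr[(u,v_j)\in\mathsf{OPT}\mid \mathbf{t}_{I_j}]$ (the independent estimator is $I_j=\{j\}$). Rounding with OCS: with $p(y)=1-\exp\!\big(-y-\tfrac12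 y^2-\tfrac{4-2\sqrt3}{3}y^3\big)$, on arrival of $v_j$ the multiway online correlated selection of Gao et al. (FOCS 2021) selects one $u$ with $x_{u,j}>0$ (a dummy element absorbs mass $1-\sum_u x_{u,j}$) and $v_j$ is matched to $u$ if $u$ is unmatched; for any fixed sequence $x_1,\dots,x_n$ each $u$ is selected at least once with probability at least $p(y_u)$. $\Gamma$-competitive means the expected value (weight of matched offline vertices) is at least $\Gamma$ times the expected weight of $\mathsf{OPT}$ on every instance; the competitive ratio is the largest such $\Gamma$. *)

theory Defs
  imports "HOL-Probability.Probability" "HOL-Library.Infinite_Typeclass"
begin

text \<open>
  Instances of online vertex-weighted stochastic matching. The online vertices are
  the indices \<open>1, \<dots>, arrivals G\<close>, arriving in this order. A type may carry more
  information than the set of offline neighbours it determines.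
\<close>

record ('l, 't) osm =
  offline :: "'l set"
  weight :: "'l \<Rightarrow> real"
  arrivals :: nat
  dist :: "nat \<Rightarrow> 't pmf"
  nbrs :: "'t \<Rightarrow> 'l set"

definition valid_osm :: "('l, 't) osm \<Rightarrow> bool" where
  "valid_osm G \<longleftrightarrow>
     finite (offline G) \<and>
     (\<forall>u\<in>offline G. 0 \<le> weight G u) \<and>
     (\<forall>j\<in>{1..arrivals G}. finite (set_pmf (dist G j)) \<and>
        (\<forall>\<tau>\<in>set_pmf (dist G j). nbrs G \<tau> \<subseteq> offline G))"

definition types_law :: "('l, 't) osm \<Rightarrow> (nat \<Rightarrow> 't) pmf" where
  "types_law G = Pi_pmf {1..arrivals G} undefined (dist G)"

definition edges :: "('l, 't) osm \<Rightarrow> (nat \<Rightarrow> 't) \<Rightarrow> ('l \<times> nat) set" where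
  "edges G t = {(u, j). j \<in> {1..arrivals G} \<and> u \<in> nbrs G (t j)}"

definition is_matching :: "('l, 't) osm \<Rightarrow> (nat \<Rightarrow> 't) \<Rightarrow> ('l \<times> nat) set \<Rightarrow> bool" where
  "is_matching G t M \<longleftrightarrow> M \<subseteq> edges G t \<and> inj_on fst M \<and> inj_on snd M"

definition matching_weight :: "('l, 't) osm \<Rightarrow> ('l \<times> nat) set \<Rightarrow> real" where
  "matching_weight G M = (\<Sum>u\<in>fst ` M. weight G u)"

definition max_weight_matching :: "('l, 't) osm \<Rightarrow> (nat \<Rightarrow> 't) \<Rightarrow> ('l \<times> nat) set \<Rightarrow> bool" where
  "max_weight_matching G t M \<longleftrightarrow>
     is_matching G t M \<and>
     (\<forall>M'. is_matching G t M' \<longrightarrow> matching_weight G M' \<le> matching_weight G M)"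

text \<open>
  A fixed, possibly randomized, rule choosing a maximum-weight matching of the realized
  graph. The random bits of the rule are independent of the types.
\<close>

type_synonym ('l, 't) opt_rule = "('l, 't) osm \<Rightarrow> (nat \<Rightarrow> 't) \<Rightarrow> ('l \<times> nat) set pmf"

definition valid_opt_rule :: "('l, 't) opt_rule \<Rightarrow> bool" where
  "valid_opt_rule OPT \<longleftrightarrow>
     (\<forall>G. valid_osm G \<longrightarrow>
       (\<forall>t\<in>set_pmf (types_law G). \<forall>M\<in>set_pmf (OPT G t). max_weight_matching G t M))"

definition opt_law :: "('l, 't) opt_rule \<Rightarrow> ('l, 't) osm \<Rightarrow> ((nat \<Rightarrow> 't) \<times> ('l \<times> nat) set) pmf" where
  "opt_law OPT G = bind_pmf (types_law G) (\<lambda>t. map_pmf (\<lambda>M. (t, M)) (OPT G t))"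

definition opt_value :: "('l, 't) opt_rule \<Rightarrow> ('l, 't) osm \<Rightarrow> real" where
  "opt_value OPT G =
     measure_pmf.expectation (opt_law OPT G) (\<lambda>(t, M). matching_weight G M)"

text \<open>
  In \<open>x G j t u\<close>, \<open>t\<close> is the whole type profile; that only the types revealed so far
  are used is part of \<open>fractional_online\<close>.
\<close>

type_synonym ('l, 't) fractional = "('l, 't) osm \<Rightarrow> nat \<Rightarrow> (nat \<Rightarrow> 't) \<Rightarrow> 'l \<Rightarrow> real"

definition fractional_online :: "('l, 't) fractional \<Rightarrow> bool" where
  "fractional_online x \<longleftrightarrow>
     (\<forall>G. valid_osm G \<longrightarrow> (\<forall>j\<in>{1..arrivals G}. \<forall>t\<in>set_pmf (types_law G).
        (\<forall>u. x G j t u \<in> {0..1} \<and> (x G j t u > 0 \<longrightarrow> u \<in> nbrs G (t j))) \<and>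
        (\<Sum>u\<in>offline G. x G j t u) \<le> 1 \<and>
        (\<forall>t'\<in>set_pmf (types_law G). (\<forall>i\<in>{1..j}. t' i = t i) \<longrightarrow> x G j t' = x G j t)))"

definition load :: "nat \<Rightarrow> (nat \<Rightarrow> 'l \<Rightarrow> real) \<Rightarrow> 'l \<Rightarrow> real" where
  "load n x u = (\<Sum>j=1..n. x j u)"

definition fractional_value :: "('l, 't) fractional \<Rightarrow> ('l, 't) osm \<Rightarrow> real" where
  "fractional_value x G =
     measure_pmf.expectation (types_law G)
       (\<lambda>t. \<Sum>u\<in>offline G. weight G u * min (load (arrivals G) (\<lambda>j. x G j t) u) 1)"

definition independent_estimator :: "('l, 't) opt_rule \<Rightarrow> ('l, 't) fractional" where
  "independent_estimator OPT G j t u =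
     measure_pmf.prob
       (bind_pmf (Pi_pmf ({1..arrivals G} - {j}) undefined (dist G))
          (\<lambda>t'. OPT G (t'(j := t j))))
       {M. (u, j) \<in> M}"

text \<open>
  The index set used on arrival of vertex \<open>j\<close> is \<open>S n j\<close>, where \<open>n\<close> is the number of
  online vertices; families that do not depend on \<open>n\<close> are a special case.
\<close>

definition valid_index_sets :: "(nat \<Rightarrow> nat \<Rightarrow> nat set) \<Rightarrow> bool" where
  "valid_index_sets S \<longleftrightarrow> (\<forall>n. \<forall>j\<in>{1..n}. S n j \<subseteq> {1..j} \<and> j \<in> S n j)"

definition subset_estimator ::
    "('l, 't) opt_rule \<Rightarrow> (nat \<Rightarrow> nat \<Rightarrow> nat set) \<Rightarrow> ('l, 't) fractional" where
  "subset_estimator OPT S G j t u =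
     \<P>(p in measure_pmf (opt_law OPT G).
        (u, j) \<in> snd p \<bar> (\<forall>i\<in>S (arrivals G) j. fst p i = t i))"

text \<open>
  An algorithm enters through its expected value on each instance. The set in
  \<open>competitive_ratio\<close> is closed, and bounded above by the instance with one edge, so for
  algorithms of nonnegative value its supremum is its largest element.
\<close>

definition competitive :: "('l, 't) opt_rule \<Rightarrow> (('l, 't) osm \<Rightarrow> real) \<Rightarrow> real \<Rightarrow> bool" where
  "competitive OPT val \<Gamma> \<longleftrightarrow> (\<forall>G. valid_osm G \<longrightarrow> val G \<ge> \<Gamma> * opt_value OPT G)"

definition competitive_ratio :: "('l, 't) opt_rule \<Rightarrow> (('l, 't) osm \<Rightarrow> real) \<Rightarrow> real" where
  "competitive_ratio OPT val = Sup {\<Gamma>. competitive OPT val \<Gamma>}"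

text \<open>
  A multiway online selection procedure on a ground set \<open>L\<close>: from the vectors
  \<open>x\<^sub>1, \<dots>, x\<^sub>j\<close> and its own earlier selections it draws the selection of round \<open>j\<close>.
  Internal randomness shared between rounds is covered, by conditioning on the earlier
  selections. \<open>None\<close> is the dummy element.
\<close>

type_synonym 'l selector = "'l set \<Rightarrow> ('l \<Rightarrow> real) list \<Rightarrow> 'l option list \<Rightarrow> 'l option pmf"

primrec selections :: "'l selector \<Rightarrow> 'l set \<Rightarrow> (nat \<Rightarrow> 'l \<Rightarrow> real) \<Rightarrow> nat \<Rightarrow> 'l option list pmf" where
  "selections A L x 0 = return_pmf []"
| "selections A L x (Suc j) =
     bind_pmf (selections A L x j)
       (\<lambda>s. map_pmf (\<lambda>a. s @ [a]) (A L (map x [1..<Suc (Suc j)]) s))"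

definition fractional_seq :: "'l set \<Rightarrow> nat \<Rightarrow> (nat \<Rightarrow> 'l \<Rightarrow> real) \<Rightarrow> bool" where
  "fractional_seq L n x \<longleftrightarrow>
     (\<forall>j\<in>{1..n}. (\<forall>u. 0 \<le> x j u) \<and> (\<forall>u. u \<notin> L \<longrightarrow> x j u = 0) \<and> (\<Sum>u\<in>L. x j u) \<le> 1)"

definition ocs_bound :: "real \<Rightarrow> real" where
  "ocs_bound y = 1 - exp (- y - y\<^sup>2 / 2 - (4 - 2 * sqrt 3) / 3 * y ^ 3)"

text \<open>
  The round-\<open>j\<close> selection is \<open>s ! (j - 1)\<close>. The guarantee is that of the multiway OCS of
  Gao et al.; nothing else about that OCS is used.
\<close>

definition is_ocs :: "'l selector \<Rightarrow> bool" where
  "is_ocs A \<longleftrightarrow>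
     (\<forall>L n x. finite L \<and> fractional_seq L n x \<longrightarrow>
        (\<forall>s\<in>set_pmf (selections A L x n). \<forall>j\<in>{1..n}.
           case s ! (j - 1) of None \<Rightarrow> (\<Sum>u\<in>L. x j u) < 1 | Some u \<Rightarrow> x j u > 0) \<and>
        (\<forall>u\<in>L. measure_pmf.prob (selections A L x n) {s. Some u \<in> set s}
                 \<ge> ocs_bound (load n x u)))"

text \<open>Vertex \<open>j\<close> is matched to its selected \<open>u\<close> iff \<open>u\<close> was not selected before.\<close>

definition greedy_matching :: "'l option list \<Rightarrow> ('l \<times> nat) set" where
  "greedy_matching s =
     {(u, j). j \<in> {1..length s} \<and> s ! (j - 1) = Some u \<and>
              (\<forall>i\<in>{1..<j}. s ! (i - 1) \<noteq> Some u)}"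

definition rounded_law ::
    "'l selector \<Rightarrow> ('l, 't) fractional \<Rightarrow> ('l, 't) osm \<Rightarrow> (nat \<Rightarrow> 't) \<Rightarrow> ('l \<times> nat) set pmf" where
  "rounded_law A x G t =
     map_pmf greedy_matching (selections A (offline G) (\<lambda>j. x G j t) (arrivals G))"

definition rounded_value ::
    "'l selector \<Rightarrow> ('l, 't) fractional \<Rightarrow> ('l, 't) osm \<Rightarrow> real" where
  "rounded_value A x G =
     measure_pmf.expectation (bind_pmf (types_law G) (rounded_law A x G)) (matching_weight G)"

end

(* For a fixed offline vertex u the estimates x_j = x_{u,j}(t_j) are independent, and since the
   events "u is matched to v_j in OPT" are disjoint, every set B of (vertex, type) pairs satisfies
   the Border-type constraint E[sum of x_j over B] <= P(some (j, t_j) lies in B).  For a concave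
   function such as min(y, a), a sorting and layer-cake argument together with Jensen's inequality
   shows that under this constraint the worst case is S = sum_i B_i v_i, where the B_i are
   independent Bernoulli(d_i) and v_i = (1 - d_1) ... (1 - d_{i-1}); as the d_i tend to 0 this
   becomes the Dickman distribution, and 1 - exp(-gamma)/2 = 0.7192... is the limit of the ratio.
   A supersolution of the Dickman delay equation bounds E (a - S)^+ for all a at once; the case
   a = 1 gives 0.718, and the OCS bound, being concave, dominates a positive combination of
   functions min(y, a), which gives 0.666.

   Conversely each such S is the load of a single vertex u in an instance in which later arrivals
   have priority for u. There the types revealed so far carry no information about the future
   competitors, so all subset-resampling estimators coincide on u. Hence the
   ratio of every subset-resampling estimator is at most the infimum over S, and this infimum is a
   lower bound for the independent estimator on every instance. *)

theory Submission
  imports Defs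
begin

text \<open>The obstacle in the reduction to S is that the sorted list of (vertex, type) pairs
  interleaves types of different vertices, while two types of one vertex exclude each other; so the
  tests along the list are not independent events of the profile. \<open>payoff\<close> lets a pair
  absorb the mean of the later payoffs at its own vertex: this keeps the prefix sums compared by the
  Border constraint under control, and by Jensen it can only lower the shortfall. The marginal
  values are taken at the given load, so the comparison is a tangent inequality followed by Abel
  summation; subtracting \<Gamma> from them pays for the difference between the total masses of
  payoffs and estimates. The delay inequality is the first-order condition at hazard d = 0 for one
  step S = B + (1 - d) S' to respect the bound; convexity extends it to larger d. Mixing the Dickman
  bound with \<open>max 0 z\<close> in this proportion gives the factor \<open>1 - survival\<close>,
  which is the value of OPT on the matching hard instance up to the tiny private weights.\<close>

section \<open>Extremal sums\<close>

text \<open>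
  \<open>shortfall ds v z\<close> is the expectation of \<open>max 0 (z - v S)\<close>, where \<open>S = B\<^sub>1 + (1 - d\<^sub>1) S'\<close>
  with \<open>B\<^sub>1\<close> Bernoulli with parameter \<open>d\<^sub>1\<close>, and \<open>S'\<close> is the corresponding sum for the tail of \<open>ds\<close>.
\<close>

fun shortfall :: "real list \<Rightarrow> real \<Rightarrow> real \<Rightarrow> real" where
  "shortfall [] v z = max 0 z"
| "shortfall (d # ds) v z =
     d * shortfall ds ((1 - d) * v) (z - v) + (1 - d) * shortfall ds ((1 - d) * v) z"

definition survival :: "real list \<Rightarrow> real" where
  "survival ds = (\<Prod>d\<leftarrow>ds. 1 - d)"

lemma shortfall_zero_scale: "shortfall ds 0 z = max 0 z"
  by (induction ds arbitrary: z) (simp_all add: algebra_simps)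

section \<open>Weighted sums over finite product spaces\<close>

definition mass :: "('j \<Rightarrow> 't \<Rightarrow> real) \<Rightarrow> ('j \<Rightarrow> 't set) \<Rightarrow> 'j \<Rightarrow> real" where
  "mass p A j = (\<Sum>\<tau>\<in>A j. p j \<tau>)"

definition total_mass :: "'j set \<Rightarrow> ('j \<Rightarrow> 't \<Rightarrow> real) \<Rightarrow> ('j \<Rightarrow> 't set) \<Rightarrow> real" where
  "total_mass J p A = (\<Prod>j\<in>J. mass p A j)"

definition product_sum ::
    "'j set \<Rightarrow> ('j \<Rightarrow> 't \<Rightarrow> real) \<Rightarrow> ('j \<Rightarrow> 't set) \<Rightarrow> (('j \<Rightarrow> 't) \<Rightarrow> real) \<Rightarrow> real" where
  "product_sum J p A f = (\<Sum>t\<in>PiE J A. (\<Prod>j\<in>J. p j (t j)) * f t)"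

definition additive_shortfall ::
    "'j set \<Rightarrow> ('j \<Rightarrow> 't \<Rightarrow> real) \<Rightarrow> ('j \<Rightarrow> 't set) \<Rightarrow> ('j \<Rightarrow> 't \<Rightarrow> real) \<Rightarrow> real \<Rightarrow> real" where
  "additive_shortfall J p A \<phi> z = product_sum J p A (\<lambda>t. max 0 (z - (\<Sum>j\<in>J. \<phi> j (t j))))"

definition drop_types :: "('j \<Rightarrow> 't set) \<Rightarrow> ('j \<times> 't) list \<Rightarrow> 'j \<Rightarrow> 't set" where
  "drop_types A es j = A j - {\<tau>. (j, \<tau>) \<in> set es}"

text \<open>
  When the pairs of \<open>es\<close> are tested one after the other, the test of \<open>(j, \<tau>)\<close> succeeds with
  probability \<open>p j \<tau> / mass p A j\<close> and then pays the current total mass. The payoff of \<open>(j, \<tau>)\<close> adds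
  to this the expected payoff of the later pairs with the same \<open>j\<close>, which are no longer reached:
  replacing those by their mean is the Jensen step in \<open>additive_shortfall_payoff\<close>.
  If no mass is left at \<open>j\<close>, division by zero makes the second summand vanish.
\<close>

fun payoff ::
    "'j set \<Rightarrow> ('j \<Rightarrow> 't \<Rightarrow> real) \<Rightarrow> ('j \<times> 't) list \<Rightarrow> ('j \<Rightarrow> 't set) \<Rightarrow> 'j \<Rightarrow> 't \<Rightarrow> real" where
  "payoff J p [] A = (\<lambda>_ _. 0)"
| "payoff J p (e # es) A =
     (let A' = drop_types A [e]; f = payoff J p es A'; j = fst e in
        f(j := (f j)(snd e :=
          total_mass J p A + (\<Sum>\<sigma>\<in>A' j. p j \<sigma> * f j \<sigma>) / mass p A' j)))"

text \<open>The entry of \<open>(j, \<tau>)\<close> is the conditional probability of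
  \<open>t j = \<tau>\<close> given that all earlier tests have failed. These are the Bernoulli
  parameters of the extremal sum.\<close>

fun hazards :: "('j \<Rightarrow> 't \<Rightarrow> real) \<Rightarrow> ('j \<times> 't) list \<Rightarrow> ('j \<Rightarrow> 't set) \<Rightarrow> real list" where
  "hazards p [] A = []"
| "hazards p (e # es) A =
     p (fst e) (snd e) / mass p A (fst e) # hazards p es (drop_types A [e])"

lemma drop_types_simps [simp]:
  "drop_types A [] = A"
  "drop_types (drop_types A es) es' = drop_types A (es @ es')"
  by (auto simp: drop_types_def fun_eq_iff)

lemma product_sum_split:
  assumes "finite J" "j \<in> J"
  shows "product_sum J p A (\<lambda>t. F (\<Sum>i\<in>J. \<phi> i (t i))) =
    (\<Sum>\<tau>\<in>A j. p j \<tau> * product_sum (J - {j}) p A (\<lambda>t. F (\<phi> j \<tau> + (\<Sum>i\<in>J-{j}. \<phi> i (t i)))))"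
proof -
  let ?K = "J - {j}"
  have J: "J = insert j ?K" using assms by auto
  have inj: "inj_on (\<lambda>(\<tau>, t). t(j := \<tau>)) (A j \<times> PiE ?K A)"
    using inj_combinator[of j ?K A] by simp
  have img: "PiE J A = (\<lambda>(\<tau>, t). t(j := \<tau>)) ` (A j \<times> PiE ?K A)"
    using PiE_insert_eq[of j ?K A] J by simp
  have term_eq: "(\<Prod>i\<in>J. p i ((t(j := \<tau>)) i)) * F (\<Sum>i\<in>J. \<phi> i ((t(j := \<tau>)) i)) =
      p j \<tau> * ((\<Prod>i\<in>?K. p i (t i)) * F (\<phi> j \<tau> + (\<Sum>i\<in>?K. \<phi> i (t i))))" for t \<tau>
  proof -
    have "(\<Prod>i\<in>?K. p i ((t(j := \<tau>)) i)) = (\<Prod>i\<in>?K. p i (t i))" by (rule prod.cong) auto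
    moreover have "(\<Sum>i\<in>?K. \<phi> i ((t(j := \<tau>)) i)) = (\<Sum>i\<in>?K. \<phi> i (t i))" by (rule sum.cong) auto
    ultimately show ?thesis
      unfolding prod.remove[OF assms] sum.remove[OF assms] by simp
  qed
  have "product_sum J p A (\<lambda>t. F (\<Sum>i\<in>J. \<phi> i (t i))) = (\<Sum>(\<tau>, t)\<in>A j \<times> PiE ?K A.
      (\<Prod>i\<in>J. p i ((t(j := \<tau>)) i)) * F (\<Sum>i\<in>J. \<phi> i ((t(j := \<tau>)) i)))"
    unfolding product_sum_def img by (subst sum.reindex[OF inj]) (simp only: case_prod_unfold comp_def)
  also have "\<dots> = (\<Sum>(\<tau>, t)\<in>A j \<times> PiE ?K A.
      p j \<tau> * ((\<Prod>i\<in>?K. p i (t i)) * F (\<phi> j \<tau> + (\<Sum>i\<in>?K. \<phi> i (t i)))))"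
    by (simp only: term_eq)
  finally show ?thesis
    unfolding product_sum_def by (simp add: sum.cartesian_product sum_distrib_left)
qed

lemma product_sum_const:
  assumes "finite J" "\<And>j. j \<in> J \<Longrightarrow> finite (A j)"
  shows "product_sum J p A (\<lambda>t. c) = total_mass J p A * c"
proof -
  have "(\<Prod>j\<in>J. \<Sum>\<tau>\<in>A j. p j \<tau>) = (\<Sum>t\<in>PiE J A. \<Prod>j\<in>J. p j (t j))"
    using assms by (intro prod_sum_PiE) auto
  then show ?thesis
    unfolding product_sum_def total_mass_def mass_def by (simp add: sum_distrib_right)
qed

lemma product_sum_cong:
  assumes "\<And>t j. j \<in> J \<Longrightarrow> A j = A' j" "\<And>t. t \<in> PiE J A \<Longrightarrow> f t = f' t"
  shows "product_sum J p A f = product_sum J p A' f'"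
proof -
  have "PiE J A = PiE J A'" using assms(1) by (rule PiE_cong)
  then show ?thesis
    unfolding product_sum_def using assms(2) by (intro sum.cong) auto
qed

lemma product_sum_mono:
  assumes "\<And>j \<tau>. j \<in> J \<Longrightarrow> \<tau> \<in> A j \<Longrightarrow> 0 \<le> p j \<tau>" "\<And>t. t \<in> PiE J A \<Longrightarrow> f t \<le> f' t"
  shows "product_sum J p A f \<le> product_sum J p A f'"
  unfolding product_sum_def
  using assms by (intro sum_mono mult_left_mono prod_nonneg) (auto simp: PiE_iff)

lemma product_sum_linear:
  "product_sum J p A (\<lambda>t. f t - g t) = product_sum J p A f - product_sum J p A g"
  "product_sum J p A (\<lambda>t. c * f t) = c * product_sum J p A f"
  "product_sum J p A (\<lambda>t. \<Sum>i\<in>I. h i t) = (\<Sum>i\<in>I. product_sum J p A (h i))"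
proof -
  show "product_sum J p A (\<lambda>t. f t - g t) = product_sum J p A f - product_sum J p A g"
    unfolding product_sum_def by (simp only: right_diff_distrib sum_subtractf)
  show "product_sum J p A (\<lambda>t. c * f t) = c * product_sum J p A f"
    unfolding product_sum_def by (simp add: sum_distrib_left mult.left_commute)
  show "product_sum J p A (\<lambda>t. \<Sum>i\<in>I. h i t) = (\<Sum>i\<in>I. product_sum J p A (h i))"
    unfolding product_sum_def by (subst sum.swap) (simp only: sum_distrib_left)
qed

text \<open>The weights are unnormalized because the inductions pass to subfamilies \<open>A\<close>
  of \<open>T\<close>: restricting a sum takes the place of conditioning.\<close>

locale weighted_types =
  fixes J :: "'j set" and p :: "'j \<Rightarrow> 't \<Rightarrow> real" and T :: "'j \<Rightarrow> 't set"
  assumes finJ: "finite J" and finT: "\<And>j. j \<in> J \<Longrightarrow> finite (T j)"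
    and p_pos: "\<And>j \<tau>. j \<in> J \<Longrightarrow> \<tau> \<in> T j \<Longrightarrow> 0 < p j \<tau>"
begin

lemma drop_types_subset:
  "\<forall>j\<in>J. A j \<subseteq> T j \<Longrightarrow> \<forall>j\<in>J. drop_types A es j \<subseteq> T j"
  unfolding drop_types_def by blast

lemma mass_nonneg: "(\<forall>j\<in>J. A j \<subseteq> T j) \<Longrightarrow> j \<in> J \<Longrightarrow> 0 \<le> mass p A j"
  unfolding mass_def using p_pos by (intro sum_nonneg) (meson less_imp_le subsetD)

lemma total_mass_nonneg: "(\<forall>j\<in>J. A j \<subseteq> T j) \<Longrightarrow> 0 \<le> total_mass J p A"
  unfolding total_mass_def using mass_nonneg by (intro prod_nonneg) auto

lemma mass_drop:
  assumes "\<forall>j\<in>J. A j \<subseteq> T j" "j \<in> J" "\<tau> \<in> A j"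
  shows "mass p A j = p j \<tau> + mass p (drop_types A [(j, \<tau>)]) j" "0 < mass p A j"
    "\<And>i. i \<noteq> j \<Longrightarrow> mass p (drop_types A [(j, \<tau>)]) i = mass p A i"
proof -
  have fin: "finite (A j)" using assms finT finite_subset by blast
  have eq: "drop_types A [(j, \<tau>)] j = A j - {\<tau>}" by (auto simp: drop_types_def)
  show 1: "mass p A j = p j \<tau> + mass p (drop_types A [(j, \<tau>)]) j"
    unfolding mass_def eq using fin assms(3) by (rule sum.remove)
  have "0 \<le> mass p (drop_types A [(j, \<tau>)]) j"
    using drop_types_subset[OF assms(1)] assms(2) by (rule mass_nonneg)
  moreover have "0 < p j \<tau>" using assms p_pos by auto
  ultimately show "0 < mass p A j" using 1 by simp
  show "mass p (drop_types A [(j, \<tau>)]) i = mass p A i" if "i \<noteq> j" for i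
  proof -
    have "drop_types A [(j, \<tau>)] i = A i" using that by (auto simp: drop_types_def)
    then show ?thesis by (simp add: mass_def)
  qed
qed

text \<open>The third equation identifies the scale \<open>v\<close> in \<open>shortfall\<close>
  with the current total mass: a failed test multiplies both by one minus its hazard.\<close>

lemma total_mass_drop:
  assumes "\<forall>j\<in>J. A j \<subseteq> T j" "j \<in> J" "\<tau> \<in> A j"
  defines "A' \<equiv> drop_types A [(j, \<tau>)]"
  shows "total_mass J p A = mass p A j * total_mass (J - {j}) p A"
    "total_mass J p A' = mass p A' j * total_mass (J - {j}) p A"
    "total_mass J p A' = (1 - p j \<tau> / mass p A j) * total_mass J p A"
proof -
  note m = mass_drop[OF assms(1-3)]
  show 1: "total_mass J p A = mass p A j * total_mass (J - {j}) p A"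
    unfolding total_mass_def using finJ assms(2) by (rule prod.remove)
  have "(\<Prod>i\<in>J-{j}. mass p A' i) = (\<Prod>i\<in>J-{j}. mass p A i)"
    by (intro prod.cong) (auto simp: m A'_def)
  then show 2: "total_mass J p A' = mass p A' j * total_mass (J - {j}) p A"
    unfolding total_mass_def using prod.remove[OF finJ assms(2), of "mass p A'"] by simp
  have "mass p A' j = mass p A j - p j \<tau>" using m by (simp add: A'_def)
  then have "1 - p j \<tau> / mass p A j = mass p A' j / mass p A j"
    using m(2) by (simp add: field_simps)
  then show "total_mass J p A' = (1 - p j \<tau> / mass p A j) * total_mass J p A"
    unfolding 1 2 using m(2) by simp
qed

lemma payoff_outside:
  "(j, \<tau>) \<notin> set es \<Longrightarrow> payoff J p es A j \<tau> = 0"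
  by (induction es arbitrary: A) (auto simp: Let_def)

text \<open>Each test shrinks the family, so \<open>es\<close> and \<open>A\<close> must vary
  together; the rule maintains that the untested pairs lie in the reduced family.\<close>

lemma drop_types_induct [consumes 3, case_names Nil Cons]:
  assumes "\<forall>j\<in>J. A j \<subseteq> T j" "distinct es" "set es \<subseteq> Sigma J A"
    and Nil: "\<And>A. (\<forall>j\<in>J. A j \<subseteq> T j) \<Longrightarrow> P [] A"
    and Cons: "\<And>j \<tau> es A. (\<forall>j\<in>J. A j \<subseteq> T j) \<Longrightarrow> j \<in> J \<Longrightarrow> \<tau> \<in> A j \<Longrightarrow>
      (j, \<tau>) \<notin> set es \<Longrightarrow> set es \<subseteq> Sigma J (drop_types A [(j, \<tau>)]) \<Longrightarrow> distinct es \<Longrightarrow>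
      P es (drop_types A [(j, \<tau>)]) \<Longrightarrow> P ((j, \<tau>) # es) A"
  shows "P es A"
  using assms(1-3)
proof (induction es arbitrary: A)
  case Nil
  then show ?case using assms(4) by blast
next
  case (Cons e es)
  obtain j \<tau> where e: "e = (j, \<tau>)" by fastforce
  have sub: "set es \<subseteq> Sigma J (drop_types A [(j, \<tau>)])"
    using Cons.prems e by (auto simp: drop_types_def)
  have "P es (drop_types A [(j, \<tau>)])"
    using Cons.prems sub by (intro Cons.IH) (auto simp: drop_types_def)
  then show ?case
    unfolding e using Cons.prems e sub by (intro assms(5)) auto
qed

lemma payoff_Cons:
  fixes A :: "'j \<Rightarrow> 't set"
  assumes "(j, \<tau>) \<notin> set es"
  defines "A' \<equiv> drop_types A [(j, \<tau>)]"
  shows "payoff J p ((j, \<tau>) # es) A j \<tau> =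
      total_mass J p A + (\<Sum>\<sigma>\<in>A' j. p j \<sigma> * payoff J p es A' j \<sigma>) / mass p A' j"
    "(i, \<sigma>) \<noteq> (j, \<tau>) \<Longrightarrow> payoff J p ((j, \<tau>) # es) A i \<sigma> = payoff J p es A' i \<sigma>"
  by (auto simp: Let_def A'_def)

declare payoff.simps(2) [simp del]

lemma payoff_nonneg:
  assumes "\<forall>j\<in>J. A j \<subseteq> T j" "distinct es" "set es \<subseteq> Sigma J A"
  shows "0 \<le> payoff J p es A i \<sigma>"
  using assms
proof (induction arbitrary: i \<sigma> rule: drop_types_induct)
  case (Cons j \<tau> es A)
  let ?A' = "drop_types A [(j, \<tau>)]"
  have "?A' j \<subseteq> T j" "0 \<le> mass p ?A' j"
    using drop_types_subset[OF Cons.hyps(1)] Cons.hyps(2) mass_nonneg by blast+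
  moreover have "0 \<le> total_mass J p A"
    using Cons.hyps(1) by (rule total_mass_nonneg)
  moreover have "0 \<le> (\<Sum>\<sigma>\<in>?A' j. p j \<sigma> * payoff J p es ?A' j \<sigma>)"
    using calculation(1) Cons.hyps(2) Cons.IH p_pos
    by (intro sum_nonneg mult_nonneg_nonneg) (auto intro!: less_imp_le)
  ultimately show ?case
    using payoff_Cons[OF Cons.hyps(4), where A = A] Cons.IH
    by (cases "(i, \<sigma>) = (j, \<tau>)") auto
qed simp

text \<open>Serves the case of hazard 1, after which no test is reached with positive
  probability.\<close>

lemma payoff_zero:
  assumes "\<forall>j\<in>J. A j \<subseteq> T j" "distinct es" "set es \<subseteq> Sigma J A"
    and "total_mass J p A = 0"
  shows "payoff J p es A i \<sigma> = 0"
  using assms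
proof (induction arbitrary: i \<sigma> rule: drop_types_induct)
  case (Cons j \<tau> es A)
  have "total_mass J p (drop_types A [(j, \<tau>)]) = 0"
    using total_mass_drop(3)[OF Cons.hyps(1-3)] Cons.prems by simp
  then have "payoff J p es (drop_types A [(j, \<tau>)]) i \<sigma> = 0" for i \<sigma>
    by (rule Cons.IH)
  then show ?case
    using payoff_Cons[OF Cons.hyps(4), where A = A] Cons.prems
    by (cases "(i, \<sigma>) = (j, \<tau>)") auto
qed simp

lemma hazards_range:
  assumes "\<forall>j\<in>J. A j \<subseteq> T j" "distinct es" "set es \<subseteq> Sigma J A"
  shows "set (hazards p es A) \<subseteq> {0..1}"
  using assms
proof (induction rule: drop_types_induct)
  case (Cons j \<tau> es A)
  have "0 \<le> mass p (drop_types A [(j, \<tau>)]) j"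
    using drop_types_subset[OF Cons.hyps(1)] Cons.hyps(2) by (rule mass_nonneg)
  moreover have "0 < p j \<tau>" using Cons.hyps p_pos by blast
  ultimately have "p j \<tau> / mass p A j \<in> {0..1}"
    using mass_drop[OF Cons.hyps(1-3)] by auto
  then show ?case using Cons.IH by simp
qed simp

lemma survival_hazards:
  assumes "\<forall>j\<in>J. A j \<subseteq> T j" "distinct es" "set es \<subseteq> Sigma J A"
  shows "total_mass J p (drop_types A es) = survival (hazards p es A) * total_mass J p A"
  using assms
proof (induction rule: drop_types_induct)
  case (Cons j \<tau> es A)
  then show ?case
    using total_mass_drop(3)[OF Cons.hyps(1-3)] by (simp add: survival_def)
qed (simp add: survival_def)

lemma sum_list_fiber:
  fixes h :: "'t \<Rightarrow> real"
  assumes "distinct ps"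
  shows "(\<Sum>(i, \<sigma>)\<leftarrow>ps. if i = j then h \<sigma> else 0) = (\<Sum>\<sigma>\<in>{\<sigma>. (j, \<sigma>) \<in> set ps}. h \<sigma>)"
  using assms
proof (induction ps)
  case (Cons e ps)
  obtain i \<tau> where e: "e = (i, \<tau>)" by fastforce
  have fin: "finite {\<sigma>. (j, \<sigma>) \<in> set ps}"
    by (rule finite_subset[of _ "snd ` set ps"]) force+
  show ?case
  proof (cases "i = j")
    case True
    then have "{\<sigma>. (j, \<sigma>) \<in> set (e # ps)} = insert \<tau> {\<sigma>. (j, \<sigma>) \<in> set ps}"
      using e by auto
    then show ?thesis using Cons fin e True by simp
  next
    case False
    then have "{\<sigma>. (j, \<sigma>) \<in> set (e # ps)} = {\<sigma>. (j, \<sigma>) \<in> set ps}"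
      using e by auto
    then show ?thesis using Cons e False by simp
  qed
qed simp

text \<open>Removing the head \<open>(j, \<tau>)\<close> changes the normalizer at \<open>j\<close>
  only, from m to m' = m - \<open>p j \<tau>\<close>. The later pairs of the prefix at
  \<open>j\<close> thereby lose c R, whereas the head gains c S from the mean added to its payoff. A
  prefix sees only part of the pairs at \<open>j\<close>, so R \<le> S; for the whole list R = S.
  Hence the payoffs attain the Border bound on the whole list and are at least as large on
  prefixes.\<close>

lemma payoff_prefix:
  assumes "\<forall>j\<in>J. A j \<subseteq> T j" "distinct es" "set es \<subseteq> Sigma J A"
    and "es = ps @ qs"
  defines "L \<equiv> \<lambda>A ps es. \<Sum>(j, \<tau>)\<leftarrow>ps. p j \<tau> * payoff J p es A j \<tau> / mass p A j"
  shows "total_mass J p A - total_mass J p (drop_types A ps) \<le> L A ps es \<and>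
    (qs = [] \<longrightarrow> total_mass J p A - total_mass J p (drop_types A ps) = L A ps es)"
  using assms(1-4)
proof (induction arbitrary: ps rule: drop_types_induct)
  case (Cons j \<tau> es A)
  let ?A' = "drop_types A [(j, \<tau>)]"
  let ?f = "payoff J p es ?A'"
  show ?case
  proof (cases ps)
    case Nil
    then show ?thesis using Cons.prems by (simp add: L_def)
  next
    case (Cons e ps')
    then have e: "e = (j, \<tau>)" and es: "es = ps' @ qs"
      using Cons.prems by auto
    have A'T: "\<forall>j\<in>J. ?A' j \<subseteq> T j"
      using Cons.hyps(1) by (rule drop_types_subset)
    have dist: "distinct ps'" and notin: "(j, \<tau>) \<notin> set ps'" using Cons.hyps es by auto
    note m = mass_drop[OF Cons.hyps(1-3)]
    note W = total_mass_drop[OF Cons.hyps(1-3)]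
    let ?m = "mass p A j" and ?m' = "mass p ?A' j"
    let ?S = "\<Sum>\<sigma>\<in>?A' j. p j \<sigma> * ?f j \<sigma>"
    let ?R = "\<Sum>\<sigma>\<in>{\<sigma>. (j, \<sigma>) \<in> set ps'}. p j \<sigma> * ?f j \<sigma>"
    have finA': "finite (?A' j)"
      using A'T[rule_format, OF Cons.hyps(2)] finT[OF Cons.hyps(2)] finite_subset by blast
    have nn: "0 \<le> p j \<sigma> * ?f j \<sigma>" if "\<sigma> \<in> ?A' j" for \<sigma>
      using that A'T Cons.hyps(2) p_pos payoff_nonneg[OF A'T Cons.hyps(6,5)]
      by (intro mult_nonneg_nonneg) (blast intro: less_imp_le)+
    have sub: "{\<sigma>. (j, \<sigma>) \<in> set ps'} \<subseteq> ?A' j"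
      using Cons.hyps(5) es by auto
    have RS: "?R \<le> ?S" using sub finA' nn by (intro sum_mono2) auto
    have RS_eq: "?R = ?S" if "qs = []"
      using sub finA' es that by (intro sum.mono_neutral_left) (auto simp: payoff_outside)
    have empty: "?A' j = {}" if "?m' = 0"
    proof (rule ccontr)
      assume "?A' j \<noteq> {}"
      then have "0 < ?m'" unfolding mass_def
        using finA' A'T[rule_format, OF Cons.hyps(2)] p_pos[OF Cons.hyps(2)] by (intro sum_pos) auto
      with that show False by simp
    qed
    \<comment> \<open>For m' > 0 this equals \<open>p j \<tau>\<close> / (m m'). If m' = 0 there is
      no later pair at \<open>j\<close>, and nothing has to be compensated.\<close>
    define c where "c = (if ?m' = 0 then 0 else 1 / ?m' - 1 / ?m)"
    have c_nonneg: "0 \<le> c"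
    proof (cases "?m' = 0")
      case False
      moreover have "0 \<le> ?m'" using A'T Cons.hyps(2) by (rule mass_nonneg)
      moreover have "?m' \<le> ?m" using m(1) p_pos[of j \<tau>] Cons.hyps(1-3) by fastforce
      ultimately show ?thesis by (simp add: c_def field_simps)
    qed (simp add: c_def)
    have terms: "(\<Sum>(i, \<sigma>)\<leftarrow>ps'. p i \<sigma> * payoff J p ((j, \<tau>) # es) A i \<sigma> / mass p A i) = L ?A' ps' es - c * ?R"
    proof -
      have "(\<Sum>(i, \<sigma>)\<leftarrow>ps'. p i \<sigma> * payoff J p ((j, \<tau>) # es) A i \<sigma> / mass p A i) =
        (\<Sum>(i, \<sigma>)\<leftarrow>ps'. p i \<sigma> * ?f i \<sigma> / mass p ?A' i - c * (if i = j then p j \<sigma> * ?f j \<sigma> else 0))"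
      proof (intro arg_cong[where f = sum_list] map_cong refl, clarify)
        fix i \<sigma> assume *: "(i, \<sigma>) \<in> set ps'"
        with notin have ne: "(i, \<sigma>) \<noteq> (j, \<tau>)" by blast
        have "i = j \<Longrightarrow> ?m' \<noteq> 0" using empty sub * by auto
        then show "p i \<sigma> * payoff J p ((j, \<tau>) # es) A i \<sigma> / mass p A i =
          p i \<sigma> * ?f i \<sigma> / mass p ?A' i - c * (if i = j then p j \<sigma> * ?f j \<sigma> else 0)"
          using payoff_Cons(2)[OF Cons.hyps(4) ne] m(3)[of i]
          by (auto simp: c_def algebra_simps)
      qed
      also have "\<dots> = L ?A' ps' es - c * (\<Sum>(i, \<sigma>)\<leftarrow>ps'. if i = j then p j \<sigma> * ?f j \<sigma> else 0)"
        by (simp add: L_def case_prod_unfold sum_list_subtractf sum_list_const_mult)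
      finally show ?thesis using sum_list_fiber[OF dist, of j "\<lambda>\<sigma>. p j \<sigma> * ?f j \<sigma>"] by simp
    qed
    have "p j \<tau> * payoff J p ((j, \<tau>) # es) A j \<tau> / ?m = (total_mass J p A - total_mass J p ?A') + c * ?S"
    proof (cases "?m' = 0")
      case True
      then show ?thesis
        using payoff_Cons(1)[OF Cons.hyps(4), where A = A] m W empty by (simp add: c_def)
    next
      case False
      have "p j \<tau> * total_mass J p A / ?m = total_mass J p A - total_mass J p ?A'"
        using W(3) by (simp add: algebra_simps)
      moreover have "p j \<tau> * (?S / ?m') / ?m = c * ?S"
        using m(1,2) False by (simp add: c_def field_simps)
      ultimately show ?thesis
        using payoff_Cons(1)[OF Cons.hyps(4), where A = A] by (simp add: distrib_left add_divide_distrib)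
    qed
    then have "L A ps ((j, \<tau>) # es) =
        (total_mass J p A - total_mass J p ?A') + L ?A' ps' es + c * (?S - ?R)"
      using terms unfolding Cons e L_def by (simp add: algebra_simps)
    moreover have "drop_types A ps = drop_types ?A' ps'" using Cons e by simp
    moreover have "0 \<le> c * (?S - ?R)" using c_nonneg RS by simp
    ultimately show ?thesis using Cons.IH[OF es] RS_eq by auto
  qed
qed (simp add: L_def)

text \<open>Split by whether \<open>t j = \<tau>\<close> for the head pair. If not, the family has
  shrunk and the induction hypothesis applies at z. If so, W is paid, and the mean of the later
  payoffs at \<open>j\<close> stands for a fresh type drawn from \<open>A' j\<close>; by convexity
  of \<open>max 0\<close> this is at most the shortfall over \<open>A'\<close> at z - W, where the
  induction hypothesis applies again.\<close>

lemma additive_shortfall_payoff: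
  assumes "\<forall>j\<in>J. A j \<subseteq> T j" "distinct es" "set es \<subseteq> Sigma J A"
  shows "additive_shortfall J p A (payoff J p es A) z \<le>
    total_mass J p A * shortfall (hazards p es A) (total_mass J p A) z"
  using assms
proof (induction arbitrary: z rule: drop_types_induct)
  case (Nil A)
  have "\<And>j. j \<in> J \<Longrightarrow> finite (A j)" using Nil finT finite_subset by blast
  then show ?case
    unfolding additive_shortfall_def using finJ by (simp add: product_sum_const[of J A])
next
  case (Cons j \<tau> es A)
  let ?A' = "drop_types A [(j, \<tau>)]"
  let ?f = "payoff J p es ?A'" and ?g = "payoff J p ((j, \<tau>) # es) A"
  let ?W = "total_mass J p A" and ?W' = "total_mass J p ?A'"
  let ?m = "mass p A j" and ?m' = "mass p ?A' j"
  let ?S = "\<Sum>\<sigma>\<in>?A' j. p j \<sigma> * ?f j \<sigma>"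
  let ?ds = "hazards p es ?A'"
  note m = mass_drop[OF Cons.hyps(1-3)]
  note W = total_mass_drop[OF Cons.hyps(1-3)]
  have A'T: "\<forall>j\<in>J. ?A' j \<subseteq> T j"
    using Cons.hyps(1) by (rule drop_types_subset)
  have finA: "finite (A i)" if "i \<in> J" for i
    using Cons.hyps(1) finT that finite_subset by blast
  have Aj: "A j = insert \<tau> (?A' j)" "\<tau> \<notin> ?A' j"
    using Cons.hyps(3) by (auto simp: drop_types_def)
  have finA': "finite (?A' j)" using finA[OF Cons.hyps(2)] Aj by simp
  \<comment> \<open>Away from \<open>j\<close> both families and both payoff functions agree, so one
    function H serves all branches.\<close>
  define H where "H z = product_sum (J - {j}) p A (\<lambda>t. max 0 (z - (\<Sum>i\<in>J-{j}. ?f i (t i))))" for z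
  have eqA: "product_sum (J - {j}) p B (\<lambda>t. max 0 (z - (c + (\<Sum>i\<in>J-{j}. k i (t i))))) = H (z - c)"
    if "\<And>i. i \<noteq> j \<Longrightarrow> B i = A i" "\<And>i. i \<noteq> j \<Longrightarrow> k i = ?f i" for B k z c
  proof -
    have "(\<Sum>i\<in>J-{j}. k i (t i)) = (\<Sum>i\<in>J-{j}. ?f i (t i))" for t
      using that by (intro sum.cong) auto
    then show ?thesis
      unfolding H_def using that by (intro product_sum_cong) (auto simp: algebra_simps)
  qed
  have G': "additive_shortfall J p ?A' ?f z = (\<Sum>\<sigma>\<in>?A' j. p j \<sigma> * H (z - ?f j \<sigma>))" for z
    unfolding additive_shortfall_def
    by (subst product_sum_split[OF finJ Cons.hyps(2), where F = "\<lambda>s. max 0 (z - s)"])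
       (subst eqA, auto simp: drop_types_def)
  have G: "additive_shortfall J p A ?g z = p j \<tau> * H (z - ?g j \<tau>) + additive_shortfall J p ?A' ?f z"
  proof -
    have g: "?g j \<sigma> = ?f j \<sigma>" if "\<sigma> \<in> ?A' j" for \<sigma>
    proof -
      have "(j, \<sigma>) \<noteq> (j, \<tau>)" using that Aj by auto
      then show ?thesis by (rule payoff_Cons(2)[OF Cons.hyps(4)])
    qed
    have "additive_shortfall J p A ?g z = (\<Sum>\<sigma>\<in>A j. p j \<sigma> * H (z - ?g j \<sigma>))"
      unfolding additive_shortfall_def
      by (subst product_sum_split[OF finJ Cons.hyps(2), where F = "\<lambda>s. max 0 (z - s)"])
         (subst eqA, simp_all add: fun_eq_iff payoff_Cons(2)[OF Cons.hyps(4)])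
    also have "\<dots> = p j \<tau> * H (z - ?g j \<tau>) + (\<Sum>\<sigma>\<in>?A' j. p j \<sigma> * H (z - ?g j \<sigma>))"
      unfolding Aj(1) using finA' Aj(2) by simp
    also have "(\<Sum>\<sigma>\<in>?A' j. p j \<sigma> * H (z - ?g j \<sigma>)) = additive_shortfall J p ?A' ?f z"
      unfolding G' using g by simp
    finally show ?thesis .
  qed
  have Wnn: "0 \<le> ?W'" using A'T by (rule total_mass_nonneg)
  have haz: "1 - p j \<tau> / ?m = ?m' / ?m" using m(1,2) by (simp add: field_simps)
  have W': "?W' = ?m' / ?m * ?W" using W(3) haz by simp
  have rhs: "?W * shortfall (hazards p ((j, \<tau>) # es) A) ?W z =
      ?W * (p j \<tau> / ?m) * shortfall ?ds ?W' (z - ?W) + ?W' * shortfall ?ds ?W' z"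
  proof -
    have "x * (d * a + (1 - d) * b) = x * d * a + ((1 - d) * x) * b" for x d a b :: real
      by (simp add: algebra_simps)
    then show ?thesis
      by (simp only: hazards.simps shortfall.simps fst_conv snd_conv W(3)[symmetric])
  qed
  have first: "p j \<tau> * H (z - ?g j \<tau>) \<le> ?W * (p j \<tau> / ?m) * shortfall ?ds ?W' (z - ?W)"
  proof (cases "?m' = 0")
    case True
    have "?A' j = {}"
    proof (rule ccontr)
      assume "?A' j \<noteq> {}"
      then have "0 < ?m'" unfolding mass_def
        using finA' A'T[rule_format, OF Cons.hyps(2)] p_pos[OF Cons.hyps(2)] by (intro sum_pos) auto
      with True show False by simp
    qed
    then have g: "?g j \<tau> = ?W" using payoff_Cons(1)[OF Cons.hyps(4), where A = A] by simp
    have W0: "?W' = 0" using W' True by simp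
    have "?f i \<sigma> = 0" for i \<sigma>
      using payoff_zero[OF A'T Cons.hyps(6,5) W0] .
    then have "H (z - ?W) = product_sum (J - {j}) p A (\<lambda>t. max 0 (z - ?W))"
      unfolding H_def by simp
    also have "\<dots> = total_mass (J - {j}) p A * max 0 (z - ?W)"
      using finJ finA by (intro product_sum_const) auto
    finally have "H (z - ?W) = total_mass (J - {j}) p A * max 0 (z - ?W)" .
    then show ?thesis
      using g W(1) m(2) W0 by (simp add: shortfall_zero_scale)
  next
    case False
    have "0 \<le> ?m'" using A'T Cons.hyps(2) by (rule mass_nonneg)
    with False have m': "0 < ?m'" by simp
    have g: "z - ?g j \<tau> = (z - ?W) - ?S / ?m'"
      using payoff_Cons(1)[OF Cons.hyps(4), where A = A] by simp
    have jensen: "?m' * max 0 (w - ?S / ?m') \<le> (\<Sum>\<sigma>\<in>?A' j. p j \<sigma> * max 0 (w - ?f j \<sigma>))" for w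
    proof -
      have nn: "0 \<le> p j \<sigma>" if "\<sigma> \<in> ?A' j" for \<sigma>
        using that A'T Cons.hyps(2) p_pos by (blast intro: less_imp_le)
      have "?m' * (w - ?S / ?m') = ?m' * w - ?S"
      proof -
        have "?m' * (?S / ?m') = ?S" using m' by simp
        then show ?thesis by (simp only: right_diff_distrib)
      qed
      also have "\<dots> = (\<Sum>\<sigma>\<in>?A' j. p j \<sigma> * (w - ?f j \<sigma>))"
      proof -
        have "?m' * w = (\<Sum>\<sigma>\<in>?A' j. p j \<sigma> * w)"
          unfolding mass_def by (rule sum_distrib_right)
        then show ?thesis by (simp only: right_diff_distrib sum_subtractf)
      qed
      also have "\<dots> \<le> (\<Sum>\<sigma>\<in>?A' j. p j \<sigma> * max 0 (w - ?f j \<sigma>))"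
        using nn by (intro sum_mono mult_left_mono) auto
      finally have "?m' * (w - ?S / ?m') \<le> (\<Sum>\<sigma>\<in>?A' j. p j \<sigma> * max 0 (w - ?f j \<sigma>))" .
      moreover have "0 \<le> (\<Sum>\<sigma>\<in>?A' j. p j \<sigma> * max 0 (w - ?f j \<sigma>))"
        using nn by (intro sum_nonneg) auto
      ultimately show ?thesis using m' by (auto simp: max_def)
    qed
    have "?m' * H (z - ?g j \<tau>) \<le> additive_shortfall J p ?A' ?f (z - ?W)"
    proof -
      let ?s = "\<lambda>t. \<Sum>i\<in>J-{j}. ?f i (t i)"
      have H_eq: "product_sum (J - {j}) p A (\<lambda>t. max 0 ((z - ?W - ?s t) - c)) = H (z - ?W - c)" for c
        unfolding H_def by (simp add: algebra_simps)
      have "?m' * H (z - ?g j \<tau>) =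
          product_sum (J - {j}) p A (\<lambda>t. ?m' * max 0 ((z - ?W - ?s t) - ?S / ?m'))"
        unfolding g by (simp only: H_eq product_sum_linear(2))
      also have "\<dots> \<le> product_sum (J - {j}) p A
          (\<lambda>t. \<Sum>\<sigma>\<in>?A' j. p j \<sigma> * max 0 ((z - ?W - ?s t) - ?f j \<sigma>))"
      proof (rule product_sum_mono[OF _ jensen])
        fix i \<sigma> assume "i \<in> J - {j}" "\<sigma> \<in> A i"
        then show "0 \<le> p i \<sigma>" using Cons.hyps(1) p_pos by (meson DiffD1 less_imp_le subsetD)
      qed
      also have "\<dots> = (\<Sum>\<sigma>\<in>?A' j. p j \<sigma> * H ((z - ?W) - ?f j \<sigma>))"
        by (simp only: H_eq product_sum_linear(2,3))
      finally show ?thesis unfolding G' .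
    qed
    also have "\<dots> \<le> ?W' * shortfall ?ds ?W' (z - ?W)" by (rule Cons.IH)
    finally have "H (z - ?g j \<tau>) \<le> ?W' * shortfall ?ds ?W' (z - ?W) / ?m'"
      using m' by (simp add: field_simps)
    also have "\<dots> = ?W / ?m * shortfall ?ds ?W' (z - ?W)"
      using W' m' by simp
    finally have "p j \<tau> * H (z - ?g j \<tau>) \<le> p j \<tau> * (?W / ?m * shortfall ?ds ?W' (z - ?W))"
      using p_pos[of j \<tau>] Cons.hyps(1-3) by (intro mult_left_mono) (auto intro!: less_imp_le)
    then show ?thesis by (simp add: mult_ac)
  qed
  then show ?case unfolding G rhs using Cons.IH[of z] by linarith
qed

end

section \<open>Majorization along the sorted list\<close>

text \<open>Abel summation. The nonnegative partial sum collected so far is carried as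
  \<open>C\<close> at a key \<open>k0\<close> below all remaining keys, so moving it to the next key
  can only increase the expression.\<close>

lemma sum_list_sorted_nonpos:
  fixes k c :: "'e \<Rightarrow> real"
  assumes "sorted (map k es)" "\<And>e. e \<in> set es \<Longrightarrow> k e \<le> 0"
    and "\<And>ps qs. es = ps @ qs \<Longrightarrow> 0 \<le> C + (\<Sum>e\<leftarrow>ps. c e)"
    and "k0 \<le> 0" "\<And>e. e \<in> set es \<Longrightarrow> k0 \<le> k e"
  shows "k0 * C + (\<Sum>e\<leftarrow>es. k e * c e) \<le> 0"
  using assms
proof (induction es arbitrary: k0 C)
  case Nil
  have "0 \<le> C" using Nil(3)[of "[]" "[]"] by simp
  then show ?case using Nil(4) by (simp add: mult_nonpos_nonneg)
next
  case (Cons e es)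
  have "0 \<le> C" using Cons.prems(3)[of "[]"] by simp
  then have "k0 * C \<le> k e * C" using Cons.prems(5) by (intro mult_right_mono) auto
  moreover have "k e * (C + c e) + (\<Sum>e\<leftarrow>es. k e * c e) \<le> 0"
  proof (rule Cons.IH)
    fix ps qs assume "es = ps @ qs"
    then show "0 \<le> C + c e + (\<Sum>e\<leftarrow>ps. c e)" using Cons.prems(3)[of "e # ps" qs] by simp
  qed (use Cons.prems in auto)
  ultimately show ?case by (simp add: algebra_simps)
qed

text \<open>
  \<open>K\<close> below is the conditional probability that the sum stays below \<open>a\<close>, minus \<open>\<Gamma>\<close>. This is the
  marginal value of the pair for the concave function \<open>min y a - \<Gamma> y\<close>; testing the pairs with
  \<open>K \<le> 0\<close> in increasing order of \<open>K\<close> turns \<open>feasible\<close> into a majorization of \<open>x\<close> by the payoffs.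
\<close>

theorem additive_min_lower_bound:
  fixes p x :: "'j \<Rightarrow> 't \<Rightarrow> real"
  assumes finJ: "finite J" and finT: "\<And>j. j \<in> J \<Longrightarrow> finite (T j)"
    and p_pos: "\<And>j \<tau>. j \<in> J \<Longrightarrow> \<tau> \<in> T j \<Longrightarrow> 0 < p j \<tau>"
    and mass1: "\<And>j. j \<in> J \<Longrightarrow> (\<Sum>\<tau>\<in>T j. p j \<tau>) = 1"
    and x_nonneg: "\<And>j \<tau>. j \<in> J \<Longrightarrow> \<tau> \<in> T j \<Longrightarrow> 0 \<le> x j \<tau>"
    and feasible: "\<And>B. B \<subseteq> Sigma J T \<Longrightarrow>
      (\<Sum>(j, \<tau>)\<in>B. p j \<tau> * x j \<tau>) \<le> 1 - (\<Prod>j\<in>J. \<Sum>\<tau>\<in>{\<tau>\<in>T j. (j, \<tau>) \<notin> B}. p j \<tau>)"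
    and worst: "\<And>ds. set ds \<subseteq> {0..1} \<Longrightarrow> \<Gamma> * (1 - survival ds) \<le> a - shortfall ds 1 a"
  shows "\<Gamma> * (\<Sum>j\<in>J. \<Sum>\<tau>\<in>T j. p j \<tau> * x j \<tau>) \<le>
    product_sum J p T (\<lambda>t. min (\<Sum>j\<in>J. x j (t j)) a)"
proof -
  define Y where "Y t = (\<Sum>j\<in>J. x j (t j))" for t
  define K where "K e = product_sum J p T (\<lambda>t. if t (fst e) = snd e \<and> Y t < a then 1 else 0) /
    p (fst e) (snd e) - \<Gamma>" for e
  define E where "E = Sigma J T"
  have finE: "finite E" unfolding E_def using finJ finT by (rule finite_SigmaI)
  obtain es where es: "set es = {e\<in>E. K e \<le> 0}" "distinct es" "sorted (map K es)"
  proof -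
    obtain xs where "set xs = {e\<in>E. K e \<le> 0}" "distinct xs"
      using finite_distinct_list[of "{e\<in>E. K e \<le> 0}"] finE by auto
    then show ?thesis using that[of "sort_key K xs"] by auto
  qed
  have TT: "\<forall>j\<in>J. T j \<subseteq> T j" and esE: "set es \<subseteq> Sigma J T"
    using es(1) by (auto simp: E_def)
  interpret weighted_types J p T
    using finJ finT p_pos by unfold_locales
  define \<phi> where "\<phi> = payoff J p es T"
  define c where "c e = p (fst e) (snd e) * (\<phi> (fst e) (snd e) - x (fst e) (snd e))" for e
  have mass1': "mass p T j = 1" if "j \<in> J" for j
    using mass1[OF that] by (simp add: mass_def)
  have W1: "total_mass J p T = 1"
    unfolding total_mass_def using mass1' by simp
  have sum_pt: "(\<Sum>(j, \<tau>)\<leftarrow>ps. p j \<tau> * \<phi> j \<tau> / mass p T j) = (\<Sum>(j, \<tau>)\<leftarrow>ps. p j \<tau> * \<phi> j \<tau>)"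
    if "set ps \<subseteq> Sigma J T" for ps
    using that mass1' by (intro arg_cong[where f = sum_list] map_cong) auto
  have prefix: "1 - total_mass J p (drop_types T ps) \<le> (\<Sum>(j, \<tau>)\<leftarrow>ps. p j \<tau> * \<phi> j \<tau>)"
    if "es = ps @ qs" for ps qs
  proof -
    have sub: "set ps \<subseteq> Sigma J T" using that esE by auto
    show ?thesis
      using payoff_prefix[OF TT es(2) esE that]
      unfolding \<phi>_def[symmetric] sum_pt[OF sub] W1 by simp
  qed
  have whole: "1 - total_mass J p (drop_types T es) = (\<Sum>(j, \<tau>)\<leftarrow>es. p j \<tau> * \<phi> j \<tau>)"
    using payoff_prefix[OF TT es(2) esE, of es "[]"]
    unfolding \<phi>_def[symmetric] sum_pt[OF esE] W1 by simp
  have nonpos: "(\<Sum>e\<leftarrow>es. K e * c e) \<le> 0"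
  proof -
    \<comment> \<open>The Border constraint for the set of pairs in the prefix bounds the mass of
      \<open>x\<close> from above, and \<open>payoff_prefix\<close> bounds that of
      \<open>\<phi>\<close> from below.\<close>
    have pre: "0 \<le> 0 + (\<Sum>e\<leftarrow>ps. c e)" if "es = ps @ qs" for ps qs
    proof -
      have d: "distinct ps" and sub: "set ps \<subseteq> Sigma J T" using that es(2) esE by auto
      have "(\<Sum>(j, \<tau>)\<leftarrow>ps. p j \<tau> * x j \<tau>) = (\<Sum>(j, \<tau>)\<in>set ps. p j \<tau> * x j \<tau>)"
        using d by (rule sum_list_distinct_conv_sum_set)
      also have "\<dots> \<le> 1 - (\<Prod>j\<in>J. \<Sum>\<tau>\<in>{\<tau>\<in>T j. (j, \<tau>) \<notin> set ps}. p j \<tau>)"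
        using sub by (rule feasible)
      also have "\<dots> = 1 - total_mass J p (drop_types T ps)"
      proof -
        have "drop_types T ps = (\<lambda>j. {\<tau>\<in>T j. (j, \<tau>) \<notin> set ps})"
          by (auto simp: drop_types_def fun_eq_iff)
        then show ?thesis by (simp add: total_mass_def mass_def)
      qed
      also note prefix[OF that]
      finally show ?thesis
        by (simp add: c_def case_prod_unfold right_diff_distrib sum_list_subtractf)
    qed
    have le0: "K e \<le> 0" if "e \<in> set es" for e using that es(1) by auto
    show ?thesis
    proof (cases es)
      case (Cons e es')
      have "K e \<le> 0" using Cons es(1) by auto
      moreover have "K e \<le> K e'" if "e' \<in> set es" for e'
        using that es(3) Cons by auto
      ultimately have "K e * 0 + (\<Sum>e\<leftarrow>es. K e * c e) \<le> 0"
        by (intro sum_list_sorted_nonpos[OF es(3) le0 pre])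
      then show ?thesis by simp
    qed simp
  qed
  have KE: "(\<Sum>e\<in>E. K e * c e) \<le> 0"
  proof -
    have "set es \<subseteq> E" using es(1) by auto
    then have "(\<Sum>e\<in>E. K e * c e) = (\<Sum>e\<in>E - set es. K e * c e) + (\<Sum>e\<in>set es. K e * c e)"
      using finE by (rule sum.subset_diff)
    moreover have "(\<Sum>e\<in>set es. K e * c e) \<le> 0"
      using nonpos unfolding sum_list_distinct_conv_sum_set[OF es(2)] .
    \<comment> \<open>Pairs of positive marginal value are left out of the list, so their payoff is
      0 and they contribute with the favourable sign.\<close>
    moreover have "(\<Sum>e\<in>E - set es. K e * c e) \<le> 0"
    proof (rule sum_nonpos)
      fix e assume e: "e \<in> E - set es"
      obtain j \<tau> where jt: "e = (j, \<tau>)" by fastforce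
      have jT: "j \<in> J" "\<tau> \<in> T j" and out: "(j, \<tau>) \<notin> set es"
        using e by (simp_all add: jt E_def)
      have "\<not> K e \<le> 0" using e es(1) by blast
      then have K: "0 \<le> K e" by simp
      have "\<phi> j \<tau> = 0" unfolding \<phi>_def using out by (rule payoff_outside)
      then have "c e = - (p j \<tau> * x j \<tau>)" by (simp add: c_def jt)
      moreover have "0 \<le> p j \<tau> * x j \<tau>"
        using p_pos[OF jT] x_nonneg[OF jT] by simp
      ultimately have "c e \<le> 0" by simp
      with K show "K e * c e \<le> 0" by (rule mult_nonneg_nonpos)
    qed
    ultimately show ?thesis by simp
  qed
  have margin: "product_sum J p T (\<lambda>t. if Y t < a then h (t j) else 0) =
      (\<Sum>\<tau>\<in>T j. p j \<tau> * (K (j, \<tau>) + \<Gamma>) * h \<tau>)" if "j \<in> J" for h :: "'t \<Rightarrow> real" and j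
  proof -
    have "product_sum J p T (\<lambda>t. if Y t < a then h (t j) else 0) =
      product_sum J p T (\<lambda>t. \<Sum>\<tau>\<in>T j. h \<tau> * (if t j = \<tau> \<and> Y t < a then 1 else 0))"
    proof (intro product_sum_cong refl)
      fix t assume "t \<in> PiE J T"
      then have "t j \<in> T j" using that by auto
      have "(\<Sum>\<tau>\<in>T j. h \<tau> * (if t j = \<tau> \<and> Y t < a then 1 else 0)) =
        (\<Sum>\<tau>\<in>T j. if t j = \<tau> then (if Y t < a then h \<tau> else 0) else 0)"
        by (intro sum.cong) auto
      also have "\<dots> = (if Y t < a then h (t j) else 0)"
        using \<open>t j \<in> T j\<close> finT[OF that] by simp
      finally show "(if Y t < a then h (t j) else 0) =
        (\<Sum>\<tau>\<in>T j. h \<tau> * (if t j = \<tau> \<and> Y t < a then 1 else 0))" by simp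
    qed
    also have "\<dots> = (\<Sum>\<tau>\<in>T j. h \<tau> * product_sum J p T (\<lambda>t. if t j = \<tau> \<and> Y t < a then 1 else 0))"
      by (simp only: product_sum_linear(2,3))
    also have "\<dots> = (\<Sum>\<tau>\<in>T j. p j \<tau> * (K (j, \<tau>) + \<Gamma>) * h \<tau>)"
    proof (rule sum.cong[OF refl])
      fix \<tau> assume "\<tau> \<in> T j"
      then have "p j \<tau> \<noteq> 0" using p_pos[OF that] by force
      then show "h \<tau> * product_sum J p T (\<lambda>t. if t j = \<tau> \<and> Y t < a then 1 else 0) =
        p j \<tau> * (K (j, \<tau>) + \<Gamma>) * h \<tau>" by (simp add: K_def)
    qed
    finally show ?thesis .
  qed
  let ?Z = "\<lambda>t. \<Sum>j\<in>J. \<phi> j (t j)"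
  \<comment> \<open>Tangent inequality for the concave function min y a at \<open>Y t\<close>, with
    slope 1 below a and 0 from a on.\<close>
  have pt: "min (?Z t) a - (\<Sum>j\<in>J. if Y t < a then \<phi> j (t j) - x j (t j) else 0) \<le> min (Y t) a" for t
    by (cases "Y t < a") (simp_all add: sum_subtractf Y_def[symmetric])
  have "product_sum J p T (\<lambda>t. min (?Z t) a) - (\<Sum>e\<in>E. (K e + \<Gamma>) * c e) =
    product_sum J p T (\<lambda>t. min (?Z t) a - (\<Sum>j\<in>J. if Y t < a then \<phi> j (t j) - x j (t j) else 0))"
  proof -
    have "(\<Sum>e\<in>E. (K e + \<Gamma>) * c e) = (\<Sum>j\<in>J. \<Sum>\<tau>\<in>T j. (K (j, \<tau>) + \<Gamma>) * c (j, \<tau>))"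
      unfolding E_def using finJ finT by (subst sum.Sigma) (auto simp: case_prod_unfold)
    also have "\<dots> = (\<Sum>j\<in>J. product_sum J p T (\<lambda>t. if Y t < a then \<phi> j (t j) - x j (t j) else 0))"
      by (intro sum.cong refl)
        (subst margin[where h = "\<lambda>\<tau>. \<phi> j \<tau> - x j \<tau>" for j], simp, simp add: c_def mult_ac)
    finally show ?thesis by (simp only: product_sum_linear(1,3))
  qed
  also have "\<dots> \<le> product_sum J p T (\<lambda>t. min (Y t) a)"
    by (rule product_sum_mono[OF _ pt]) (auto intro: less_imp_le p_pos)
  finally have main: "product_sum J p T (\<lambda>t. min (?Z t) a) - (\<Sum>e\<in>E. (K e + \<Gamma>) * c e)
    \<le> product_sum J p T (\<lambda>t. min (Y t) a)" .
  have "\<Gamma> * (1 - survival (hazards p es T)) \<le> a - shortfall (hazards p es T) 1 a"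
    using hazards_range[OF TT es(2) esE] by (rule worst)
  also have "shortfall (hazards p es T) 1 a \<ge> additive_shortfall J p T \<phi> a"
    using additive_shortfall_payoff[OF TT es(2) esE, of a] W1 by (simp add: \<phi>_def)
  then have "a - shortfall (hazards p es T) 1 a \<le> a - additive_shortfall J p T \<phi> a" by simp
  also have "\<dots> = product_sum J p T (\<lambda>t. min (?Z t) a)"
  proof -
    have "min z a = a - max 0 (a - z)" for z by auto
    then show ?thesis
      unfolding additive_shortfall_def
      using product_sum_const[OF finJ finT, where c = a and p = p] W1
      by (simp only: product_sum_linear(1) mult_1)
  qed
  finally have Z: "\<Gamma> * (1 - survival (hazards p es T)) \<le> product_sum J p T (\<lambda>t. min (?Z t) a)" .
  have "1 - survival (hazards p es T) = (\<Sum>(j, \<tau>)\<leftarrow>es. p j \<tau> * \<phi> j \<tau>)"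
    using whole survival_hazards[OF TT es(2) esE] W1 by simp
  also have "\<dots> = (\<Sum>(j, \<tau>)\<in>set es. p j \<tau> * \<phi> j \<tau>)"
    using es(2) by (rule sum_list_distinct_conv_sum_set)
  also have "\<dots> = (\<Sum>(j, \<tau>)\<in>E. p j \<tau> * \<phi> j \<tau>)"
  proof (rule sum.mono_neutral_left[OF finE])
    show "set es \<subseteq> E" using esE by (simp add: E_def)
    show "\<forall>e\<in>E - set es. (case e of (j, \<tau>) \<Rightarrow> p j \<tau> * \<phi> j \<tau>) = 0"
      by (auto simp: \<phi>_def payoff_outside)
  qed
  also have "\<dots> = (\<Sum>e\<in>E. c e) + (\<Sum>(j, \<tau>)\<in>E. p j \<tau> * x j \<tau>)"
    by (simp add: c_def sum.distrib[symmetric] case_prod_unfold algebra_simps)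
  also have "(\<Sum>(j, \<tau>)\<in>E. p j \<tau> * x j \<tau>) = (\<Sum>j\<in>J. \<Sum>\<tau>\<in>T j. p j \<tau> * x j \<tau>)"
    unfolding E_def using finJ finT by (subst sum.Sigma) auto
  finally have surv: "1 - survival (hazards p es T) =
    (\<Sum>e\<in>E. c e) + (\<Sum>j\<in>J. \<Sum>\<tau>\<in>T j. p j \<tau> * x j \<tau>)" .
  \<comment> \<open>By \<open>surv\<close>, the sum of c is the difference of the total masses of
    payoffs and \<open>x\<close>. Its \<Gamma>-fold is what turns the bound for the payoffs into the
    bound for \<open>x\<close>; the remaining sum has the right sign by \<open>KE\<close>.\<close>
  have "(\<Sum>e\<in>E. (K e + \<Gamma>) * c e) = (\<Sum>e\<in>E. K e * c e) + \<Gamma> * (\<Sum>e\<in>E. c e)"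
    by (simp add: distrib_right sum.distrib sum_distrib_left)
  with main Z KE surv show ?thesis
    unfolding Y_def by (simp add: algebra_simps)
qed

section \<open>The Dickman bound\<close>

definition quartic :: "real \<Rightarrow> real \<Rightarrow> real \<Rightarrow> real \<Rightarrow> real \<Rightarrow> real \<Rightarrow> real" where
  "quartic a b c d e s = a + b * s + c * s ^ 2 + d * s ^ 3 + e * s ^ 4"

lemma quartic_deriv:
  "((\<lambda>z. quartic a b c d e (z - k)) has_real_derivative
      quartic b (2 * c) (3 * d) (4 * e) 0 (z - k)) (at z)"
  unfolding quartic_def by (auto intro!: derivative_eq_intros simp: algebra_simps)

text \<open>The last five premises say that the Bernstein coefficients on \<open>[l, u]\<close> are nonnegative.\<close>

lemma quartic_nonneg:
  assumes "l \<le> s" "s \<le> u" "l < u"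
    and "0 \<le> quartic a b c d e l" "0 \<le> quartic a b c d e u"
    and "0 \<le> a + b * (3*l + u) / 4 + c * (l^2 + l*u) / 2 + d * (l^3 + 3*l^2*u) / 4 + e * (l^3*u)"
    and "0 \<le> a + b * (l + u) / 2 + c * (l^2 + 4*l*u + u^2) / 6 + d * (l^2*u + l*u^2) / 2 + e * (l^2*u^2)"
    and "0 \<le> a + b * (l + 3*u) / 4 + c * (u^2 + l*u) / 2 + d * (u^3 + 3*u^2*l) / 4 + e * (l*u^3)"
  shows "0 \<le> quartic a b c d e s"
proof -
  define B1 where "B1 = a + b * (3*l + u) / 4 + c * (l^2 + l*u) / 2 + d * (l^3 + 3*l^2*u) / 4 + e * (l^3*u)"
  define B2 where "B2 = a + b * (l + u) / 2 + c * (l^2 + 4*l*u + u^2) / 6 + d * (l^2*u + l*u^2) / 2 + e * (l^2*u^2)"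
  define B3 where "B3 = a + b * (l + 3*u) / 4 + c * (u^2 + l*u) / 2 + d * (u^3 + 3*u^2*l) / 4 + e * (l*u^3)"
  let ?x = "s - l" and ?y = "u - s"
  have "(u - l) ^ 4 * quartic a b c d e s =
      quartic a b c d e l * ?y ^ 4 + 4 * B1 * (?x * ?y ^ 3) + 6 * B2 * (?x ^ 2 * ?y ^ 2)
      + 4 * B3 * (?x ^ 3 * ?y) + quartic a b c d e u * ?x ^ 4"
    unfolding quartic_def B1_def B2_def B3_def by (simp add: field_simps) algebra
  also have "\<dots> \<ge> 0"
    using assms unfolding B1_def[symmetric] B2_def[symmetric] B3_def[symmetric]
    by (intro add_nonneg_nonneg mult_nonneg_nonneg) auto
  finally show ?thesis
    using assms(3) by (simp add: zero_le_mult_iff)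
qed

lemma quartic_mono_on:
  assumes "\<And>s. 0 \<le> s \<Longrightarrow> s \<le> 1 \<Longrightarrow> 0 \<le> quartic b (2 * c) (3 * d) (4 * e) 0 s" "r = l + 1"
  shows "mono_on {l..r} (\<lambda>z. quartic a b c d e (z - l))"
proof (rule mono_onI)
  fix z w assume *: "z \<in> {l..r}" "w \<in> {l..r}" "z \<le> w"
  show "quartic a b c d e (z - l) \<le> quartic a b c d e (w - l)"
    using *(3)
  proof (rule DERIV_nonneg_imp_nondecreasing)
    fix v assume "z \<le> v" "v \<le> w"
    then show "\<exists>y. ((\<lambda>z. quartic a b c d e (z - l)) has_real_derivative y) (at v) \<and> 0 \<le> y"
      using quartic_deriv[of a b c d e l v] assms(1)[of "v - l"] assms(2) *
      by (intro exI[of _ "quartic b (2 * c) (3 * d) (4 * e) 0 (v - l)"]) auto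
  qed
qed

text \<open>The residual of the delay equation at z = s + k, for the piece starting at k; the
  coefficients b belong to the preceding piece, which is evaluated at z - 1 and so has the same
  local variable s.\<close>

lemma quartic_residual:
  "2 * quartic a0 a1 a2 a3 a4 s - (s + k) * quartic a1 (2 * a2) (3 * a3) (4 * a4) 0 s
    - quartic b0 b1 b2 b3 b4 s =
   quartic (2 * a0 - k * a1 - b0) (a1 - 2 * k * a2 - b1) (- 3 * k * a3 - b2)
     (- a3 - 4 * k * a4 - b3) (- 2 * a4 - b4) s"
  unfolding quartic_def by (simp add: algebra_simps power2_eq_square power3_eq_cube power4_eq_xxxx)

section \<open>A piecewise polynomial supersolution\<close>

lemma has_real_derivative_glue:
  assumes "\<And>z. (f has_real_derivative f' z) (at z)" "\<And>z. (g has_real_derivative g' z) (at z)"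
    and "f c = g c" "f' c = g' c"
  shows "((\<lambda>z. if z \<le> c then f z else g z) has_real_derivative (if z \<le> c then f' z else g' z)) (at z)"
proof -
  let ?h = "\<lambda>z. if z \<le> c then f z else g z"
  consider "z < c" | "z > c" | "z = c" by linarith
  then show ?thesis
  proof cases
    case 1
    have "\<forall>\<^sub>F y in nhds z. ?h y = f y"
      using 1 by (auto simp: eventually_nhds intro!: exI[of _ "{..<c}"])
    with assms(1)[of z] 1 show ?thesis by (simp add: DERIV_cong_ev)
  next
    case 2
    have "\<forall>\<^sub>F y in nhds z. ?h y = g y"
      using 2 by (auto simp: eventually_nhds intro!: exI[of _ "{c<..}"])
    with assms(2)[of z] 2 show ?thesis by (simp add: DERIV_cong_ev)
  next
    case 3
    have "((\<lambda>y. (?h y - ?h c) / (y - c)) \<longlongrightarrow> f' c) (at_left c)"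
    proof (rule Lim_transform_eventually)
      show "((\<lambda>y. (f y - f c) / (y - c)) \<longlongrightarrow> f' c) (at_left c)"
        using assms(1)[of c] filterlim_at_split[of _ _ c] by (auto simp: has_field_derivative_iff)
      show "\<forall>\<^sub>F y in at_left c. (f y - f c) / (y - c) = (?h y - ?h c) / (y - c)"
        by (auto simp: eventually_at_filter)
    qed
    moreover have "((\<lambda>y. (?h y - ?h c) / (y - c)) \<longlongrightarrow> f' c) (at_right c)"
    proof (rule Lim_transform_eventually)
      show "((\<lambda>y. (g y - g c) / (y - c)) \<longlongrightarrow> f' c) (at_right c)"
        using assms(2)[of c] filterlim_at_split[of _ _ c] assms(4) by (auto simp: has_field_derivative_iff)
      show "\<forall>\<^sub>F y in at_right c. (g y - g c) / (y - c) = (?h y - ?h c) / (y - c)"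
        using assms(3) by (auto simp: eventually_at_filter)
    qed
    ultimately have "(?h has_real_derivative f' c) (at c)"
      unfolding has_field_derivative_iff filterlim_at_split[of _ _ c] by simp
    with 3 show ?thesis by simp
  qed
qed

lemma mono_on_glue:
  fixes f g :: "real \<Rightarrow> real"
  assumes "mono_on {l..c} f" "mono_on {c..} g" "f c = g c" "l \<le> c"
  shows "mono_on {l..} (\<lambda>z. if z \<le> c then f z else g z)"
proof (rule mono_onI)
  fix r s assume *: "r \<in> {l..}" "s \<in> {l..}" "r \<le> s"
  have "f r \<le> g s" if "r \<le> c" "c \<le> s"
    using mono_onD[OF assms(1), of r c] mono_onD[OF assms(2), of c s] that * assms(3,4) by auto
  then show "(if r \<le> c then f r else g r) \<le> (if s \<le> c then f s else g s)"
    using * mono_onD[OF assms(1), of r s] mono_onD[OF assms(2), of r s] by auto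
qed

text \<open>
  For a Dickman distributed \<open>D\<close> the function \<open>\<psi> z = E (max 0 (z - D))\<close> solves
  \<open>z \<psi>' z = 2 \<psi> z - \<psi> (z - 1)\<close>, with \<open>\<psi> z = exp (-\<gamma>) z\<^sup>2 / 2\<close> on \<open>[0, 1]\<close>. The definition below
  is a continuously differentiable, convex, piecewise polynomial with \<open>\<le>\<close> instead of \<open>=\<close>. Its
  coefficients come from collocation, starting from \<open>0.56184\<close> instead of \<open>exp (-\<gamma>) = 0.56145\<dots>\<close>.
\<close>

definition dickman_bound :: "real \<Rightarrow> real" where
  "dickman_bound z = (
    if z \<le> 0 then 0 else
    if z \<le> 1 then quartic 0 0 (28092/100000) 0 0 z else
    if z \<le> 2 then quartic (28092/100000) (56184/100000) (27836/100000) (- 8498/100000) (1062/100000) (z - 1) else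
    if z \<le> 3 then quartic (104676/100000) (90610/100000) (8491/100000) (- 4121/100000) (890/100000) (z - 2) else
    if z \<le> 4 then quartic (200546/100000) (98789/100000) (1354/100000) (- 814/100000) (211/100000) (z - 3) else
    if z \<le> 5 then quartic (300086/100000) (99899/100000) (148/100000) (- 107/100000) (32/100000) (z - 4) else
    quartic (400058/100000) (100002/100000) 0 0 0 (z - 5))"

definition dickman_slope :: "real \<Rightarrow> real" where
  "dickman_slope z = (
    if z \<le> 0 then 0 else
    if z \<le> 1 then quartic 0 (56184/100000) 0 0 0 z else
    if z \<le> 2 then quartic (56184/100000) (55672/100000) (- 25494/100000) (4248/100000) 0 (z - 1) else
    if z \<le> 3 then quartic (90610/100000) (16982/100000) (- 12363/100000) (3560/100000) 0 (z - 2) else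
    if z \<le> 4 then quartic (98789/100000) (2708/100000) (- 2442/100000) (844/100000) 0 (z - 3) else
    if z \<le> 5 then quartic (99899/100000) (296/100000) (- 321/100000) (128/100000) 0 (z - 4) else
    quartic (100002/100000) 0 0 0 0 (z - 5))"

lemma dickman_bound_deriv: "(dickman_bound has_real_derivative dickman_slope z) (at z)"
proof -
  have D: "((\<lambda>z. quartic a b c d e (z - k)) has_real_derivative quartic a' b' c' d' e' (z - k)) (at z)"
    if "a' = b" "b' = 2 * c" "c' = 3 * d" "d' = 4 * e" "e' = 0" for a b c d e a' b' c' d' e' k z
    using quartic_deriv[of a b c d e k z] that by simp
  have D0: "(quartic a b c d e has_real_derivative quartic a' b' c' d' e' z) (at z)"
    if "a' = b" "b' = 2 * c" "c' = 3 * d" "d' = 4 * e" "e' = 0" for a b c d e a' b' c' d' e' z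
    using D[OF that, of a 0 z] by simp
  show ?thesis
    unfolding dickman_bound_def[abs_def] dickman_slope_def
    by (intro has_real_derivative_glue D D0 DERIV_const) (simp_all add: quartic_def)
qed

lemma dickman_slope_mono: "mono dickman_slope"
proof (rule monoI)
  note nonneg = quartic_nonneg[of 0 _ 1]
  fix z w :: real assume "z \<le> w"
  \<comment> \<open>A left endpoint that covers \<open>z\<close> and makes the zero piece an
    interval \<open>{l..0}\<close>, as the gluing lemma wants.\<close>
  define l where "l = min z 0"
  have M0: "mono_on {0..1} (quartic 0 a 0 0 0)" if "0 \<le> a" for a
    using that by (auto intro!: mono_onI mult_left_mono simp: quartic_def)
  \<comment> \<open>The numerical premises are the Bernstein coefficients of the derivative on the
    unit interval.\<close>
  have M: "mono_on {k..r} (\<lambda>z. quartic a b c d 0 (z - k))"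
    if "r = k + 1" "0 \<le> b" "0 \<le> b + c / 2" "0 \<le> b + c + d / 2"
      "0 \<le> b + 3 * c / 2 + 3 * d / 2" "0 \<le> b + 2 * c + 3 * d" for a b c d k r
    by (rule quartic_mono_on[OF _ that(1)], rule nonneg) (use that in \<open>simp_all add: quartic_def\<close>)
  have M5: "mono_on {5..} (\<lambda>z. quartic a 0 0 0 0 (z - 5))" for a
    by (simp add: quartic_def mono_on_def)
  have "mono_on {l..} dickman_slope"
    unfolding dickman_slope_def[abs_def]
    by (intro mono_on_glue M0 M M5) (simp_all add: quartic_def l_def mono_on_def)
  then show "dickman_slope z \<le> dickman_slope w"
    using \<open>z \<le> w\<close> by (auto simp: l_def mono_on_def)
qed

lemma dickman_bound_residual:
  "dickman_bound (z - 1) \<le> 2 * dickman_bound z - z * dickman_slope z"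
proof -
  consider "z \<le> 0" | "0 < z" "z \<le> 1" | "1 < z" "z \<le> 2" | "2 < z" "z \<le> 3" | "3 < z" "z \<le> 4" |
    "4 < z" "z \<le> 5" | "5 < z" "z \<le> 6" | "6 < z" by linarith
  then show ?thesis
  proof cases
    case 1
    then show ?thesis by (simp add: dickman_bound_def dickman_slope_def)
  next
    case 2
    then show ?thesis
      by (simp add: dickman_bound_def dickman_slope_def quartic_def power2_eq_square)
  next
    case 3
    define s where "s = z - 1"
    have s: "z = s + 1" "0 < s" "s \<le> 1" using 3 by (auto simp: s_def)
    have "0 \<le> quartic 0 (512/100000) (- 2598/100000) (4250/100000) (- 2124/100000) s"
    proof -
      \<comment> \<open>Over all of [0, 1] some Bernstein coefficient is negative, so the interval
        is subdivided; the next three pieces are treated likewise.\<close>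
      consider "0 \<le> s" "s \<le> 1/2" | "1/2 \<le> s" "s \<le> 1" using s by linarith
      then show ?thesis
      proof cases
        case 1
        then show ?thesis by (rule quartic_nonneg) (simp_all add: quartic_def power_divide)
      next
        case 2
        then show ?thesis by (rule quartic_nonneg) (simp_all add: quartic_def power_divide)
      qed
    qed
    also have "\<dots> = 2 * (quartic (28092/100000) (56184/100000) (27836/100000) (- 8498/100000) (1062/100000) s) - (s + 1) * (quartic (56184/100000) (55672/100000) (- 25494/100000) (4248/100000) 0 s) - quartic 0 0 (28092/100000) 0 0 s"
      using quartic_residual[of "(28092/100000)" "(56184/100000)" "(27836/100000)" "(- 8498/100000)" "(1062/100000)" s 1 "0" "0" "(28092/100000)" "0" "0"] by simp
    finally show ?thesis
      using s(2,3) unfolding dickman_bound_def dickman_slope_def s(1) by simp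
  next
    case 4
    define s where "s = z - 2"
    have s: "z = s + 2" "0 < s" "s \<le> 1" using 4 by (auto simp: s_def)
    have "0 \<le> quartic (40/100000) (462/100000) (- 3110/100000) (5499/100000) (- 2842/100000) s"
    proof -
      consider "0 \<le> s" "s \<le> 1/4" | "1/4 \<le> s" "s \<le> 3/8" | "3/8 \<le> s" "s \<le> 1/2" | "1/2 \<le> s" "s \<le> 1" using s by linarith
      then show ?thesis
      proof cases
        case 1
        then show ?thesis by (rule quartic_nonneg) (simp_all add: quartic_def power_divide)
      next
        case 2
        then show ?thesis by (rule quartic_nonneg) (simp_all add: quartic_def power_divide)
      next
        case 3
        then show ?thesis by (rule quartic_nonneg) (simp_all add: quartic_def power_divide)
      next
        case 4
        then show ?thesis by (rule quartic_nonneg) (simp_all add: quartic_def power_divide)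
      qed
    qed
    also have "\<dots> = 2 * (quartic (104676/100000) (90610/100000) (8491/100000) (- 4121/100000) (890/100000) s) - (s + 2) * (quartic (90610/100000) (16982/100000) (- 12363/100000) (3560/100000) 0 s) - quartic (28092/100000) (56184/100000) (27836/100000) (- 8498/100000) (1062/100000) s"
      using quartic_residual[of "(104676/100000)" "(90610/100000)" "(8491/100000)" "(- 4121/100000)" "(890/100000)" s 2 "(28092/100000)" "(56184/100000)" "(27836/100000)" "(- 8498/100000)" "(1062/100000)"] by simp
    finally show ?thesis
      using s(2,3) unfolding dickman_bound_def dickman_slope_def s(1) by simp
  next
    case 5
    define s where "s = z - 3"
    have s: "z = s + 3" "0 < s" "s \<le> 1" using 5 by (auto simp: s_def)
    have "0 \<le> quartic (49/100000) (55/100000) (- 1165/100000) (2403/100000) (- 1312/100000) s"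
    proof -
      consider "0 \<le> s" "s \<le> 1/4" | "1/4 \<le> s" "s \<le> 1/2" | "1/2 \<le> s" "s \<le> 1" using s by linarith
      then show ?thesis
      proof cases
        case 1
        then show ?thesis by (rule quartic_nonneg) (simp_all add: quartic_def power_divide)
      next
        case 2
        then show ?thesis by (rule quartic_nonneg) (simp_all add: quartic_def power_divide)
      next
        case 3
        then show ?thesis by (rule quartic_nonneg) (simp_all add: quartic_def power_divide)
      qed
    qed
    also have "\<dots> = 2 * (quartic (200546/100000) (98789/100000) (1354/100000) (- 814/100000) (211/100000) s) - (s + 3) * (quartic (98789/100000) (2708/100000) (- 2442/100000) (844/100000) 0 s) - quartic (104676/100000) (90610/100000) (8491/100000) (- 4121/100000) (890/100000) s"
      using quartic_residual[of "(200546/100000)" "(98789/100000)" "(1354/100000)" "(- 814/100000)" "(211/100000)" s 3 "(104676/100000)" "(90610/100000)" "(8491/100000)" "(- 4121/100000)" "(890/100000)"] by simp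
    finally show ?thesis
      using s(2,3) unfolding dickman_bound_def dickman_slope_def s(1) by simp
  next
    case 6
    define s where "s = z - 4"
    have s: "z = s + 4" "0 < s" "s \<le> 1" using 6 by (auto simp: s_def)
    have "0 \<le> quartic (30/100000) (- 74/100000) (- 70/100000) (409/100000) (- 275/100000) s"
    proof -
      consider "0 \<le> s" "s \<le> 1/2" | "1/2 \<le> s" "s \<le> 1" using s by linarith
      then show ?thesis
      proof cases
        case 1
        then show ?thesis by (rule quartic_nonneg) (simp_all add: quartic_def power_divide)
      next
        case 2
        then show ?thesis by (rule quartic_nonneg) (simp_all add: quartic_def power_divide)
      qed
    qed
    also have "\<dots> = 2 * (quartic (300086/100000) (99899/100000) (148/100000) (- 107/100000) (32/100000) s) - (s + 4) * (quartic (99899/100000) (296/100000) (- 321/100000) (128/100000) 0 s) - quartic (200546/100000) (98789/100000) (1354/100000) (- 814/100000) (211/100000) s"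
      using quartic_residual[of "(300086/100000)" "(99899/100000)" "(148/100000)" "(- 107/100000)" "(32/100000)" s 4 "(200546/100000)" "(98789/100000)" "(1354/100000)" "(- 814/100000)" "(211/100000)"] by simp
    finally show ?thesis
      using s(2,3) unfolding dickman_bound_def dickman_slope_def s(1) by simp
  next
    case 7
    define s where "s = z - 5"
    have s: "z = s + 5" "0 < s" "s \<le> 1" using 7 by (auto simp: s_def)
    have "0 \<le> quartic (20/100000) (103/100000) (- 148/100000) (107/100000) (- 32/100000) s"
    proof -
      show ?thesis using s(2,3) by (intro quartic_nonneg[of 0 s 1]) (simp_all add: quartic_def)
    qed
    also have "\<dots> = 2 * (quartic (400058/100000) (100002/100000) 0 0 0 s) - (s + 5) * (quartic (100002/100000) 0 0 0 0 s) - quartic (300086/100000) (99899/100000) (148/100000) (- 107/100000) (32/100000) s"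
      using quartic_residual[of "(400058/100000)" "(100002/100000)" "0" "0" "0" s 5 "(300086/100000)" "(99899/100000)" "(148/100000)" "(- 107/100000)" "(32/100000)"] by simp
    finally show ?thesis
      using s(2,3) unfolding dickman_bound_def dickman_slope_def s(1) by simp
  next
    case 8
    then have "dickman_bound z * 100000 = 100002 * z - 99952"
      "dickman_bound (z - 1) * 100000 = 100002 * z - 199954"
      "z * dickman_slope z * 100000 = 100002 * z"
      by (simp_all add: dickman_bound_def dickman_slope_def quartic_def field_simps)
    then show ?thesis by linarith
  qed
qed

lemma dickman_tangent:
  "dickman_bound y + dickman_slope y * (z - y) \<le> dickman_bound z"
proof (cases y z rule: linorder_cases)
  case less
  then obtain w where w: "y < w" "dickman_bound z - dickman_bound y = (z - y) * dickman_slope w"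
    using MVT2[of y z dickman_bound dickman_slope] dickman_bound_deriv by blast
  have "dickman_slope y * (z - y) \<le> dickman_slope w * (z - y)"
    using monoD[OF dickman_slope_mono, of y w] w(1) less by (intro mult_right_mono) auto
  with w(2) show ?thesis by (simp add: mult.commute)
next
  case greater
  then obtain w where w: "w < y" "dickman_bound y - dickman_bound z = (y - z) * dickman_slope w"
    using MVT2[of z y dickman_bound dickman_slope] dickman_bound_deriv by blast
  have "dickman_slope w * (y - z) \<le> dickman_slope y * (y - z)"
    using monoD[OF dickman_slope_mono, of w y] w(1) greater by (intro mult_right_mono) auto
  with w(2) show ?thesis by (simp add: algebra_simps)
qed simp

text \<open>The analogue of Jensen's inequality for a variable of mean 1. It lets the bound absorb a
  successful test after which nothing follows.\<close>

lemma dickman_bound_ge: "max 0 (z - 1) \<le> dickman_bound z"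
proof -
  have "0 \<le> dickman_bound z"
    using dickman_tangent[of 0 z] by (simp add: dickman_bound_def dickman_slope_def)
  moreover have "z - 1 \<le> dickman_bound z" if "1 \<le> z"
  proof -
    \<comment> \<open>The tangent at 6 has slope above 1 and is still positive at z = 1, so it stays
      above z - 1 from there on.\<close>
    have "dickman_bound 6 = 500060/100000" "dickman_slope 6 = 100002/100000"
      by (simp_all add: dickman_bound_def dickman_slope_def quartic_def)
    then have "500060/100000 + 100002/100000 * (z - 6) \<le> dickman_bound z"
      using dickman_tangent[of 6 z] by (simp only:)
    then show ?thesis using that by (simp add: field_simps)
  qed
  ultimately show ?thesis by (cases "1 \<le> z") (simp_all add: max_def)
qed

text \<open>For fixed \<open>a\<close>, the left-hand side is nondecreasing in \<open>b\<close> and equals the right-hand side at \<open>b = 1\<close>.\<close>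

lemma dickman_bound_step:
  assumes "0 < b" "b \<le> 1"
  shows "(1 - b) * b * dickman_bound ((a - 1) / b) + b ^ 2 * dickman_bound (a / b) \<le> dickman_bound a"
proof -
  define G where "G b = (1 - b) * b * dickman_bound ((a - 1) / b) + b ^ 2 * dickman_bound (a / b)" for b
  have "G b \<le> G 1"
    using assms(2)
  proof (rule DERIV_nonneg_imp_nondecreasing)
    fix c assume c: "b \<le> c" "c \<le> 1"
    with assms(1) have c0: "0 < c" by simp
    define y z where "y = (a - 1) / c" and "z = a / c"
    \<comment> \<open>At c = 1 this is exactly the residual of the delay inequality; for smaller c
      the tangent at y bridges the gap between y and z - 1.\<close>
    let ?D = "(1 - 2 * c) * dickman_bound y - (1 - c) * y * dickman_slope y
      + c * (2 * dickman_bound z - z * dickman_slope z)"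
    have comp: "((\<lambda>b. dickman_bound (v / b)) has_real_derivative dickman_slope (v / c) * (- v / c ^ 2)) (at c)" for v
    proof -
      have "((\<lambda>b. v / b) has_real_derivative - v / c ^ 2) (at c)"
        using c0 by (auto intro!: derivative_eq_intros simp: power2_eq_square)
      then show ?thesis by (rule DERIV_chain2[OF dickman_bound_deriv])
    qed
    have "(G has_real_derivative ?D) (at c)"
      unfolding G_def[abs_def] using c0
      by (auto intro!: derivative_eq_intros comp simp: y_def z_def field_simps power2_eq_square)
    moreover have "0 \<le> ?D"
    proof -
      have "z - 1 - y = (1 - c) / c"
        using c0 by (simp add: y_def z_def field_simps)
      then have "dickman_bound y + dickman_slope y * ((1 - c) / c) \<le> dickman_bound (z - 1)"
        using dickman_tangent[of y "z - 1"] by simp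
      also have "\<dots> \<le> 2 * dickman_bound z - z * dickman_slope z"
        by (rule dickman_bound_residual)
      finally have "c * (dickman_bound y + dickman_slope y * ((1 - c) / c)) \<le>
          c * (2 * dickman_bound z - z * dickman_slope z)"
        using c0 by (intro mult_left_mono) auto
      then have 1: "c * dickman_bound y + (1 - c) * dickman_slope y \<le>
          c * (2 * dickman_bound z - z * dickman_slope z)"
        using c0 by (simp add: distrib_left mult.commute)
      \<comment> \<open>The tangent at y bounds the value at y - 1 from below, and the delay
        inequality at y bounds it from above.\<close>
      have "0 \<le> dickman_bound y + dickman_slope y * (1 - y)"
        using dickman_bound_residual[of y] dickman_tangent[of y "y - 1"] by (simp add: algebra_simps)
      then have "0 \<le> (1 - c) * (dickman_bound y + dickman_slope y * (1 - y))"
        using c(2) by simp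
      with 1 show ?thesis by (simp add: algebra_simps)
    qed
    ultimately show "\<exists>D. (G has_real_derivative D) (at c) \<and> 0 \<le> D" by blast
  qed
  then show ?thesis by (simp add: G_def)
qed

section \<open>Bounding the extremal sums\<close>

text \<open>In the part weighted by the survival of the tail, the success branch
  \<open>max 0 (z - v)\<close> is moved into the Dickman term by \<open>dickman_bound_ge\<close>;
  the other part is \<open>dickman_bound_step\<close> with b = 1 - d. Stating the bound as a mixture
  makes it close under this recursion.\<close>

lemma shortfall_le_dickman:
  assumes "set ds \<subseteq> {0..1}" "0 < v"
  shows "shortfall ds v z \<le> survival ds * max 0 z + (1 - survival ds) * (v * dickman_bound (z / v))"
  using assms
proof (induction ds arbitrary: v z)
  case Nil
  then show ?case by (simp add: survival_def)
next
  case (Cons d ds)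
  let ?s = "survival ds" and ?b = "1 - d" and ?\<psi> = dickman_bound
  have d: "0 \<le> d" "d \<le> 1" using Cons.prems by auto
  have s: "0 \<le> ?s" "?s \<le> 1"
    using Cons.prems unfolding survival_def
    by (induction ds) (auto intro!: mult_nonneg_nonneg mult_le_one)
  have ge: "max 0 (z - v) \<le> v * ?\<psi> (z / v)"
  proof -
    have "v * max 0 (z / v - 1) \<le> v * ?\<psi> (z / v)"
      using Cons.prems(2) by (intro mult_left_mono dickman_bound_ge) auto
    then show ?thesis using Cons.prems(2) by (simp add: max_mult_distrib_left right_diff_distrib)
  qed
  show ?case
  \<comment> \<open>With d = 1 the tail has scale 0, where the induction hypothesis does not apply,
    and only the sure payment of v is left.\<close>
  proof (cases "d = 1")
    case True
    then show ?thesis using ge by (simp add: survival_def shortfall_zero_scale)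
  next
    case False
    with d have b: "0 < ?b" "?b \<le> 1" by auto
    let ?y = "(z - v) / (?b * v)" and ?z = "z / (?b * v)"
    have IH: "shortfall ds (?b * v) w \<le> ?s * max 0 w + (1 - ?s) * (?b * v * ?\<psi> (w / (?b * v)))" for w
      using Cons.prems b by (intro Cons.IH) auto
    have step: "d * (?b * v * ?\<psi> ?y) + ?b * (?b * v * ?\<psi> ?z) \<le> v * ?\<psi> (z / v)"
    proof -
      have eq: "(z / v - 1) / ?b = ?y" "z / v / ?b = ?z"
        using Cons.prems(2) b by (simp_all add: field_simps)
      have "v * ((1 - ?b) * ?b * ?\<psi> ?y + ?b ^ 2 * ?\<psi> ?z) \<le> v * ?\<psi> (z / v)"
        using dickman_bound_step[OF b, of "z / v"] Cons.prems(2) unfolding eq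
        by (intro mult_left_mono) simp_all
      then show ?thesis by (simp add: power2_eq_square algebra_simps)
    qed
    have "shortfall (d # ds) v z \<le>
        d * (?s * max 0 (z - v) + (1 - ?s) * (?b * v * ?\<psi> ?y)) +
        ?b * (?s * max 0 z + (1 - ?s) * (?b * v * ?\<psi> ?z))"
      unfolding shortfall.simps using d by (intro add_mono mult_left_mono IH) auto
    also have "\<dots> = ?s * (d * max 0 (z - v)) + ?s * ?b * max 0 z +
        (1 - ?s) * (d * (?b * v * ?\<psi> ?y) + ?b * (?b * v * ?\<psi> ?z))"
      by (simp add: algebra_simps)
    also have "\<dots> \<le> ?s * (d * (v * ?\<psi> (z / v))) + ?s * ?b * max 0 z + (1 - ?s) * (v * ?\<psi> (z / v))"
      using s d ge step by (intro add_mono mult_left_mono) auto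
    also have "\<dots> = survival (d # ds) * max 0 z + (1 - survival (d # ds)) * (v * ?\<psi> (z / v))"
      by (simp add: survival_def algebra_simps)
    finally show ?thesis .
  qed
qed

lemma shortfall_bound:
  assumes "set ds \<subseteq> {0..1}" "0 \<le> a"
  shows "(a - dickman_bound a) * (1 - survival ds) \<le> a - shortfall ds 1 a"
  using shortfall_le_dickman[OF assms(1), of 1 a] assms(2) by (simp add: algebra_simps)

section \<open>Piecewise linear minorant of the OCS bound\<close>

text \<open>The lower bound serves the numerical evaluation, the upper bound concavity.\<close>

lemma ocs_bound_cubic_coeff:
  "17863/100000 \<le> (4 - 2 * sqrt 3) / 3" "(4 - 2 * sqrt 3) / 3 \<le> 1/3"
proof -
  have "sqrt 3 \<le> 173205081/100000000" by (rule real_le_lsqrt) (simp_all add: power2_eq_square)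
  moreover have "3/2 \<le> sqrt 3" by (rule real_le_rsqrt) (simp add: power2_eq_square)
  ultimately show "17863/100000 \<le> (4 - 2 * sqrt 3) / 3" "(4 - 2 * sqrt 3) / 3 \<le> 1/3"
    by simp_all
qed

lemma ocs_bound_concave: "concave_on {0..} ocs_bound"
proof -
  define c where "c = (4 - 2 * sqrt 3) / 3"
  have c: "0 \<le> c" "c \<le> 1/3" using ocs_bound_cubic_coeff by (simp_all add: c_def)
  let ?e = "\<lambda>y. exp (- y - y\<^sup>2 / 2 - c * y ^ 3)" and ?p = "\<lambda>y. 1 + y + 3 * c * y\<^sup>2"
  show ?thesis
    unfolding ocs_bound_def[abs_def] c_def[symmetric]
  proof (rule f''_le0_imp_concave)
    fix y :: real assume "y \<in> {0..}"
    then have y: "0 \<le> y" by simp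
    show "((\<lambda>y. 1 - ?e y) has_real_derivative ?e y * ?p y) (at y)"
      by (auto intro!: derivative_eq_intros simp: algebra_simps)
    show "((\<lambda>y. ?e y * ?p y) has_real_derivative ?e y * (1 + 6 * c * y) - ?e y * ?p y * ?p y) (at y)"
      by (auto intro!: derivative_eq_intros simp: algebra_simps power2_eq_square)
    have "1 + 6 * c * y \<le> 1 + 2 * y"
      using mult_right_mono[OF c(2) y] by simp
    also have "\<dots> \<le> (1 + y) * (1 + y)"
      by (simp add: algebra_simps)
    also have "\<dots> \<le> ?p y * ?p y"
      using y c(1) by (intro mult_mono) auto
    finally have "?e y * (1 + 6 * c * y) \<le> ?e y * (?p y * ?p y)"
      by (intro mult_left_mono) auto
    then show "?e y * (1 + 6 * c * y) - ?e y * ?p y * ?p y \<le> 0" by (simp add: mult.assoc)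
  qed auto
qed

lemma ocs_bound_mono: "mono_on {0..} ocs_bound"
proof (rule mono_onI)
  fix x y :: real assume "x \<in> {0..}" "y \<in> {0..}" "x \<le> y"
  moreover have "0 \<le> (4 - 2 * sqrt 3) / 3" using ocs_bound_cubic_coeff by simp
  ultimately have "x + x\<^sup>2 / 2 + (4 - 2 * sqrt 3) / 3 * x ^ 3 \<le> y + y\<^sup>2 / 2 + (4 - 2 * sqrt 3) / 3 * y ^ 3"
    by (intro add_mono divide_right_mono mult_left_mono power_mono) auto
  then show "ocs_bound x \<le> ocs_bound y" unfolding ocs_bound_def by simp
qed

text \<open>Here \<open>t\<close>, \<open>t\<^sup>2\<close>, \<open>t\<^sup>4\<close> are rounded down step by step, which keeps the numerals short.\<close>

lemma ocs_bound_ge: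
  assumes "0 \<le> a" "0 \<le> h" "8 * h \<le> a + a\<^sup>2 / 2 + 17863/100000 * a ^ 3" "v \<le> 1"
    and t: "t \<le> 1 + h + h ^ 2 / 2 + h ^ 3 / 6 + h ^ 4 / 24 + h ^ 5 / 120" "0 \<le> t"
    and "q \<le> t\<^sup>2" "0 \<le> q" "r \<le> q\<^sup>2" "0 \<le> r" "1 \<le> r\<^sup>2 * (1 - v)"
  shows "v \<le> ocs_bound a"
proof -
  let ?x = "a + a\<^sup>2 / 2 + (4 - 2 * sqrt 3) / 3 * a ^ 3"
  have "17863/100000 * a ^ 3 \<le> (4 - 2 * sqrt 3) / 3 * a ^ 3"
    using assms(1) ocs_bound_cubic_coeff by (intro mult_right_mono) auto
  with assms(3) have x: "8 * h \<le> ?x" by linarith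
  \<comment> \<open>Six Taylor terms at one eighth of the exponent; three squarings then return to
    \<open>exp (8 * h)\<close>.\<close>
  have "(\<Sum>n<6. h ^ n /\<^sub>R fact n) \<le> exp h"
    unfolding exp_def using assms(2) by (intro sum_le_suminf summable_exp_generic) auto
  then have "1 + h + h ^ 2 / 2 + h ^ 3 / 6 + h ^ 4 / 24 + h ^ 5 / 120 \<le> exp h"
    by (simp add: eval_nat_numeral fact_numeral field_simps)
  with t(1) have "t \<le> exp h" by linarith
  have "r\<^sup>2 \<le> (q\<^sup>2)\<^sup>2" using assms by (intro power_mono) auto
  also have "\<dots> \<le> ((t\<^sup>2)\<^sup>2)\<^sup>2" using assms by (intro power_mono) auto
  also have "\<dots> = t ^ 8" by (simp flip: power_mult)
  also have "\<dots> \<le> exp h ^ 8" using \<open>t \<le> exp h\<close> t(2) by (rule power_mono)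
  also have "\<dots> = exp (8 * h)" by (simp add: exp_of_nat_mult[symmetric])
  also have "\<dots> \<le> exp ?x" using x by simp
  finally have "r\<^sup>2 * (1 - v) \<le> exp ?x * (1 - v)"
    using assms(4) by (intro mult_right_mono) auto
  with assms(11) have "1 \<le> exp ?x * (1 - v)" by linarith
  then have "exp (- ?x) * 1 \<le> exp (- ?x) * (exp ?x * (1 - v))"
    by (intro mult_left_mono) auto
  also have "\<dots> = 1 - v" by (simp add: mult.assoc[symmetric] exp_add[symmetric])
  finally show ?thesis by (simp add: ocs_bound_def algebra_simps)
qed

definition hinge_sum :: "(real \<times> real) list \<Rightarrow> real \<Rightarrow> real" where
  "hinge_sum hs y = (\<Sum>(b, w)\<leftarrow>hs. w * min y b)"

text \<open>Between neighbouring breakpoints, with 0 counted as one, the hinge sum is affine and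
  \<open>f\<close> lies above its chord; beyond the last breakpoint the hinge sum is constant and
  \<open>f\<close> is monotone. So it suffices to compare values at breakpoints.\<close>

lemma hinge_sum_le_concave:
  assumes "concave_on {0..} f" "mono_on {0..} f" "0 \<le> f 0" "hs \<noteq> []"
    and "\<And>b. b \<in> fst ` set hs \<Longrightarrow> 0 \<le> b \<and> hinge_sum hs b \<le> f b" "0 \<le> y"
  shows "hinge_sum hs y \<le> f y"
proof -
  define B where "B = insert 0 (fst ` set hs)"
  have zero: "hinge_sum hs 0 = 0"
  proof -
    have "(\<Sum>(b, w)\<leftarrow>hs. w * min 0 b) = (\<Sum>(b, w)\<leftarrow>hs. 0)"
      using assms(5) by (intro arg_cong[where f = sum_list] map_cong) force+
    then show ?thesis by (simp add: hinge_sum_def case_prod_unfold)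
  qed
  have B: "finite B" "\<And>b. b \<in> B \<Longrightarrow> 0 \<le> b" "\<And>b. b \<in> B \<Longrightarrow> hinge_sum hs b \<le> f b"
    using assms(3,5) zero by (auto simp: B_def)
  define l where "l = Max {b\<in>B. b \<le> y}"
  have "l \<in> {b\<in>B. b \<le> y}" unfolding l_def
    using B(1) assms(6) by (intro Max_in) (auto simp: B_def)
  then have l: "l \<in> B" "l \<le> y" by auto
  have l_max: "b \<le> l" if "b \<in> B" "b \<le> y" for b
    unfolding l_def using that B(1) by (intro Max_ge) auto
  show ?thesis
  proof (cases "\<exists>b\<in>B. y < b")
    case False
    have "hinge_sum hs y = hinge_sum hs l"
      unfolding hinge_sum_def
    proof (intro arg_cong[where f = sum_list] map_cong refl, clarify)
      fix b w assume "(b, w) \<in> set hs"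
      then have "b \<in> B" by (force simp: B_def)
      then have "b \<le> y" using False by auto
      then show "w * min y b = w * min l b" using l l_max \<open>b \<in> B\<close> by (simp add: min_absorb2)
    qed
    also have "\<dots> \<le> f l" using l(1) by (rule B(3))
    also have "\<dots> \<le> f y" using assms(2) l B(2) assms(6) by (auto intro: mono_onD)
    finally show ?thesis .
  next
    case True
    define r where "r = Min {b\<in>B. y < b}"
    have "r \<in> {b\<in>B. y < b}" unfolding r_def using B(1) True by (intro Min_in) auto
    then have r: "r \<in> B" "y < r" by auto
    have r_min: "r \<le> b" if "b \<in> B" "y < b" for b
      unfolding r_def using that B(1) by (intro Min_le) auto
    define u where "u = (y - l) / (r - l)"
    have u: "0 \<le> u" "u \<le> 1" using l r by (auto simp: u_def)
    have y: "y = (1 - u) * l + u * r"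
    proof -
      have "u * (r - l) = y - l" using l r by (simp add: u_def)
      then show ?thesis by (simp add: algebra_simps)
    qed
    have "hinge_sum hs y = (\<Sum>(b, w)\<leftarrow>hs. (1 - u) * (w * min l b) + u * (w * min r b))"
      unfolding hinge_sum_def
    proof (intro arg_cong[where f = sum_list] map_cong refl, clarify)
      fix b w assume "(b, w) \<in> set hs"
      then have b: "b \<in> B" by (force simp: B_def)
      show "w * min y b = (1 - u) * (w * min l b) + u * (w * min r b)"
      proof (cases "b \<le> y")
        case True
        then have "b \<le> l" using b l_max by simp
        then have "min y b = b" "min l b = b" "min r b = b" using True r by auto
        then show ?thesis by (simp add: algebra_simps)
      next
        case False
        then have "r \<le> b" using b r_min by simp
        then have "min y b = y" "min l b = l" "min r b = r" using l r by auto
        moreover have "w * y = (1 - u) * (w * l) + u * (w * r)"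
          unfolding y by (simp add: algebra_simps)
        ultimately show ?thesis by simp
      qed
    qed
    also have "\<dots> = (1 - u) * hinge_sum hs l + u * hinge_sum hs r"
      by (simp add: hinge_sum_def case_prod_unfold sum_list_addf sum_list_const_mult)
    also have "\<dots> \<le> (1 - u) * f l + u * f r"
      using u l r B(3) by (intro add_mono mult_left_mono) auto
    also have "\<dots> \<le> f y"
      using concave_onD[OF assms(1) u, of l r] l r B(2) y by auto
    finally show ?thesis .
  qed
qed

text \<open>Breakpoints and slope decrements of an interpolant of \<^const>\<open>ocs_bound\<close>.\<close>

definition ocs_hinges :: "(real \<times> real) list" where
  "ocs_hinges = [(1/4, 4404/100000),
    (3/8, 5560/100000),
    (1/2, 7384/100000),
    (5/8, 8888/100000),
    (3/4, 9896/100000),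
    (7/8, 10296/100000),
    (1, 10136/100000),
    (9/8, 9400/100000),
    (5/4, 8304/100000),
    (11/8, 6952/100000),
    (3/2, 5512/100000),
    (13/8, 4160/100000),
    (7/4, 2984/100000),
    (15/8, 2016/100000),
    (2, 1692/100000),
    (9/4, 968/100000),
    (5/2, 304/100000),
    (3, 44/100000)]"

lemma ocs_hinges_nonneg: "(b, w) \<in> set ocs_hinges \<Longrightarrow> 0 \<le> b \<and> 0 \<le> w"
  by (auto simp: ocs_hinges_def)

text \<open>At each breakpoint h is one eighth of the exponent, computed with the lower bound for
  the cubic coefficient, and t, q, r approximate \<open>exp h\<close>, \<open>exp (2 * h)\<close>,
  \<open>exp (4 * h)\<close>, all rounded down to seven decimals.\<close>

lemma hinge_sum_le_ocs_bound:
  assumes "0 \<le> y"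
  shows "hinge_sum ocs_hinges y \<le> ocs_bound y"
proof (rule hinge_sum_le_concave[OF ocs_bound_concave ocs_bound_mono _ _ _ assms])

  have "hinge_sum ocs_hinges (1/4) = 24725/100000"
    by (simp add: ocs_hinges_def hinge_sum_def)
  then have h0: "hinge_sum ocs_hinges (1/4) \<le> ocs_bound (1/4)"
    by (rule ord_eq_le_trans, intro ocs_bound_ge[where h = "355051/10000000" and t = "10361429/10000000"
          and q = "10735921/10000000" and r = "11525999/10000000"]) (simp_all add: power2_eq_square power_divide)
  have "hinge_sum ocs_hinges (3/8) = 36537/100000"
    by (simp add: ocs_hinges_def hinge_sum_def)
  then have h1: "hinge_sum ocs_hinges (3/8) \<le> ocs_bound (3/8)"
    by (rule ord_eq_le_trans, intro ocs_bound_ge[where h = "568415/10000000" and t = "10584880/10000000"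
          and q = "11203968/10000000" and r = "12552889/10000000"]) (simp_all add: power2_eq_square power_divide)
  have "hinge_sum ocs_hinges (1/2) = 47654/100000"
    by (simp add: ocs_hinges_def hinge_sum_def)
  then have h2: "hinge_sum ocs_hinges (1/2) \<le> ocs_bound (1/2)"
    by (rule ord_eq_le_trans, intro ocs_bound_ge[where h = "809160/10000000" and t = "10842798/10000000"
          and q = "11756626/10000000" and r = "13821825/10000000"]) (simp_all add: power2_eq_square power_divide)
  have "hinge_sum ocs_hinges (5/8) = 57848/100000"
    by (simp add: ocs_hinges_def hinge_sum_def)
  then have h3: "hinge_sum ocs_hinges (5/8) \<le> ocs_bound (5/8)"
    by (rule ord_eq_le_trans, intro ocs_bound_ge[where h = "1079904/10000000" and t = "11140370/10000000"
          and q = "12410784/10000000" and r = "15402755/10000000"]) (simp_all add: power2_eq_square power_divide)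
  have "hinge_sum ocs_hinges (3/4) = 66931/100000"
    by (simp add: ocs_hinges_def hinge_sum_def)
  then have h4: "hinge_sum ocs_hinges (3/4) \<le> ocs_bound (3/4)"
    by (rule ord_eq_le_trans, intro ocs_bound_ge[where h = "1383261/10000000" and t = "11483499/10000000"
          and q = "13187074/10000000" and r = "17389892/10000000"]) (simp_all add: power2_eq_square power_divide)
  have "hinge_sum ocs_hinges (7/8) = 74777/100000"
    by (simp add: ocs_hinges_def hinge_sum_def)
  then have h5: "hinge_sum ocs_hinges (7/8) \<le> ocs_bound (7/8)"
    by (rule ord_eq_le_trans, intro ocs_bound_ge[where h = "1721850/10000000" and t = "11878975/10000000"
          and q = "14111004/10000000" and r = "19912043/10000000"]) (simp_all add: power2_eq_square power_divide)
  have "hinge_sum ocs_hinges (1) = 81336/100000"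
    by (simp add: ocs_hinges_def hinge_sum_def)
  then have h6: "hinge_sum ocs_hinges (1) \<le> ocs_bound (1)"
    by (rule ord_eq_le_trans, intro ocs_bound_ge[where h = "2098287/10000000" and t = "12334666/10000000"
          and q = "15214398/10000000" and r = "23147790/10000000"]) (simp_all add: power2_eq_square power_divide)
  have "hinge_sum ocs_hinges (9/8) = 86628/100000"
    by (simp add: ocs_hinges_def hinge_sum_def)
  then have h7: "hinge_sum ocs_hinges (9/8) \<le> ocs_bound (9/8)"
    by (rule ord_eq_le_trans, intro ocs_bound_ge[where h = "2515188/10000000" and t = "12859767/10000000"
          and q = "16537360/10000000" and r = "27348427/10000000"]) (simp_all add: power2_eq_square power_divide)
  have "hinge_sum ocs_hinges (5/4) = 90745/100000"
    by (simp add: ocs_hinges_def hinge_sum_def)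
  then have h8: "hinge_sum ocs_hinges (5/4) \<le> ocs_bound (5/4)"
    by (rule ord_eq_le_trans, intro ocs_bound_ge[where h = "2975170/10000000" and t = "13465102/10000000"
          and q = "18130897/10000000" and r = "32872942/10000000"]) (simp_all add: power2_eq_square power_divide)
  have "hinge_sum ocs_hinges (11/8) = 93824/100000"
    by (simp add: ocs_hinges_def hinge_sum_def)
  then have h9: "hinge_sum ocs_hinges (11/8) \<le> ocs_bound (11/8)"
    by (rule ord_eq_le_trans, intro ocs_bound_ge[where h = "3480850/10000000" and t = "14163500/10000000"
          and q = "20060473/10000000" and r = "40242257/10000000"]) (simp_all add: power2_eq_square power_divide)
  have "hinge_sum ocs_hinges (3/2) = 96034/100000"
    by (simp add: ocs_hinges_def hinge_sum_def)
  then have h10: "hinge_sum ocs_hinges (3/2) \<le> ocs_bound (3/2)"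
    by (rule ord_eq_le_trans, intro ocs_bound_ge[where h = "4034845/10000000" and t = "14970256/10000000"
          and q = "22410856/10000000" and r = "50224646/10000000"]) (simp_all add: power2_eq_square power_divide)
  have "hinge_sum ocs_hinges (13/8) = 97555/100000"
    by (simp add: ocs_hinges_def hinge_sum_def)
  then have h11: "hinge_sum ocs_hinges (13/8) \<le> ocs_bound (13/8)"
    by (rule ord_eq_le_trans, intro ocs_bound_ge[where h = "4639770/10000000" and t = "15903715/10000000"
          and q = "25292815/10000000" and r = "63972649/10000000"]) (simp_all add: power2_eq_square power_divide)
  have "hinge_sum ocs_hinges (7/4) = 98556/100000"
    by (simp add: ocs_hinges_def hinge_sum_def)
  then have h12: "hinge_sum ocs_hinges (7/4) \<le> ocs_bound (7/4)"
    by (rule ord_eq_le_trans, intro ocs_bound_ge[where h = "5298243/10000000" and t = "16986006/10000000"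
          and q = "28852439/10000000" and r = "83246323/10000000"]) (simp_all add: power2_eq_square power_divide)
  have "hinge_sum ocs_hinges (15/8) = 99184/100000"
    by (simp add: ocs_hinges_def hinge_sum_def)
  then have h13: "hinge_sum ocs_hinges (15/8) \<le> ocs_bound (15/8)"
    by (rule ord_eq_le_trans, intro ocs_bound_ge[where h = "6012881/10000000" and t = "18243956/10000000"
          and q = "33284193/10000000" and r = "110783750/10000000"]) (simp_all add: power2_eq_square power_divide)
  have "hinge_sum ocs_hinges (2) = 99560/100000"
    by (simp add: ocs_hinges_def hinge_sum_def)
  then have h14: "hinge_sum ocs_hinges (2) \<le> ocs_bound (2)"
    by (rule ord_eq_le_trans, intro ocs_bound_ge[where h = "6786300/10000000" and t = "19710253/10000000"
          and q = "38849407/10000000" and r = "150927642/10000000"]) (simp_all add: power2_eq_square power_divide)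
  have "hinge_sum ocs_hinges (9/4) = 99889/100000"
    by (simp add: ocs_hinges_def hinge_sum_def)
  then have h15: "hinge_sum ocs_hinges (9/4) \<le> ocs_bound (9/4)"
    by (rule ord_eq_le_trans, intro ocs_bound_ge[where h = "8519946/10000000" and t = "23437146/10000000"
          and q = "54929981/10000000" and r = "301730281/10000000"]) (simp_all add: power2_eq_square power_divide)
  have "hinge_sum ocs_hinges (5/2) = 99976/100000"
    by (simp add: ocs_hinges_def hinge_sum_def)
  then have h16: "hinge_sum ocs_hinges (5/2) \<le> ocs_bound (5/2)"
    by (rule ord_eq_le_trans, intro ocs_bound_ge[where h = "10520117/10000000" and t = "28611978/10000000"
          and q = "81864528/10000000" and r = "670180094/10000000"]) (simp_all add: power2_eq_square power_divide)
  have "hinge_sum ocs_hinges (3) = 99998/100000"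
    by (simp add: ocs_hinges_def hinge_sum_def)
  then have h17: "hinge_sum ocs_hinges (3) \<le> ocs_bound (3)"
    by (rule ord_eq_le_trans, intro ocs_bound_ge[where h = "15403762/10000000" and t = "46427642/10000000"
          and q = "215552594/10000000" and r = "4646292078/10000000"]) (simp_all add: power2_eq_square power_divide)
  have "fst ` set ocs_hinges = {1/4, 3/8, 1/2, 5/8, 3/4, 7/8, 1, 9/8, 5/4, 11/8, 3/2, 13/8, 7/4, 15/8, 2, 9/4, 5/2, 3}"
    by (simp add: ocs_hinges_def)
  then have "hinge_sum ocs_hinges b \<le> ocs_bound b" if "b \<in> fst ` set ocs_hinges" for b
    using that h0 h1 h2 h3 h4 h5 h6 h7 h8 h9 h10 h11 h12 h13 h14 h15 h16 h17
    by (simp only:) (elim insertE emptyE; simp only:)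
  then show "0 \<le> b \<and> hinge_sum ocs_hinges b \<le> ocs_bound b" if "b \<in> fst ` set ocs_hinges" for b
    using that ocs_hinges_nonneg by force
qed (simp_all add: ocs_bound_def ocs_hinges_def)

text \<open>By \<open>shortfall_bound\<close> the hinge min y b alone guarantees the ratio
  \<open>b - dickman_bound b\<close>; nonnegative weights allow these guarantees to be
  added.\<close>

lemma ocs_hinges_value:
  "0.666 \<le> (\<Sum>(b, w)\<leftarrow>ocs_hinges. w * (b - dickman_bound b))"
  by (simp add: ocs_hinges_def dickman_bound_def quartic_def power_divide)

lemma dickman_bound_1: "dickman_bound 1 \<le> 0.282"
  by (simp add: dickman_bound_def quartic_def)

section \<open>The independent estimator\<close>

lemma prob_bind_pmf:
  "measure_pmf.prob (bind_pmf M N) X = measure_pmf.expectation M (\<lambda>x. measure_pmf.prob (N x) X)"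
proof -
  have "ennreal (measure_pmf.prob (bind_pmf M N) X) = (\<integral>\<^sup>+x. ennreal (measure_pmf.prob (N x) X) \<partial>M)"
    by (simp flip: measure_pmf.emeasure_eq_measure)
  also have "\<dots> = ennreal (measure_pmf.expectation M (\<lambda>x. measure_pmf.prob (N x) X))"
    by (intro nn_integral_eq_integral measure_pmf.integrable_const_bound[where B = 1]) auto
  finally show ?thesis by (simp add: integral_nonneg_AE)
qed

lemma expectation_finite_support:
  fixes f :: "'a \<Rightarrow> real"
  assumes "finite (set_pmf M)"
  shows "measure_pmf.expectation M f = (\<Sum>x\<in>set_pmf M. pmf M x * f x)"
  using integral_measure_pmf[OF assms, of M f] by simp

lemma types_law_support: "set_pmf (types_law G) = PiE {1..arrivals G} (\<lambda>j. set_pmf (dist G j))"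
  unfolding types_law_def
  by (subst set_Pi_pmf) (auto simp: PiE_dflt_def PiE_def Pi_def extensional_def)

lemma types_law_update:
  assumes "j \<in> {1..arrivals G}"
  shows "types_law G = bind_pmf (dist G j)
    (\<lambda>\<tau>. map_pmf (\<lambda>f. f(j := \<tau>)) (Pi_pmf ({1..arrivals G} - {j}) undefined (dist G)))"
proof -
  have "{1..arrivals G} = insert j ({1..arrivals G} - {j})" using assms by auto
  then show ?thesis
    unfolding types_law_def
    using Pi_pmf_insert'[of "{1..arrivals G} - {j}" j undefined "dist G"]
    by (simp add: map_pmf_def)
qed

lemma fst_opt_law: "map_pmf fst (opt_law OPT G) = types_law G"
  unfolding opt_law_def by (simp add: map_bind_pmf pmf.map_comp o_def map_pmf_const bind_return_pmf')

lemma set_opt_law: "set_pmf (opt_law OPT G) = (SIGMA t:set_pmf (types_law G). set_pmf (OPT G t))"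
  unfolding opt_law_def by auto

text \<open>Drawing the type of \<open>j\<close> first and the other types afterwards turns the
  resampling in the definition of the estimator into conditioning on \<open>t j\<close>.\<close>

lemma opt_law_joint:
  assumes j: "j \<in> {1..arrivals G}"
  shows "measure_pmf.prob (opt_law OPT G) {q. (u, j) \<in> snd q \<and> fst q j = t j} =
    pmf (dist G j) (t j) * independent_estimator OPT G j t u"
proof -
  let ?P = "Pi_pmf ({1..arrivals G} - {j}) undefined (dist G)"
  let ?K = "\<lambda>\<tau>. bind_pmf ?P (\<lambda>f. map_pmf (\<lambda>M. (f(j := \<tau>), M)) (OPT G (f(j := \<tau>))))"
  let ?X = "{q. (u, j) \<in> snd q \<and> fst q j = t j}"
  have law: "opt_law OPT G = bind_pmf (dist G j) ?K"
    unfolding opt_law_def types_law_update[OF j]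
    by (simp add: bind_assoc_pmf bind_map_pmf)
  have K: "measure_pmf.prob (?K \<tau>) ?X = indicator {t j} \<tau> * independent_estimator OPT G j t u" for \<tau>
  proof (cases "\<tau> = t j")
    case True
    have "(\<lambda>M. (f(j := \<tau>), M)) -` ?X = {M. (u, j) \<in> M}" for f
      using True by auto
    then show ?thesis
      using True by (simp add: prob_bind_pmf independent_estimator_def)
  next
    case False
    then show ?thesis by (simp add: prob_bind_pmf vimage_def)
  qed
  have "measure_pmf.prob (opt_law OPT G) ?X =
      measure_pmf.expectation (dist G j) (\<lambda>\<tau>. indicator {t j} \<tau> * independent_estimator OPT G j t u)"
    unfolding law by (subst prob_bind_pmf) (simp only: K)
  also have "\<dots> = pmf (dist G j) (t j) * independent_estimator OPT G j t u"
    by (simp add: measure_pmf_single)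
  finally show ?thesis .
qed

lemma types_law_marginal:
  assumes "j \<in> {1..arrivals G}"
  shows "map_pmf (\<lambda>t. t j) (types_law G) = dist G j"
  unfolding types_law_def using assms by (simp add: Pi_pmf_component)

lemma independent_eq_subset_singleton:
  assumes "j \<in> {1..arrivals G}" "t \<in> set_pmf (types_law G)"
  shows "independent_estimator OPT G j t = subset_estimator OPT (\<lambda>n j. {j}) G j t"
proof
  fix u
  have "t j \<in> set_pmf (dist G j)" using assms by (auto simp: types_law_support)
  \<comment> \<open>\<open>cond_prob\<close> divides by this probability, so the identity is stated
    for profiles in the support.\<close>
  then have pos: "0 < pmf (dist G j) (t j)" by (simp add: pmf_positive)
  have "measure_pmf.prob (opt_law OPT G) {q. fst q j = t j} =
      measure_pmf.prob (map_pmf (\<lambda>t. t j) (map_pmf fst (opt_law OPT G))) {t j}"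
    by (simp add: vimage_def pmf.map_comp)
  also have "\<dots> = pmf (dist G j) (t j)"
    unfolding fst_opt_law types_law_marginal[OF assms(1)] by (rule measure_pmf_single)
  finally show "independent_estimator OPT G j t u = subset_estimator OPT (\<lambda>n j. {j}) G j t u"
    using pos opt_law_joint[OF assms(1), of OPT u t]
    by (simp add: subset_estimator_def cond_prob_def)
qed

section \<open>Lower bounds on an arbitrary instance\<close>

locale matching_instance =
  fixes OPT :: "('l, 't) opt_rule" and G :: "('l, 't) osm"
  assumes opt: "valid_opt_rule OPT" and valid: "valid_osm G"
begin

abbreviation "J \<equiv> {1..arrivals G}"
abbreviation "T \<equiv> \<lambda>j. set_pmf (dist G j)"
abbreviation "P \<equiv> \<lambda>j. pmf (dist G j)"
text \<open>Only the type of \<open>j\<close> itself enters the estimate, so a constant profile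
  makes it a function of (vertex, type) pairs; \<open>est_eq\<close> leads back to full
  profiles.\<close>

abbreviation "est \<equiv> \<lambda>u j \<tau>. independent_estimator OPT G j (\<lambda>_. \<tau>) u"

lemma est_eq: "independent_estimator OPT G j t u = est u j (t j)"
  by (simp add: independent_estimator_def)

lemma fin: "finite (offline G)" "j \<in> J \<Longrightarrow> finite (T j)"
  and weight_nonneg: "u \<in> offline G \<Longrightarrow> 0 \<le> weight G u"
  and nbrs_offline: "j \<in> J \<Longrightarrow> \<tau> \<in> T j \<Longrightarrow> nbrs G \<tau> \<subseteq> offline G"
  using valid by (auto simp: valid_osm_def)

lemma finite_types: "finite (set_pmf (types_law G))"
  unfolding types_law_support using fin by (intro finite_PiE) auto

lemma edges_subset:
  assumes "t \<in> set_pmf (types_law G)"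
  shows "edges G t \<subseteq> offline G \<times> J"
  using assms nbrs_offline by (fastforce simp: edges_def types_law_support PiE_iff)

lemma matching_opt:
  assumes "q \<in> set_pmf (opt_law OPT G)"
  shows "max_weight_matching G (fst q) (snd q)" "is_matching G (fst q) (snd q)"
    "snd q \<subseteq> offline G \<times> J" "fst q \<in> set_pmf (types_law G)"
proof -
  show t: "fst q \<in> set_pmf (types_law G)" using assms by (auto simp: set_opt_law)
  show "max_weight_matching G (fst q) (snd q)"
    using assms opt valid by (auto simp: set_opt_law valid_opt_rule_def)
  then show "is_matching G (fst q) (snd q)" by (simp add: max_weight_matching_def)
  then show "snd q \<subseteq> offline G \<times> J"
    using edges_subset[OF t] by (auto simp: is_matching_def)
qed

lemma finite_opt_law: "finite (set_pmf (opt_law OPT G))"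
proof (rule finite_subset)
  show "set_pmf (opt_law OPT G) \<subseteq> set_pmf (types_law G) \<times> Pow (offline G \<times> J)"
  proof
    fix q assume "q \<in> set_pmf (opt_law OPT G)"
    from matching_opt(3,4)[OF this] show "q \<in> set_pmf (types_law G) \<times> Pow (offline G \<times> J)"
      by (cases q) auto
  qed
qed (use finite_types fin in auto)

lemma expectation_types:
  "measure_pmf.expectation (types_law G) f = product_sum J P T f"
proof -
  have "pmf (types_law G) t = (\<Prod>j\<in>J. P j (t j))" if "t \<in> PiE J T" for t
    unfolding types_law_def using that by (intro pmf_Pi') (auto simp: PiE_def extensional_def)
  then show ?thesis
    unfolding product_sum_def expectation_finite_support[OF finite_types] types_law_support
    by (intro sum.cong) auto
qed

lemma joint:
  assumes "j \<in> J"
  shows "measure_pmf.prob (opt_law OPT G) {q. (u, j) \<in> snd q \<and> fst q j = \<tau>} = P j \<tau> * est u j \<tau>"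
  using opt_law_joint[OF assms, of OPT u "\<lambda>_. \<tau>"] by simp

lemma est_bounds: "0 \<le> est u j \<tau>" "est u j \<tau> \<le> 1"
  by (simp_all add: independent_estimator_def)

lemma est_feasible:
  assumes "B \<subseteq> Sigma J T"
  shows "(\<Sum>(j, \<tau>)\<in>B. P j \<tau> * est u j \<tau>) \<le> 1 - (\<Prod>j\<in>J. \<Sum>\<tau>\<in>{\<tau>\<in>T j. (j, \<tau>) \<notin> B}. P j \<tau>)"
proof -
  let ?Q = "opt_law OPT G"
  \<comment> \<open>Only on the support is the second component known to be a matching, which is
    what makes the events disjoint.\<close>
  let ?E = "\<lambda>e. {q. (u, fst e) \<in> snd q \<and> fst q (fst e) = snd e} \<inter> set_pmf ?Q"
  have "finite (Sigma J T)" using fin by (intro finite_SigmaI) auto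
  then have finB: "finite B" using assms by (rule finite_subset[rotated])
  have disj: "disjoint_family_on ?E B"
  proof (unfold disjoint_family_on_def, intro ballI impI)
    fix e e' assume e: "e \<in> B" "e' \<in> B" "e \<noteq> e'"
    show "?E e \<inter> ?E e' = {}"
    proof (rule ccontr)
      assume "?E e \<inter> ?E e' \<noteq> {}"
      then obtain q where q: "q \<in> ?E e" "q \<in> ?E e'" by blast
      then have "inj_on fst (snd q)"
        using matching_opt(2)[of q] by (auto simp: is_matching_def)
      then have "fst e = fst e'"
        using q inj_onD[of fst "snd q" "(u, fst e)" "(u, fst e')"] by auto
      with q e show False by (auto simp: prod_eq_iff)
    qed
  qed
  have "(\<Sum>(j, \<tau>)\<in>B. P j \<tau> * est u j \<tau>) = (\<Sum>e\<in>B. measure_pmf.prob ?Q (?E e))"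
    using assms joint by (intro sum.cong) (auto simp: measure_Int_set_pmf)
  also have "\<dots> = measure_pmf.prob ?Q (\<Union>e\<in>B. ?E e)"
    using finB disj by (intro measure_pmf.finite_measure_finite_Union[symmetric]) auto
  also have "\<dots> \<le> measure_pmf.prob ?Q (fst -` (- Pi J (\<lambda>j. {\<tau>. (j, \<tau>) \<notin> B})))"
    using assms by (intro measure_pmf.finite_measure_mono) (fastforce simp: Pi_def)+
  also have "\<dots> = measure_pmf.prob (types_law G) (- Pi J (\<lambda>j. {\<tau>. (j, \<tau>) \<notin> B}))"
    unfolding fst_opt_law[of OPT G, symmetric] by simp
  also have "\<dots> = 1 - measure_pmf.prob (types_law G) (Pi J (\<lambda>j. {\<tau>. (j, \<tau>) \<notin> B}))"
    using measure_pmf.prob_compl[of "Pi J (\<lambda>j. {\<tau>. (j, \<tau>) \<notin> B})" "types_law G"]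
    by (simp add: Compl_eq_Diff_UNIV)
  also have "measure_pmf.prob (types_law G) (Pi J (\<lambda>j. {\<tau>. (j, \<tau>) \<notin> B})) =
      (\<Prod>j\<in>J. measure_pmf.prob (dist G j) {\<tau>. (j, \<tau>) \<notin> B})"
    unfolding types_law_def by (intro measure_Pi_pmf_Pi) auto
  also have "\<dots> = (\<Prod>j\<in>J. \<Sum>\<tau>\<in>{\<tau>\<in>T j. (j, \<tau>) \<notin> B}. P j \<tau>)"
  proof (rule prod.cong[OF refl])
    fix j assume "j \<in> J"
    then have f: "finite {\<tau>\<in>T j. (j, \<tau>) \<notin> B}" using fin by auto
    have "measure_pmf.prob (dist G j) {\<tau>. (j, \<tau>) \<notin> B} =
        measure_pmf.prob (dist G j) ({\<tau>. (j, \<tau>) \<notin> B} \<inter> T j)"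
      by (rule measure_Int_set_pmf[symmetric])
    also have "{\<tau>. (j, \<tau>) \<notin> B} \<inter> T j = {\<tau>\<in>T j. (j, \<tau>) \<notin> B}" by auto
    finally show "measure_pmf.prob (dist G j) {\<tau>. (j, \<tau>) \<notin> B} =
        (\<Sum>\<tau>\<in>{\<tau>\<in>T j. (j, \<tau>) \<notin> B}. P j \<tau>)"
      using measure_measure_pmf_finite[OF f] by simp
  qed
  finally show ?thesis .
qed

lemma est_min_lower_bound:
  assumes "\<And>ds. set ds \<subseteq> {0..1} \<Longrightarrow> \<Gamma> * (1 - survival ds) \<le> a - shortfall ds 1 a"
  shows "\<Gamma> * (\<Sum>j\<in>J. \<Sum>\<tau>\<in>T j. P j \<tau> * est u j \<tau>) \<le>
    measure_pmf.expectation (types_law G) (\<lambda>t. min (\<Sum>j\<in>J. est u j (t j)) a)"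
  unfolding expectation_types
proof (rule additive_min_lower_bound)
  show "(\<Sum>\<tau>\<in>T j. P j \<tau>) = 1" if "j \<in> J" for j
    using fin(2)[OF that] by (intro sum_pmf_eq_1) auto
qed (use fin assms est_bounds est_feasible in \<open>auto simp: pmf_positive\<close>)

lemma matched_indicator:
  assumes "M \<subseteq> offline G \<times> J" "is_matching G t M"
  shows "matching_weight G M = (\<Sum>u\<in>offline G. weight G u * (\<Sum>j\<in>J. indicator {M. (u, j) \<in> M} M))"
proof -
  have "(\<Sum>j\<in>J. indicator {M. (u, j) \<in> M} M) = (if u \<in> fst ` M then 1 else 0 :: real)" for u
  proof (cases "u \<in> fst ` M")
    case True
    then obtain i where i: "(u, i) \<in> M" "i \<in> J" using assms(1) by auto
    have inj: "inj_on fst M" using assms(2) by (simp add: is_matching_def)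
    have "(u, j) \<in> M \<longleftrightarrow> j = i" for j
      using i(1) inj_onD[OF inj, of "(u, j)" "(u, i)"] by auto
    then have "(\<Sum>j\<in>J. indicator {M. (u, j) \<in> M} M) = (\<Sum>j\<in>J. if j = i then 1 else 0 :: real)"
      by (intro sum.cong) (auto simp: indicator_def)
    then show ?thesis using i True by simp
  next
    case False
    then have "indicator {M. (u, j) \<in> M} M = (0::real)" for j
      by (force simp: indicator_def)
    then show ?thesis using False by simp
  qed
  then have "(\<Sum>u\<in>offline G. weight G u * (\<Sum>j\<in>J. indicator {M. (u, j) \<in> M} M)) =
      (\<Sum>u\<in>offline G. if u \<in> fst ` M then weight G u else 0)"
    by (intro sum.cong) auto
  also have "\<dots> = (\<Sum>u\<in>fst ` M. weight G u)"
    using assms(1) fin(1) by (subst sum.If_cases) (auto intro!: sum.cong)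
  finally show ?thesis by (simp add: matching_weight_def)
qed

lemma opt_value_eq:
  "opt_value OPT G = (\<Sum>u\<in>offline G. weight G u * (\<Sum>j\<in>J. \<Sum>\<tau>\<in>T j. P j \<tau> * est u j \<tau>))"
proof -
  let ?Q = "opt_law OPT G"
  note int = integrable_measure_pmf_finite[OF finite_opt_law]
  have "opt_value OPT G = measure_pmf.expectation ?Q
      (\<lambda>q. \<Sum>u\<in>offline G. weight G u * (\<Sum>j\<in>J. indicator {q. (u, j) \<in> snd q} q))"
    unfolding opt_value_def
  proof (rule integral_cong_AE)
    show "AE q in ?Q. (case q of (t, M) \<Rightarrow> matching_weight G M) =
        (\<Sum>u\<in>offline G. weight G u * (\<Sum>j\<in>J. indicator {q. (u, j) \<in> snd q} q))"
      unfolding AE_measure_pmf_iff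
    proof
      fix q assume "q \<in> set_pmf ?Q"
      from matched_indicator[OF matching_opt(3,2)[OF this]]
      show "(case q of (t, M) \<Rightarrow> matching_weight G M) =
        (\<Sum>u\<in>offline G. weight G u * (\<Sum>j\<in>J. indicator {q. (u, j) \<in> snd q} q))"
        by (simp add: case_prod_unfold indicator_def)
    qed
  qed auto
  also have "\<dots> = (\<Sum>u\<in>offline G. weight G u * (\<Sum>j\<in>J. measure_pmf.prob ?Q {q. (u, j) \<in> snd q}))"
    by (simp add: Bochner_Integration.integral_sum int)
  also have "\<dots> = (\<Sum>u\<in>offline G. weight G u * (\<Sum>j\<in>J. \<Sum>\<tau>\<in>T j. P j \<tau> * est u j \<tau>))"
  proof (intro sum.cong refl arg_cong2[where f = "(*)"])
    fix u j assume j: "j \<in> J"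
    have "measure_pmf.prob ?Q {q. (u, j) \<in> snd q} =
        measure_pmf.prob ?Q ({q. (u, j) \<in> snd q} \<inter> set_pmf ?Q)"
      by (rule measure_Int_set_pmf[symmetric])
    also have "{q. (u, j) \<in> snd q} \<inter> set_pmf ?Q =
        (\<Union>\<tau>\<in>T j. {q. (u, j) \<in> snd q \<and> fst q j = \<tau>} \<inter> set_pmf ?Q)"
      using j by (auto simp: set_opt_law types_law_support)
    also have "measure_pmf.prob ?Q \<dots> =
        (\<Sum>\<tau>\<in>T j. measure_pmf.prob ?Q ({q. (u, j) \<in> snd q \<and> fst q j = \<tau>} \<inter> set_pmf ?Q))"
      using fin(2)[OF j]
      by (intro measure_pmf.finite_measure_finite_Union) (auto simp: disjoint_family_on_def)
    also have "\<dots> = (\<Sum>\<tau>\<in>T j. P j \<tau> * est u j \<tau>)"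
      using joint[OF j] by (simp add: measure_Int_set_pmf)
    finally show "measure_pmf.prob ?Q {q. (u, j) \<in> snd q} = (\<Sum>\<tau>\<in>T j. P j \<tau> * est u j \<tau>)" .
  qed
  finally show ?thesis .
qed

lemma fractional_value_eq:
  "fractional_value (independent_estimator OPT) G =
    (\<Sum>u\<in>offline G. weight G u *
      measure_pmf.expectation (types_law G) (\<lambda>t. min (\<Sum>j\<in>J. est u j (t j)) 1))"
proof -
  have "load (arrivals G) (\<lambda>j. independent_estimator OPT G j t) u = (\<Sum>j\<in>J. est u j (t j))" for t u
    unfolding load_def by (intro sum.cong refl est_eq)
  then show ?thesis
    unfolding fractional_value_def
    by (simp add: Bochner_Integration.integral_sum integrable_measure_pmf_finite[OF finite_types])
qed

lemma fractional_value_ge: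
  assumes "\<And>ds. set ds \<subseteq> {0..1} \<Longrightarrow> \<Gamma> * (1 - survival ds) \<le> 1 - shortfall ds 1 1"
  shows "\<Gamma> * opt_value OPT G \<le> fractional_value (independent_estimator OPT) G"
proof -
  have "\<Gamma> * opt_value OPT G =
      (\<Sum>u\<in>offline G. weight G u * (\<Gamma> * (\<Sum>j\<in>J. \<Sum>\<tau>\<in>T j. P j \<tau> * est u j \<tau>)))"
    unfolding opt_value_eq by (simp add: sum_distrib_left mult_ac)
  also have "\<dots> \<le> fractional_value (independent_estimator OPT) G"
    unfolding fractional_value_eq
    by (intro sum_mono mult_left_mono est_min_lower_bound assms weight_nonneg)
  finally show ?thesis .
qed

lemma estimator_fractional:
  assumes "j \<in> J" "t \<in> set_pmf (types_law G)"
  shows "independent_estimator OPT G j t u \<in> {0..1}"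
    "0 < independent_estimator OPT G j t u \<Longrightarrow> u \<in> nbrs G (t j)"
    "(\<Sum>u\<in>offline G. independent_estimator OPT G j t u) \<le> 1"
proof -
  let ?R = "bind_pmf (Pi_pmf (J - {j}) undefined (dist G)) (\<lambda>t'. OPT G (t'(j := t j)))"
  show "independent_estimator OPT G j t u \<in> {0..1}"
    by (simp add: independent_estimator_def)
  \<comment> \<open>A resampled profile with \<open>t j\<close> put back is again in the support, so
    the rule returns a matching there.\<close>
  have M: "is_matching G s M" if s: "s = t'(j := t j)" "t' \<in> set_pmf (Pi_pmf (J - {j}) undefined (dist G))"
    "M \<in> set_pmf (OPT G s)" for M s t'
  proof -
    have "s \<in> set_pmf (types_law G)"
      using assms s(1,2) unfolding types_law_support
      by (auto simp: set_Pi_pmf PiE_dflt_def PiE_def extensional_def)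
    then show ?thesis
      using opt valid s(3) by (auto simp: valid_opt_rule_def max_weight_matching_def)
  qed
  show "u \<in> nbrs G (t j)" if "0 < independent_estimator OPT G j t u"
  proof -
    have "set_pmf ?R \<inter> {M. (u, j) \<in> M} \<noteq> {}"
      using that measure_pmf_zero_iff[of ?R "{M. (u, j) \<in> M}"]
      by (simp add: independent_estimator_def)
    then obtain M t' where *: "t' \<in> set_pmf (Pi_pmf (J - {j}) undefined (dist G))"
      "M \<in> set_pmf (OPT G (t'(j := t j)))" "(u, j) \<in> M" by auto
    then have "(u, j) \<in> edges G (t'(j := t j))"
      using M[OF refl *(1,2)] unfolding is_matching_def by blast
    then show ?thesis by (simp add: edges_def)
  qed
  let ?E = "\<lambda>u. {M. (u, j) \<in> M} \<inter> set_pmf ?R"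
  have "(\<Sum>u\<in>offline G. independent_estimator OPT G j t u) =
      (\<Sum>u\<in>offline G. measure_pmf.prob ?R (?E u))"
    by (simp only: independent_estimator_def measure_Int_set_pmf)
  also have "\<dots> = measure_pmf.prob ?R (\<Union>u\<in>offline G. ?E u)"
  proof (rule measure_pmf.finite_measure_finite_Union[symmetric])
    show "disjoint_family_on ?E (offline G)"
    proof (unfold disjoint_family_on_def, intro ballI impI)
      fix u v :: 'l assume "u \<noteq> v"
      show "?E u \<inter> ?E v = {}"
      proof (rule ccontr)
        assume "?E u \<inter> ?E v \<noteq> {}"
        then obtain M t' where *: "t' \<in> set_pmf (Pi_pmf (J - {j}) undefined (dist G))"
          "M \<in> set_pmf (OPT G (t'(j := t j)))" "(u, j) \<in> M" "(v, j) \<in> M" by auto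
        then have "inj_on snd M" using M[OF refl *(1,2)] by (simp add: is_matching_def)
        then show False using inj_onD[of snd M "(u, j)" "(v, j)"] * \<open>u \<noteq> v\<close> by auto
      qed
    qed
  qed (use fin in auto)
  also have "\<dots> \<le> 1" by simp
  finally show "(\<Sum>u\<in>offline G. independent_estimator OPT G j t u) \<le> 1" .
qed

lemma estimator_fractional_seq:
  assumes "t \<in> set_pmf (types_law G)"
  shows "fractional_seq (offline G) (arrivals G) (\<lambda>j. independent_estimator OPT G j t)"
  unfolding fractional_seq_def
proof (intro ballI conjI allI impI)
  fix j u assume j: "j \<in> J"
  show "0 \<le> independent_estimator OPT G j t u"
    using estimator_fractional(1)[OF j assms] by simp
  show "independent_estimator OPT G j t u = 0" if "u \<notin> offline G"
  proof -
    have "nbrs G (t j) \<subseteq> offline G"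
      using assms j by (intro nbrs_offline[of j]) (auto simp: types_law_support)
    then show ?thesis
      using estimator_fractional(1,2)[OF j assms, of u] that by force
  qed
qed (use estimator_fractional(3)[OF _ assms] in auto)

end

section \<open>Rounding by a selection procedure\<close>

lemma length_selections: "s \<in> set_pmf (selections A L x n) \<Longrightarrow> length s = n"
  by (induction n arbitrary: s) auto

lemma fst_greedy_matching: "u \<in> fst ` greedy_matching s \<longleftrightarrow> Some u \<in> set s"
proof
  assume "u \<in> fst ` greedy_matching s"
  then obtain j where "j \<in> {1..length s}" "s ! (j - 1) = Some u" by (auto simp: greedy_matching_def)
  then show "Some u \<in> set s" by (metis atLeastAtMost_iff diff_less less_le_trans nth_mem zero_less_one less_eq_Suc_le One_nat_def)
next
  assume "Some u \<in> set s"
  then obtain i where i: "i < length s" "s ! i = Some u" by (auto simp: in_set_conv_nth)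
  \<comment> \<open>The first selection of u. Positions in s start at 0 and rounds at 1, hence the
    edge \<open>(u, Suc k)\<close>.\<close>
  define k where "k = (LEAST i. s ! i = Some u)"
  have k: "s ! k = Some u" "k \<le> i"
    unfolding k_def using i by (auto intro: LeastI Least_le)
  have "s ! (l - 1) \<noteq> Some u" if "l \<in> {1..<Suc k}" for l
  proof -
    have "l - 1 < (LEAST i. s ! i = Some u)" using that by (auto simp: k_def)
    then show ?thesis by (rule not_less_Least)
  qed
  then have "(u, Suc k) \<in> greedy_matching s"
    using k i by (auto simp: greedy_matching_def)
  then show "u \<in> fst ` greedy_matching s" by force
qed

lemma greedy_matching_inj: "inj_on fst (greedy_matching s)" "inj_on snd (greedy_matching s)"
proof -
  show "inj_on snd (greedy_matching s)"
    by (auto simp: inj_on_def greedy_matching_def)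
  have "i = j" if "(u, i) \<in> greedy_matching s" "(u, j) \<in> greedy_matching s" for u i j
  proof (rule ccontr)
    assume "i \<noteq> j"
    then consider "i < j" | "j < i" by linarith
    then show False using that by cases (auto simp: greedy_matching_def)
  qed
  then show "inj_on fst (greedy_matching s)" by (auto simp: inj_on_def)
qed

context matching_instance
begin

context
  fixes A :: "'l selector"
  assumes ocs: "is_ocs A"
begin

lemma rounded_is_matching:
  assumes "t \<in> set_pmf (types_law G)" "M \<in> set_pmf (rounded_law A (independent_estimator OPT) G t)"
  shows "is_matching G t M"
proof -
  let ?x = "\<lambda>j. independent_estimator OPT G j t"
  obtain s where s: "s \<in> set_pmf (selections A (offline G) ?x (arrivals G))" "M = greedy_matching s"
    using assms(2) by (auto simp: rounded_law_def)
  have "M \<subseteq> edges G t"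
  proof
    fix e assume "e \<in> M"
    then obtain u j where e: "e = (u, j)" "j \<in> J" "s ! (j - 1) = Some u"
      using s length_selections[OF s(1)] by (auto simp: greedy_matching_def)
    have "case s ! (j - 1) of None \<Rightarrow> (\<Sum>u\<in>offline G. ?x j u) < 1 | Some u \<Rightarrow> ?x j u > 0"
      using ocs estimator_fractional_seq[OF assms(1)] fin(1) s(1) e(2)
      unfolding is_ocs_def by blast
    then have "?x j u > 0" using e by simp
    then show "e \<in> edges G t"
      using e estimator_fractional(2)[OF e(2) assms(1)] by (auto simp: edges_def)
  qed
  then show ?thesis
    using greedy_matching_inj[of s] s(2) by (simp add: is_matching_def)
qed

lemma rounded_expectation:
  assumes "t \<in> set_pmf (types_law G)"
  shows "(\<Sum>u\<in>offline G. weight G u * ocs_bound (\<Sum>j\<in>J. est u j (t j))) \<le>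
      measure_pmf.expectation (rounded_law A (independent_estimator OPT) G t) (matching_weight G)"
    "finite (set_pmf (rounded_law A (independent_estimator OPT) G t))"
proof -
  let ?x = "\<lambda>j. independent_estimator OPT G j t"
  let ?R = "rounded_law A (independent_estimator OPT) G t"
  let ?S = "selections A (offline G) ?x (arrivals G)"
  have sub: "M \<subseteq> offline G \<times> J" if "M \<in> set_pmf ?R" for M
    using rounded_is_matching[OF assms that] edges_subset[OF assms] by (auto simp: is_matching_def)
  have "finite (offline G \<times> J)" using fin by auto
  then show finR: "finite (set_pmf ?R)"
    using sub by (intro finite_subset[of "set_pmf ?R" "Pow (offline G \<times> J)"]) auto
  note int = integrable_measure_pmf_finite[OF finR]
  have ind: "measure_pmf.expectation ?R (\<lambda>M. indicator {M. u \<in> fst ` M} M) \<ge>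
      ocs_bound (\<Sum>j\<in>J. est u j (t j))" if "u \<in> offline G" for u
  proof -
    have "measure_pmf.expectation ?R (indicator {M. u \<in> fst ` M}) = measure_pmf.prob ?R {M. u \<in> fst ` M}"
      by simp
    also have "\<dots> = measure_pmf.prob ?S {s. Some u \<in> set s}"
      by (simp add: rounded_law_def vimage_def fst_greedy_matching)
    also have "\<dots> \<ge> ocs_bound (load (arrivals G) ?x u)"
      using ocs estimator_fractional_seq[OF assms] fin(1) that unfolding is_ocs_def by blast
    also have "load (arrivals G) ?x u = (\<Sum>j\<in>J. est u j (t j))"
      unfolding load_def by (intro sum.cong refl est_eq)
    finally show ?thesis by simp
  qed
  have "measure_pmf.expectation ?R (matching_weight G) =
      measure_pmf.expectation ?R (\<lambda>M. \<Sum>u\<in>offline G. weight G u * indicator {M. u \<in> fst ` M} M)"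
  proof (rule integral_cong_AE)
    show "AE M in ?R. matching_weight G M = (\<Sum>u\<in>offline G. weight G u * indicator {M. u \<in> fst ` M} M)"
      unfolding AE_measure_pmf_iff
    proof
      fix M assume "M \<in> set_pmf ?R"
      then have "fst ` M \<subseteq> offline G" using sub by fastforce
      then show "matching_weight G M = (\<Sum>u\<in>offline G. weight G u * indicator {M. u \<in> fst ` M} M)"
        unfolding matching_weight_def using fin(1)
        by (intro sum.mono_neutral_cong_left) auto
    qed
  qed auto
  also have "\<dots> = (\<Sum>u\<in>offline G. weight G u * measure_pmf.expectation ?R (\<lambda>M. indicator {M. u \<in> fst ` M} M))"
    by (simp add: Bochner_Integration.integral_sum int)
  finally show "(\<Sum>u\<in>offline G. weight G u * ocs_bound (\<Sum>j\<in>J. est u j (t j))) \<le>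
      measure_pmf.expectation ?R (matching_weight G)"
    using ind weight_nonneg by (auto intro!: sum_mono mult_left_mono)
qed

lemma rounded_value_ge:
  "0.666 * opt_value OPT G \<le> rounded_value A (independent_estimator OPT) G"
proof -
  let ?q = "\<lambda>u. \<Sum>j\<in>J. \<Sum>\<tau>\<in>T j. P j \<tau> * est u j \<tau>"
  let ?y = "\<lambda>u t. \<Sum>j\<in>J. est u j (t j)"
  let ?E = "measure_pmf.expectation (types_law G)"
  note int = integrable_measure_pmf_finite[OF finite_types]
  have q: "0.666 * ?q u \<le> ?E (\<lambda>t. ocs_bound (?y u t))" for u
  proof -
    have "0 \<le> ?q u" using est_bounds by (intro sum_nonneg mult_nonneg_nonneg) auto
    then have "0.666 * ?q u \<le> (\<Sum>(b, w)\<leftarrow>ocs_hinges. w * (b - dickman_bound b)) * ?q u"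
      using ocs_hinges_value by (rule mult_right_mono[rotated])
    also have "\<dots> = (\<Sum>(b, w)\<leftarrow>ocs_hinges. w * ((b - dickman_bound b) * ?q u))"
      by (simp add: sum_list_mult_const[symmetric] case_prod_unfold mult.assoc)
    \<comment> \<open>Each breakpoint b uses \<open>est_min_lower_bound\<close> with a = b and its
      own constant; the load is the same for all of them.\<close>
    also have "\<dots> \<le> (\<Sum>(b, w)\<leftarrow>ocs_hinges. w * ?E (\<lambda>t. min (?y u t) b))"
    proof (rule sum_list_mono, clarify)
      fix b w assume "(b, w) \<in> set ocs_hinges"
      then have "0 \<le> b" "0 \<le> w" using ocs_hinges_nonneg by auto
      then show "w * ((b - dickman_bound b) * ?q u) \<le> w * ?E (\<lambda>t. min (?y u t) b)"
        by (intro mult_left_mono est_min_lower_bound shortfall_bound)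
    qed
    also have "\<dots> = ?E (\<lambda>t. hinge_sum ocs_hinges (?y u t))"
    proof -
      have "(\<Sum>(b, w)\<leftarrow>hs. w * ?E (\<lambda>t. min (?y u t) b)) =
          ?E (\<lambda>t. \<Sum>(b, w)\<leftarrow>hs. w * min (?y u t) b)" for hs
        by (induction hs) (auto simp: int)
      then show ?thesis by (simp add: hinge_sum_def)
    qed
    also have "\<dots> \<le> ?E (\<lambda>t. ocs_bound (?y u t))"
      using est_bounds by (intro integral_mono int hinge_sum_le_ocs_bound sum_nonneg)
    finally show ?thesis .
  qed
  have "0.666 * opt_value OPT G = (\<Sum>u\<in>offline G. weight G u * (0.666 * ?q u))"
    unfolding opt_value_eq sum_distrib_left[where A = "offline G"]
    by (intro sum.cong refl mult.left_commute)
  also have "\<dots> \<le> (\<Sum>u\<in>offline G. weight G u * ?E (\<lambda>t. ocs_bound (?y u t)))"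
    by (intro sum_mono mult_left_mono q weight_nonneg)
  also have "\<dots> = ?E (\<lambda>t. \<Sum>u\<in>offline G. weight G u * ocs_bound (?y u t))"
    by (simp add: Bochner_Integration.integral_sum int)
  also have "\<dots> = (\<Sum>t\<in>set_pmf (types_law G). pmf (types_law G) t *
      (\<Sum>u\<in>offline G. weight G u * ocs_bound (?y u t)))"
    by (rule expectation_finite_support[OF finite_types])
  also have "\<dots> \<le> (\<Sum>t\<in>set_pmf (types_law G). pmf (types_law G) t *
      measure_pmf.expectation (rounded_law A (independent_estimator OPT) G t) (matching_weight G))"
    by (intro sum_mono mult_left_mono rounded_expectation(1)) auto
  also have "\<dots> = rounded_value A (independent_estimator OPT) G"
    unfolding rounded_value_def
    by (subst pmf_expectation_bind[OF finite_types rounded_expectation(2)]) auto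
  finally show ?thesis .
qed

end

end

section \<open>Instances with priorities\<close>

text \<open>The recursion of \<open>shortfall\<close> peels off the latest of the arrivals 1, ...,
  k. As \<open>ds\<close> starts with the last arrival, arrival j has parameter
  \<open>ds ! (n - j)\<close>, and its payment is the probability that all later vertices are
  absent.\<close>

lemma shortfall_product_sum:
  fixes p \<phi> :: "nat \<Rightarrow> 't \<Rightarrow> real" and a b :: "nat \<Rightarrow> 't"
  assumes "set ds \<subseteq> {0..1}" "n = length ds" "k \<le> n"
    and p: "\<And>j. j \<in> {1..n} \<Longrightarrow> a j \<noteq> b j \<and> p j (a j) = ds ! (n - j) \<and> p j (b j) = 1 - ds ! (n - j)"
    and \<phi>: "\<And>j. j \<in> {1..n} \<Longrightarrow> \<phi> j (a j) = (\<Prod>i\<in>{j<..n}. 1 - ds ! (n - i)) \<and> \<phi> j (b j) = 0"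
  shows "additive_shortfall {1..k} p (\<lambda>j. {a j, b j}) \<phi> z =
    shortfall (drop (n - k) ds) (\<Prod>i\<in>{k<..n}. 1 - ds ! (n - i)) z"
  using assms(3)
proof (induction k arbitrary: z)
  case 0
  then show ?case using assms(2) by (simp add: additive_shortfall_def product_sum_def)
next
  case (Suc k)
  let ?v = "\<lambda>k. \<Prod>i\<in>{k<..n}. 1 - ds ! (n - i)" and ?d = "ds ! (n - Suc k)"
  have drop: "drop (n - Suc k) ds = ?d # drop (n - k) ds"
    using Suc.prems assms(2) Cons_nth_drop_Suc[of "n - Suc k" ds] by (simp add: Suc_diff_Suc)
  have "{k<..n} = insert (Suc k) {Suc k<..n}" using Suc.prems by auto
  then have v: "?v k = (1 - ?d) * ?v (Suc k)" by simp
  have K: "{1..Suc k} - {Suc k} = {1..k}" by auto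
  have j: "Suc k \<in> {1..n}" using Suc.prems by auto
  have "additive_shortfall {1..Suc k} p (\<lambda>j. {a j, b j}) \<phi> z =
      (\<Sum>\<tau>\<in>{a (Suc k), b (Suc k)}. p (Suc k) \<tau> *
        additive_shortfall {1..k} p (\<lambda>j. {a j, b j}) \<phi> (z - \<phi> (Suc k) \<tau>))"
    unfolding additive_shortfall_def
    by (subst product_sum_split[of _ "Suc k", where F = "\<lambda>s. max 0 (z - s)"])
      (simp_all only: K diff_diff_eq finite_atLeastAtMost, simp)
  also have "\<dots> = ?d * shortfall (drop (n - k) ds) (?v k) (z - ?v (Suc k)) +
      (1 - ?d) * shortfall (drop (n - k) ds) (?v k) z"
    using p[OF j] \<phi>[OF j] Suc.IH Suc.prems by simp
  finally show ?case unfolding drop v by simp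
qed

text \<open>
  Vertex \<open>j\<close> is present with probability \<open>rate j\<close>, and then adjacent to \<open>L 0\<close>, of weight \<open>1\<close>, and to
  a private vertex \<open>L j\<close>. The tiny private weights decrease in \<open>j\<close>, so every maximum-weight
  matching gives \<open>L 0\<close> to the last vertex that is present. The list \<open>ds\<close> starts with the last
  arrival.
\<close>

locale priority_instance =
  fixes ds :: "real list" and L :: "nat \<Rightarrow> 'l" and Ty :: "nat \<Rightarrow> 't" and \<epsilon> :: real
    and OPT :: "('l, 't) opt_rule"
  assumes ds: "set ds \<subseteq> {0..1}" and L: "inj L" and Ty: "inj Ty"
    and eps: "0 < \<epsilon>" "\<epsilon> * real (length ds) < 1"
    and opt: "valid_opt_rule OPT"
begin

definition "n = length ds"
definition "rate j = ds ! (n - j)"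
definition "wt k = \<epsilon> * (real (Suc n) - real k)"

text \<open>\<open>Ty 0\<close> is the type of an absent vertex. The embeddings \<open>L\<close> and
  \<open>Ty\<close> place the instance into arbitrary infinite carrier types.\<close>

definition G :: "('l, 't) osm" where
  "G = \<lparr>offline = L ` {0..n},
    weight = (\<lambda>u. if u = L 0 then 1 else wt (inv L u)),
    arrivals = n,
    dist = (\<lambda>j. map_pmf (\<lambda>b. if b then Ty j else Ty 0) (bernoulli_pmf (rate j))),
    nbrs = (\<lambda>\<tau>. if \<tau> \<in> Ty ` {1..n} then {L 0, L (inv Ty \<tau>)} else {})\<rparr>"

abbreviation "I \<equiv> {1..n}"

lemma G_simps [simp]:
  "offline G = L ` {0..n}" "arrivals G = n"
  "dist G j = map_pmf (\<lambda>b. if b then Ty j else Ty 0) (bernoulli_pmf (rate j))"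
  "weight G (L 0) = 1" "0 < k \<Longrightarrow> weight G (L k) = wt k"
  "j \<in> I \<Longrightarrow> nbrs G (Ty j) = {L 0, L j}" "nbrs G (Ty 0) = {}"
  using L Ty by (auto simp: G_def inj_eq)

lemma rate: "j \<in> I \<Longrightarrow> 0 \<le> rate j" "j \<in> I \<Longrightarrow> rate j \<le> 1"
proof -
  assume "j \<in> I"
  then have "rate j \<in> set ds" unfolding rate_def n_def by (intro nth_mem) auto
  then show "0 \<le> rate j" "rate j \<le> 1" using ds by auto
qed

lemma wt: "k \<in> I \<Longrightarrow> 0 < wt k" "k \<in> I \<Longrightarrow> wt k < 1" "i < k \<Longrightarrow> wt k < wt i"
proof -
  show "0 < wt k" if "k \<in> I" using that eps by (auto simp: wt_def)
  show "wt k < wt i" if "i < k" using that eps by (auto simp: wt_def)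
  show "wt k < 1" if "k \<in> I"
  proof -
    have "wt k \<le> \<epsilon> * real n" unfolding wt_def using that eps by (intro mult_left_mono) auto
    also have "\<dots> < 1" using eps by (simp add: n_def)
    finally show ?thesis .
  qed
qed

lemma valid: "valid_osm G"
proof -
  have "0 \<le> weight G u" if "u \<in> offline G" for u
  proof -
    obtain k where k: "u = L k" "k \<le> n" using \<open>u \<in> offline G\<close> by auto
    then show ?thesis
      using wt(1)[of k] by (cases "k = 0") (auto intro!: less_imp_le)
  qed
  moreover have "nbrs G \<tau> \<subseteq> offline G" if "\<tau> \<in> set_pmf (dist G j)" "j \<in> I" for j \<tau>
    using that by (auto split: if_splits simp del: set_pmf_bernoulli)
  ultimately show ?thesis
    unfolding valid_osm_def by (auto intro: finite_subset[OF subset_UNIV])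
qed

sublocale matching_instance OPT G
  using opt valid by unfold_locales

lemma pmf_dist:
  assumes "j \<in> I"
  shows "pmf (dist G j) (Ty j) = rate j" "pmf (dist G j) (Ty 0) = 1 - rate j"
    "set_pmf (dist G j) \<subseteq> {Ty j, Ty 0}"
proof -
  have ne: "Ty j \<noteq> Ty 0" using Ty assms by (auto simp: inj_eq)
  have "(\<lambda>b. if b then Ty j else Ty 0) -` {Ty j} = {True}"
    "(\<lambda>b. if b then Ty j else Ty 0) -` {Ty 0} = {False}" using ne by (auto split: if_splits)
  then show "pmf (dist G j) (Ty j) = rate j" "pmf (dist G j) (Ty 0) = 1 - rate j"
    using rate[OF assms] by (simp_all add: pmf_map measure_pmf_single)
  show "set_pmf (dist G j) \<subseteq> {Ty j, Ty 0}" by auto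
qed

definition present :: "(nat \<Rightarrow> 't) \<Rightarrow> nat set" where
  "present t = {j\<in>I. t j = Ty j}"

lemma edges_eq:
  assumes "t \<in> set_pmf (types_law G)"
  shows "edges G t = {(u, j). j \<in> present t \<and> u \<in> {L 0, L j}}"
proof -
  have dj: "t j = Ty j \<or> t j = Ty 0" if "j \<in> I" for j
    using assms pmf_dist(3)[OF that] that by (auto simp: types_law_support PiE_iff simp del: G_simps(3))
  have "u \<in> nbrs G (t j) \<longleftrightarrow> j \<in> present t \<and> u \<in> {L 0, L j}" if j: "j \<in> I" for u j
  proof (cases "t j = Ty j")
    case True
    then show ?thesis using j G_simps(6)[OF j] by (simp add: present_def)
  next
    case False
    then show ?thesis using dj[OF j] G_simps(7) by (simp add: present_def)
  qed
  then show ?thesis by (auto simp: edges_def present_def)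
qed

text \<open>Giving \<open>L 0\<close> to a present vertex m costs exactly the private weight of m
  when all other present vertices take their private ones, so the optimal m has the least private
  weight, i.e. is the last. Leaving \<open>L 0\<close> free is worse, since a single private weight
  is below 1.\<close>

lemma main_matched_last:
  assumes t: "t \<in> set_pmf (types_law G)" and M: "max_weight_matching G t M"
  shows "(L 0, j) \<in> M \<longleftrightarrow> j \<in> present t \<and> (\<forall>i\<in>present t. i \<le> j)"
proof -
  let ?P = "present t"
  have fin: "finite ?P" by (simp add: present_def)
  have PI: "?P \<subseteq> I" by (auto simp: present_def)
  have M1: "M \<subseteq> edges G t" "inj_on snd M" "inj_on fst M"
    using M by (auto simp: max_weight_matching_def is_matching_def)
  have P0: "0 \<notin> ?P" using PI by auto
  note Leq = inj_eq[OF L]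
  have reindex: "(\<Sum>u\<in>L ` Q. weight G u) = sum wt Q" if "Q \<subseteq> ?P" for Q
  proof -
    have "(\<Sum>u\<in>L ` Q. weight G u) = (\<Sum>k\<in>Q. weight G (L k))"
      using sum.reindex[OF inj_on_subset[OF L subset_UNIV], of "weight G" Q] by simp
    also have "\<dots> = sum wt Q"
    proof (rule sum.cong[OF refl])
      fix k assume "k \<in> Q"
      then have "0 < k" using that P0 by (cases k) auto
      then show "weight G (L k) = wt k" by (rule G_simps(5))
    qed
    finally show ?thesis .
  qed
  have zero_notin: "L 0 \<notin> L ` Q" if "Q \<subseteq> ?P" for Q
    using that P0 by (auto simp: Leq)
  have matched: "(L i, i) \<in> M" if "L i \<in> fst ` M" "0 < i" for i
  proof -
    obtain k where k: "(L i, k) \<in> M" using \<open>L i \<in> fst ` M\<close> by auto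
    then have "L i \<in> {L 0, L k}" using M1(1) unfolding edges_eq[OF t] by blast
    then have "k = i" using \<open>0 < i\<close> by (simp add: Leq)
    with k show ?thesis by simp
  qed
  have sub: "fst ` M \<subseteq> insert (L 0) (L ` ?P)"
    using M1(1) unfolding edges_eq[OF t] by auto
  have nn: "0 \<le> weight G u" if u: "u \<in> insert (L 0) (L ` ?P)" for u
  proof -
    consider "u = L 0" | k where "u = L k" "k \<in> I" using u PI by blast
    then show ?thesis
    proof cases
      case 2
      then show ?thesis using wt(1)[OF 2(2)] G_simps(5)[of k] by simp
    qed simp
  qed
  have better: "1 + sum wt (?P - {m}) \<le> matching_weight G M" if "m \<in> ?P" for m
  proof -
    let ?M = "insert (L 0, m) ((\<lambda>k. (L k, k)) ` (?P - {m}))"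
    have "?M \<subseteq> edges G t" unfolding edges_eq[OF t] using that by blast
    moreover have "inj_on snd ?M" by (auto simp: inj_on_def)
    moreover have "inj_on fst ?M" using P0 by (auto simp: inj_on_def Leq)
    ultimately have "matching_weight G ?M \<le> matching_weight G M"
      using M by (simp add: max_weight_matching_def is_matching_def)
    moreover have "matching_weight G ?M = 1 + sum wt (?P - {m})"
    proof -
      have "fst ` ?M = insert (L 0) (L ` (?P - {m}))" by (simp add: image_image)
      moreover have "finite (L ` (?P - {m}))" using fin by simp
      ultimately show ?thesis
        unfolding matching_weight_def
        using sum.insert[of "L ` (?P - {m})" "L 0" "weight G"] zero_notin[of "?P - {m}"]
          reindex[of "?P - {m}"] G_simps(4) by (simp only: Diff_subset if_False simp_thms)
    qed
    ultimately show ?thesis by simp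
  qed
  have last: "j \<in> ?P \<and> (\<forall>i\<in>?P. i \<le> j)" if j: "(L 0, j) \<in> M" for j
  proof (rule ccontr)
    have jP: "j \<in> ?P" using j M1(1) unfolding edges_eq[OF t] by blast
    assume "\<not> (j \<in> ?P \<and> (\<forall>i\<in>?P. i \<le> j))"
    then obtain i where i: "i \<in> ?P" "\<not> i \<le> j" using jP by blast
    then have ji: "j < i" by simp
    have j0: "0 < j" using jP P0 by (cases j) auto
    \<comment> \<open>The only possible partner of \<open>L j\<close> is the arrival j, which is
      already spent on \<open>L 0\<close>.\<close>
    have "L j \<notin> fst ` M"
    proof
      assume "L j \<in> fst ` M"
      then have "(L j, j) \<in> M" using j0 by (rule matched)
      from inj_onD[OF M1(2) _ this j] have "L j = L 0" by simp
      then show False using j0 by (simp add: Leq)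
    qed
    have sub': "fst ` M \<subseteq> insert (L 0) (L ` (?P - {j}))"
    proof
      fix u assume u: "u \<in> fst ` M"
      with sub have "u \<in> insert (L 0) (L ` ?P)" by (rule subsetD)
      then consider "u = L 0" | k where "k \<in> ?P" "u = L k" by (auto elim!: insertE imageE)
      then show "u \<in> insert (L 0) (L ` (?P - {j}))"
      proof cases
        case 2
        then have "k \<noteq> j" using u \<open>L j \<notin> fst ` M\<close> by (auto simp only:)
        with 2 show ?thesis by simp
      qed simp
    qed
    have "matching_weight G M \<le> (\<Sum>u\<in>insert (L 0) (L ` (?P - {j})). weight G u)"
      unfolding matching_weight_def
    proof (rule sum_mono2)
      show "0 \<le> weight G u" if "u \<in> insert (L 0) (L ` (?P - {j})) - fst ` M" for u
        using that by (intro nn) blast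
    qed (use fin sub' in simp_all)
    also have "\<dots> = 1 + sum wt (?P - {j})"
      using sum.insert[of "L ` (?P - {j})" "L 0" "weight G"] fin zero_notin[of "?P - {j}"]
        reindex[of "?P - {j}"] G_simps(4) by (simp only: Diff_subset if_False simp_thms finite_imageI finite_Diff)
    also have "\<dots> < 1 + sum wt (?P - {i})"
      using wt(3)[OF ji] sum.remove[OF fin jP, of wt] sum.remove[OF fin i(1), of wt] by linarith
    also have "\<dots> \<le> matching_weight G M" using i(1) by (rule better)
    finally show False by simp
  qed
  show ?thesis
  proof
    assume R: "j \<in> ?P \<and> (\<forall>i\<in>?P. i \<le> j)"
    show "(L 0, j) \<in> M"
    proof (rule ccontr)
      assume no: "(L 0, j) \<notin> M"
      have "L 0 \<notin> fst ` M"
      proof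
        assume "L 0 \<in> fst ` M"
        then obtain k where k: "(L 0, k) \<in> M" by (auto elim!: imageE)
        have "k \<le> j" "j \<le> k" using last[OF k] R by blast+
        then have "k = j" by simp
        with k no show False by simp
      qed
      from subset_insert[OF this] sub have subP: "fst ` M \<subseteq> L ` ?P" by (rule iffD1)
      have "matching_weight G M \<le> (\<Sum>u\<in>L ` ?P. weight G u)"
        unfolding matching_weight_def
      proof (rule sum_mono2)
        show "0 \<le> weight G u" if "u \<in> L ` ?P - fst ` M" for u
          using that by (intro nn) blast
      qed (use fin subP in simp_all)
      also have "\<dots> = sum wt ?P" by (rule reindex) simp
      also have "\<dots> < 1 + sum wt (?P - {j})"
      proof -
        have "j \<in> ?P" "j \<in> I" using R PI by blast+
        then show ?thesis using wt(2)[of j] sum.remove[OF fin, of j wt] by simp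
      qed
      also have "\<dots> \<le> matching_weight G M" using R by (intro better) (rule conjunct1)
      finally show False by simp
    qed
  qed (rule last)
qed

definition "later j = (\<Prod>i\<in>{j<..n}. 1 - rate i)"

text \<open>\<open>L 0\<close> goes to \<open>j\<close> iff \<open>j\<close> is present and all
  later vertices are absent. The conditioning set contains \<open>j\<close> and no later index, so
  by independence it fixes the first event and leaves the second at its unconditional probability,
  whatever else it contains.\<close>

lemma subset_estimator_main:
  assumes S: "S n j \<subseteq> {1..j}" "j \<in> S n j" and j: "j \<in> I" and t: "t \<in> set_pmf (types_law G)"
  shows "subset_estimator OPT S G j t (L 0) = (if t j = Ty j then later j else 0)"
proof -
  let ?Q = "opt_law OPT G"
  have dj: "s i \<in> set_pmf (dist G i)" if "s \<in> set_pmf (types_law G)" "i \<in> I" for s i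
  proof -
    have "s \<in> PiE I T" using that(1) by (simp only: types_law_support G_simps(2))
    then show ?thesis using that(2) by (rule PiE_mem)
  qed
  have event: "(L 0, j) \<in> snd q \<longleftrightarrow> fst q j = Ty j \<and> (\<forall>i\<in>{j<..n}. fst q i = Ty 0)"
    if "q \<in> set_pmf ?Q" for q
  proof -
    note q = matching_opt(4,1)[OF that]
    have pr: "i \<in> present (fst q) \<longleftrightarrow> fst q i \<noteq> Ty 0" if i: "i \<in> I" for i
    proof -
      have ne: "Ty i \<noteq> Ty 0" using i by (simp add: inj_eq[OF Ty])
      have "fst q i \<in> {Ty i, Ty 0}" using dj[OF q(1) i] pmf_dist(3)[OF i] by (rule subsetD[rotated])
      then show ?thesis using i ne by (auto simp only: present_def mem_Collect_eq insert_iff empty_iff)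
    qed
    have "(\<forall>i\<in>present (fst q). i \<le> j) \<longleftrightarrow> (\<forall>i\<in>{j<..n}. fst q i = Ty 0)"
    proof
      assume R: "\<forall>i\<in>present (fst q). i \<le> j"
      show "\<forall>i\<in>{j<..n}. fst q i = Ty 0"
      proof
        fix i assume i: "i \<in> {j<..n}"
        have "i \<notin> present (fst q)"
        proof
          assume "i \<in> present (fst q)"
          with R have "i \<le> j" by (rule bspec)
          with i show False by simp
        qed
        moreover have "i \<in> I" using i by simp
        ultimately show "fst q i = Ty 0" using pr by blast
      qed
    next
      assume R: "\<forall>i\<in>{j<..n}. fst q i = Ty 0"
      show "\<forall>i\<in>present (fst q). i \<le> j"
      proof
        fix i assume i: "i \<in> present (fst q)"
        then have iI: "i \<in> I" by (simp add: present_def)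
        show "i \<le> j"
        proof (rule ccontr)
          assume "\<not> i \<le> j"
          with iI have "i \<in> {j<..n}" by simp
          with R have "fst q i = Ty 0" by (rule bspec)
          with pr[OF iI] i show False by blast
        qed
      qed
    qed
    moreover have "j \<in> present (fst q) \<longleftrightarrow> fst q j = Ty j" using j by (simp add: present_def)
    ultimately show ?thesis unfolding main_matched_last[OF q] by (simp only:)
  qed
  \<comment> \<open>Boxes for the conditioning event and, with the later vertices forced to be
    absent, for the numerator; they differ only in coordinates that are free in the first
    box.\<close>
  let ?B = "\<lambda>i. if i \<in> S n j then {t i} else UNIV"
  let ?C = "\<lambda>i. if j < i then {Ty 0} else ?B i"
  have SI: "S n j \<subseteq> I" and later_notin: "\<And>i. j < i \<Longrightarrow> i \<notin> S n j" using S(1) j by auto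
  have "measure_pmf.prob ?Q {q. \<forall>i\<in>S n j. fst q i = t i} =
      measure_pmf.prob (types_law G) (Pi I ?B)"
  proof -
    have mem: "s \<in> Pi I ?B \<longleftrightarrow> (\<forall>i\<in>S n j. s i = t i)" for s
    proof
      assume s: "s \<in> Pi I ?B"
      show "\<forall>i\<in>S n j. s i = t i"
      proof
        fix i assume i: "i \<in> S n j"
        then have "i \<in> I" using SI by blast
        with Pi_mem[OF s, of i] i show "s i = t i" by simp
      qed
    qed (intro Pi_I, simp)
    have "fst -` Pi I ?B = {q :: (nat \<Rightarrow> 't) \<times> ('l \<times> nat) set. \<forall>i\<in>S n j. fst q i = t i}"
      by (simp only: vimage_def mem)
    then show ?thesis by (simp only: measure_map_pmf flip: fst_opt_law[of OPT])
  qed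
  also have "\<dots> = (\<Prod>i\<in>I. measure_pmf.prob (dist G i) (?B i))"
    unfolding types_law_def G_simps(2) by (rule measure_Pi_pmf_Pi) simp
  finally have den: "measure_pmf.prob ?Q {q. \<forall>i\<in>S n j. fst q i = t i} =
      (\<Prod>i\<in>I. measure_pmf.prob (dist G i) (?B i))" .
  have "0 < measure_pmf.prob (dist G i) (?B i)" if "i \<in> I" for i
    using dj[OF t that] by (simp add: measure_pmf_single pmf_positive del: G_simps(3))
  then have pos: "0 < (\<Prod>i\<in>I. measure_pmf.prob (dist G i) (?B i))" by (intro prod_pos) auto
  show ?thesis
  proof (cases "t j = Ty j")
    case True
    have mem: "s \<in> Pi I ?C \<longleftrightarrow> (\<forall>i\<in>{j<..n}. s i = Ty 0) \<and> (\<forall>i\<in>S n j. s i = t i)" for s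
    proof
      assume s: "s \<in> Pi I ?C"
      have "s i = Ty 0" if "i \<in> {j<..n}" for i
        using Pi_mem[OF s, of i] that by simp
      moreover have "s i = t i" if i: "i \<in> S n j" for i
      proof -
        have "i \<in> I" "\<not> j < i" using i SI later_notin by blast+
        with Pi_mem[OF s, of i] i show ?thesis by simp
      qed
      ultimately show "(\<forall>i\<in>{j<..n}. s i = Ty 0) \<and> (\<forall>i\<in>S n j. s i = t i)" by blast
    qed (intro Pi_I, simp)
    have "{q. (L 0, j) \<in> snd q \<and> (\<forall>i\<in>S n j. fst q i = t i)} \<inter> set_pmf ?Q =
        fst -` Pi I ?C \<inter> set_pmf ?Q"
    proof -
      have "(L 0, j) \<in> snd q \<and> (\<forall>i\<in>S n j. fst q i = t i) \<longleftrightarrow>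
          (\<forall>i\<in>{j<..n}. fst q i = Ty 0) \<and> (\<forall>i\<in>S n j. fst q i = t i)"
        if "q \<in> set_pmf ?Q" for q
      proof -
        have "fst q j = Ty j" if "\<forall>i\<in>S n j. fst q i = t i"
          using bspec[OF that S(2)] True by (rule trans)
        then show ?thesis unfolding event[OF that] by blast
      qed
      then show ?thesis by (auto simp only: vimage_def mem Int_iff mem_Collect_eq)
    qed
    then have "measure_pmf.prob ?Q {q. (L 0, j) \<in> snd q \<and> (\<forall>i\<in>S n j. fst q i = t i)} =
        measure_pmf.prob ?Q (fst -` Pi I ?C)"
      using measure_Int_set_pmf[of ?Q "{q. (L 0, j) \<in> snd q \<and> (\<forall>i\<in>S n j. fst q i = t i)}"]
        measure_Int_set_pmf[of ?Q "fst -` Pi I ?C"] by (simp only:)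
    also have "\<dots> = measure_pmf.prob (types_law G) (Pi I ?C)"
      by (simp only: measure_map_pmf flip: fst_opt_law[of OPT])
    also have "\<dots> = (\<Prod>i\<in>I. measure_pmf.prob (dist G i) (?C i))"
      unfolding types_law_def G_simps(2) by (rule measure_Pi_pmf_Pi) simp
    also have "\<dots> = (\<Prod>i\<in>I. measure_pmf.prob (dist G i) (?B i) * (if j < i then 1 - rate i else 1))"
    proof (rule prod.cong[OF refl])
      fix i assume i: "i \<in> I"
      have "i \<notin> S n j" if "j < i" using that S(1) by auto
      then show "measure_pmf.prob (dist G i) (?C i) =
          measure_pmf.prob (dist G i) (?B i) * (if j < i then 1 - rate i else 1)"
        using pmf_dist(2)[OF i] by (simp add: measure_pmf_single del: G_simps(3))
    qed
    also have "\<dots> = (\<Prod>i\<in>I. measure_pmf.prob (dist G i) (?B i)) * later j"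
    proof -
      have "(\<Prod>i\<in>I. if j < i then 1 - rate i else 1) = (\<Prod>i\<in>{i\<in>I. j < i}. 1 - rate i)"
        by (rule prod.inter_filter[symmetric]) simp
      also have "{i\<in>I. j < i} = {j<..n}" using j by auto
      finally show ?thesis by (simp add: prod.distrib later_def)
    qed
    finally have num: "measure_pmf.prob ?Q {q. (L 0, j) \<in> snd q \<and> (\<forall>i\<in>S n j. fst q i = t i)} =
        (\<Prod>i\<in>I. measure_pmf.prob (dist G i) (?B i)) * later j" .
    have "x * y / x = y" if "0 < x" for x y :: real using that by simp
    with num den pos True show ?thesis
      by (simp only: subset_estimator_def cond_prob_def G_simps(2) space_measure_pmf UNIV_I simp_thms if_True)
  next
    case False
    have "measure_pmf.prob ?Q {q. (L 0, j) \<in> snd q \<and> (\<forall>i\<in>S n j. fst q i = t i)} = 0"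
        unfolding measure_pmf_zero_iff
    proof (intro equals0I, elim IntE, unfold mem_Collect_eq, elim conjE)
      fix q assume q: "q \<in> set_pmf ?Q" "(L 0, j) \<in> snd q" "\<forall>i\<in>S n j. fst q i = t i"
      have "fst q j = Ty j" using event[OF q(1)] q(2) by blast
      moreover have "fst q j = t j" using q(3) S(2) by (rule bspec)
      ultimately show False using False by simp
    qed
    then show ?thesis
      using False by (simp add: subset_estimator_def cond_prob_def)
  qed
qed

text \<open>The load of \<open>L 0\<close> is the extremal sum for \<open>ds\<close>, and the
  private vertices together add at most their total weight.\<close>

lemma subset_value_le:
  assumes "valid_index_sets S"
  shows "fractional_value (subset_estimator OPT S) G \<le> 1 - shortfall ds 1 1 + (\<Sum>k\<in>I. wt k)"
proof -
  let ?E = "measure_pmf.expectation (types_law G)"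
  let ?\<phi> = "\<lambda>j \<tau>. if \<tau> = Ty j then later j else 0 :: real"
  note int = integrable_measure_pmf_finite[OF finite_types]
  have ptw: "(\<Sum>u\<in>offline G. weight G u * min (load n (\<lambda>j. subset_estimator OPT S G j t) u) 1) \<le>
      (1 - max 0 (1 - (\<Sum>j\<in>I. ?\<phi> j (t j)))) + (\<Sum>k\<in>I. wt k)"
    if t: "t \<in> set_pmf (types_law G)" for t
  proof -
    let ?f = "\<lambda>u. weight G u * min (load n (\<lambda>j. subset_estimator OPT S G j t) u) 1"
    have "load n (\<lambda>j. subset_estimator OPT S G j t) (L 0) = (\<Sum>j\<in>I. ?\<phi> j (t j))"
      unfolding load_def using assms
      by (intro sum.cong refl subset_estimator_main t) (auto simp: valid_index_sets_def)
    then have 0: "?f (L 0) = 1 - max 0 (1 - (\<Sum>j\<in>I. ?\<phi> j (t j)))"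
      by (simp only: G_simps(4))
    have "offline G = insert (L 0) (L ` I)"
    proof -
      have "{0..n} = insert 0 I" by auto
      then show ?thesis by simp
    qed
    moreover have "L 0 \<notin> L ` I" using L by (auto simp: inj_eq)
    ultimately have "sum ?f (offline G) = ?f (L 0) + sum ?f (L ` I)" by simp
    also have "sum ?f (L ` I) = (\<Sum>k\<in>I. ?f (L k))"
      using sum.reindex[OF inj_on_subset[OF L subset_UNIV], of ?f I] by (simp only: comp_def)
    also have "\<dots> \<le> (\<Sum>k\<in>I. wt k)"
    proof (rule sum_mono)
      fix k assume "k \<in> I"
      then show "?f (L k) \<le> wt k"
        using wt(1)[of k] mult_left_mono[of "min (load n (\<lambda>j. subset_estimator OPT S G j t) (L k)) 1" 1 "wt k"]
        by simp
    qed
    finally show ?thesis using 0 by simp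
  qed
  have "fractional_value (subset_estimator OPT S) G \<le>
      ?E (\<lambda>t. (1 - max 0 (1 - (\<Sum>j\<in>I. ?\<phi> j (t j)))) + (\<Sum>k\<in>I. wt k))"
    unfolding fractional_value_def G_simps(2)
  proof (intro integral_mono_AE int)
    show "AE t in types_law G.
        (\<Sum>u\<in>offline G. weight G u * min (load n (\<lambda>j. subset_estimator OPT S G j t) u) 1) \<le>
        (1 - max 0 (1 - (\<Sum>j\<in>I. ?\<phi> j (t j)))) + (\<Sum>k\<in>I. wt k)"
      unfolding AE_measure_pmf_iff using ptw by (rule ballI)
  qed
  also have "\<dots> = 1 - ?E (\<lambda>t. max 0 (1 - (\<Sum>j\<in>I. ?\<phi> j (t j)))) + (\<Sum>k\<in>I. wt k)"
  proof -
    have "?E (\<lambda>t. (1 - f t) + c) = 1 - ?E f + c" for f and c :: real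
      using int[of f] by simp
    then show ?thesis .
  qed
  also have "?E (\<lambda>t. max 0 (1 - (\<Sum>j\<in>I. ?\<phi> j (t j)))) = shortfall ds 1 1"
  proof -
    \<comment> \<open>At rates 0 and 1 the support is smaller than this product; the sum is extended
      over profiles of probability 0.\<close>
    have "finite (PiE I (\<lambda>j. {Ty j, Ty 0}))" by (intro finite_PiE) auto
    moreover have "set_pmf (types_law G) \<subseteq> PiE I (\<lambda>j. {Ty j, Ty 0})"
      unfolding types_law_support G_simps(2) by (rule PiE_mono) (rule pmf_dist(3))
    ultimately have "?E (\<lambda>t. max 0 (1 - (\<Sum>j\<in>I. ?\<phi> j (t j)))) =
        (\<Sum>t\<in>PiE I (\<lambda>j. {Ty j, Ty 0}). pmf (types_law G) t * max 0 (1 - (\<Sum>j\<in>I. ?\<phi> j (t j))))"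
      by (subst integral_measure_pmf[where A = "PiE I (\<lambda>j. {Ty j, Ty 0})"])
        (assumption, erule (1) subsetD, simp only: real_scaleR_def)
    also have "\<dots> = additive_shortfall I (\<lambda>j. pmf (dist G j)) (\<lambda>j. {Ty j, Ty 0}) ?\<phi> 1"
      unfolding additive_shortfall_def product_sum_def
    proof (rule sum.cong[OF refl])
      fix t assume "t \<in> PiE I (\<lambda>j. {Ty j, Ty 0})"
      then have "pmf (types_law G) t = (\<Prod>j\<in>I. pmf (dist G j) (t j))"
        unfolding types_law_def G_simps(2) by (intro pmf_Pi') (simp_all add: PiE_def extensional_def)
      then show "pmf (types_law G) t * max 0 (1 - (\<Sum>j\<in>I. ?\<phi> j (t j))) =
          (\<Prod>j\<in>I. pmf (dist G j) (t j)) * max 0 (1 - (\<Sum>j\<in>I. ?\<phi> j (t j)))"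
        by (simp only:)
    qed
    also have "\<dots> = shortfall (drop (n - n) ds) (\<Prod>i\<in>{n<..n}. 1 - ds ! (n - i)) 1"
    proof (rule shortfall_product_sum[OF ds n_def order_refl])
      fix j assume j: "j \<in> I"
      have "Ty j \<noteq> Ty 0" using j Ty by (auto simp: inj_eq)
      then show "Ty j \<noteq> Ty 0 \<and> pmf (dist G j) (Ty j) = ds ! (n - j) \<and>
          pmf (dist G j) (Ty 0) = 1 - ds ! (n - j)"
        "?\<phi> j (Ty j) = (\<Prod>i\<in>{j<..n}. 1 - ds ! (n - i)) \<and> ?\<phi> j (Ty 0) = 0"
        using pmf_dist(1,2)[OF j] by (simp_all add: rate_def later_def del: G_simps(3))
    qed
    also have "\<dots> = shortfall ds 1 1" by simp
    finally show ?thesis .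
  qed
  finally show ?thesis by simp
qed

text \<open>OPT matches \<open>L 0\<close>, of weight 1, unless every vertex is absent, which has
  probability \<open>survival ds\<close>.\<close>

lemma opt_value_ge: "1 - survival ds \<le> opt_value OPT G"
proof -
  let ?Q = "opt_law OPT G"
  let ?N = "Pi I (\<lambda>_. {Ty 0})"
  have "measure_pmf.prob (types_law G) ?N = (\<Prod>j\<in>I. measure_pmf.prob (dist G j) {Ty 0})"
    unfolding types_law_def G_simps(2) by (rule measure_Pi_pmf_Pi) simp
  also have "\<dots> = (\<Prod>j\<in>I. 1 - rate j)"
    using pmf_dist(2) by (intro prod.cong) (simp_all add: measure_pmf_single del: G_simps(3))
  also have "\<dots> = (\<Prod>i<n. 1 - ds ! (n - Suc i))"
    unfolding rate_def by (simp add: prod.atLeast1_atMost_eq)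
  also have "\<dots> = (\<Prod>i<n. 1 - ds ! i)"
    by (rule prod.nat_diff_reindex)
  also have "\<dots> = survival ds"
    by (simp add: survival_def prod.list_conv_set_nth n_def atLeast0LessThan)
  finally have none: "measure_pmf.prob (types_law G) ?N = survival ds" .
  have ptw: "1 - indicator (fst -` ?N) q \<le> matching_weight G (snd q)" if q: "q \<in> set_pmf ?Q" for q
  proof (cases "present (fst q) = {}")
    case True
    have "fst q i \<in> set_pmf (dist G i)" if "i \<in> I" for i
      using matching_opt(4)[OF q] that by (auto simp: types_law_support simp del: G_simps(3))
    then have "fst q i = Ty 0" if "i \<in> I" for i
      using pmf_dist(3)[OF that] True that by (auto simp: present_def simp del: G_simps(3))
    moreover have "0 \<le> matching_weight G (snd q)"
      unfolding matching_weight_def using matching_opt(3)[OF q] weight_nonneg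
      by (intro sum_nonneg) fastforce
    ultimately show ?thesis by (simp add: Pi_def)
  next
    case False
    have f: "finite (present (fst q))" by (simp add: present_def)
    then have "(L 0, Max (present (fst q))) \<in> snd q"
      unfolding main_matched_last[OF matching_opt(4,1)[OF q]] using False by auto
    then have *: "{L 0} \<subseteq> fst ` snd q" by force
    have "fst ` snd q \<subseteq> offline G" using matching_opt(3)[OF q] by force
    then have "(\<Sum>u\<in>{L 0}. weight G u) \<le> matching_weight G (snd q)"
      unfolding matching_weight_def using * fin(1) weight_nonneg
      by (intro sum_mono2) (auto intro: finite_subset simp del: G_simps(1))
    then show ?thesis by (simp add: indicator_def)
  qed
  have "1 - survival ds = measure_pmf.expectation ?Q (\<lambda>q. 1 - indicator (fst -` ?N) q)"
    unfolding none[symmetric] fst_opt_law[of OPT G, symmetric]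
    by (simp add: integrable_measure_pmf_finite[OF finite_opt_law])
  also have "\<dots> \<le> opt_value OPT G"
    unfolding opt_value_def
    by (intro integral_mono_AE integrable_measure_pmf_finite[OF finite_opt_law])
      (auto simp: AE_measure_pmf_iff case_prod_unfold dest!: ptw simp del: vimage_eq)
  finally show ?thesis .
qed

end

section \<open>Competitive ratios\<close>

lemma survival_le_1:
  assumes "set ds \<subseteq> {0..1}"
  shows "survival ds \<le> 1"
proof -
  have "0 \<le> survival ds \<and> survival ds \<le> 1"
    using assms unfolding survival_def
    by (induction ds) (auto intro!: mult_nonneg_nonneg mult_le_one)
  then show ?thesis ..
qed

lemma shortfall_718:
  assumes "set ds \<subseteq> {0..1}"
  shows "0.718 * (1 - survival ds) \<le> 1 - shortfall ds 1 1"
proof -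
  have "0.718 * (1 - survival ds) \<le> (1 - dickman_bound 1) * (1 - survival ds)"
    using dickman_bound_1 survival_le_1[OF assms] by (intro mult_right_mono) auto
  also have "\<dots> \<le> 1 - shortfall ds 1 1" using shortfall_bound[OF assms, of 1] by simp
  finally show ?thesis .
qed

lemma fractional_online_independent_estimator:
  fixes OPT :: "('l, 't) opt_rule"
  assumes "valid_opt_rule OPT"
  shows "fractional_online (independent_estimator OPT)"
  unfolding fractional_online_def
proof (intro allI impI ballI conjI)
  fix G :: "('l, 't) osm" and j t u assume G: "valid_osm G" and j: "j \<in> {1..arrivals G}" and t: "t \<in> set_pmf (types_law G)"
  interpret matching_instance OPT G using assms G by unfold_locales
  show "independent_estimator OPT G j t u \<in> {0..1}"
    "0 < independent_estimator OPT G j t u \<Longrightarrow> u \<in> nbrs G (t j)"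
    "(\<Sum>u\<in>offline G. independent_estimator OPT G j t u) \<le> 1"
    using estimator_fractional[OF j t] by blast+
  show "independent_estimator OPT G j t' = independent_estimator OPT G j t"
    if "\<forall>i\<in>{1..j}. t' i = t i" for t'
    using that j by (simp add: independent_estimator_def fun_eq_iff)
qed

lemma fractional_value_cong:
  assumes "\<And>j t. j \<in> {1..arrivals G} \<Longrightarrow> t \<in> set_pmf (types_law G) \<Longrightarrow> x G j t = x' G j t"
  shows "fractional_value x G = fractional_value x' G"
  unfolding fractional_value_def load_def
  using assms by (intro integral_cong_AE) (auto simp: AE_measure_pmf_iff intro!: sum.cong)

lemma exists_injections:
  "\<exists>(L :: nat \<Rightarrow> 'l::infinite) (Ty :: nat \<Rightarrow> 't::infinite). inj L \<and> inj Ty"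
  using infinite_countable_subset[OF infinite_UNIV[where 'a = 'l]]
    infinite_countable_subset[OF infinite_UNIV[where 'a = 't]] by blast

text \<open>The conclusion is the premise of \<open>fractional_value_ge\<close>, so a ratio that any
  subset estimator attains on the priority instances is attained by the independent estimator on
  every instance.\<close>

lemma subset_competitive_imp_list_bound:
  fixes OPT :: "('l::infinite, 't::infinite) opt_rule"
  assumes OPT: "valid_opt_rule OPT" and S: "valid_index_sets S"
    and comp: "competitive OPT (fractional_value (subset_estimator OPT S)) \<Gamma>"
    and ds: "set ds \<subseteq> {0..1}"
  shows "\<Gamma> * (1 - survival ds) \<le> 1 - shortfall ds 1 1"
\<comment> \<open>Small \<Gamma> are settled by the Dickman bound; otherwise \<Gamma> is positive
  and may multiply the lower bound on OPT.\<close>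
proof (cases "\<Gamma> \<le> 0.718")
  case True
  then have "\<Gamma> * (1 - survival ds) \<le> 0.718 * (1 - survival ds)"
    using survival_le_1[OF ds] by (intro mult_right_mono) auto
  also note shortfall_718[OF ds]
  finally show ?thesis .
next
  case False
  obtain L :: "nat \<Rightarrow> 'l" and Ty :: "nat \<Rightarrow> 't" where inj: "inj L" "inj Ty"
    using exists_injections by blast
  show ?thesis
  proof (rule field_le_epsilon)
    fix e :: real assume e: "0 < e"
    let ?n = "real (length ds)"
    \<comment> \<open>The private weights sum to at most \<open>\<epsilon> * n\<^sup>2\<close>, to
      be below e, and the locale needs \<open>\<epsilon> * n < 1\<close>; both n and its square are
      at most \<open>n\<^sup>2 + 1\<close>.\<close>
    define \<epsilon> where "\<epsilon> = min e (1/2) / (?n\<^sup>2 + 1)"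
    have den: "0 < ?n\<^sup>2 + 1" by (simp add: add_nonneg_pos)
    have scale: "0 < \<epsilon>" "\<epsilon> * (?n\<^sup>2 + 1) = min e (1/2)"
      using e den by (simp_all add: \<epsilon>_def)
    have "?n \<le> ?n\<^sup>2 + 1"
      using zero_le_power2[of "?n - 1"] by (simp add: power2_eq_square algebra_simps)
    then have "\<epsilon> * ?n \<le> \<epsilon> * (?n\<^sup>2 + 1)" using scale(1) by (intro mult_left_mono) auto
    with scale(2) have "\<epsilon> * ?n < 1" by linarith
    then interpret priority_instance ds L Ty \<epsilon> OPT
      using ds inj scale(1) OPT by unfold_locales
    have "(\<Sum>k\<in>{1..n}. wt k) \<le> (\<Sum>k\<in>{1..n}. \<epsilon> * real n)"
      unfolding wt_def using scale(1) by (intro sum_mono mult_left_mono) auto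
    also have "\<dots> = \<epsilon> * ?n\<^sup>2" by (simp add: n_def power2_eq_square)
    also have "\<dots> \<le> \<epsilon> * (?n\<^sup>2 + 1)" using scale(1) by (intro mult_left_mono) auto
    finally have small: "(\<Sum>k\<in>{1..n}. wt k) \<le> e" using scale(2) by linarith
    have "\<Gamma> * (1 - survival ds) \<le> \<Gamma> * opt_value OPT G"
      using opt_value_ge False by (intro mult_left_mono) auto
    also have "\<dots> \<le> fractional_value (subset_estimator OPT S) G"
      using comp valid by (simp add: competitive_def)
    also note subset_value_le[OF S]
    finally show "\<Gamma> * (1 - survival ds) \<le> 1 - shortfall ds 1 1 + e" using small by linarith
  qed
qed

text \<open>Makes the supremum meaningful. With one sure arrival OPT has value at least 1, while the
  vertex weights are 1 and 1/2.\<close>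

lemma independent_competitive_bounded:
  fixes OPT :: "('l::infinite, 't::infinite) opt_rule"
  assumes OPT: "valid_opt_rule OPT"
    and comp: "competitive OPT (fractional_value (independent_estimator OPT)) \<Gamma>"
  shows "\<Gamma> \<le> 3/2"
proof (rule ccontr)
  assume neg: "\<not> \<Gamma> \<le> 3/2"
  obtain L :: "nat \<Rightarrow> 'l" and Ty :: "nat \<Rightarrow> 't" where inj: "inj L" "inj Ty"
    using exists_injections by blast
  interpret priority_instance "[1]" L Ty "1/2" OPT
    using inj OPT by unfold_locales auto
  have "\<Gamma> * 1 \<le> \<Gamma> * opt_value OPT G"
    using opt_value_ge neg by (intro mult_left_mono) (auto simp: survival_def)
  also have "\<dots> \<le> fractional_value (independent_estimator OPT) G"
    using comp valid by (simp add: competitive_def)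
  also have "\<dots> = fractional_value (subset_estimator OPT (\<lambda>n j. {j})) G"
    by (intro fractional_value_cong independent_eq_subset_singleton)
  also have "\<dots> \<le> 1 - shortfall [1] 1 1 + (\<Sum>k\<in>{1..n}. wt k)"
    by (rule subset_value_le) (auto simp: valid_index_sets_def)
  also have "\<dots> = 3/2" by (simp add: n_def wt_def)
  finally show False using neg by simp
qed

theorem theorem4:
  fixes OPT :: "('l::infinite, 't::infinite) opt_rule"
  assumes "valid_opt_rule OPT"
  shows "fractional_online (independent_estimator OPT) \<and>
    competitive OPT (fractional_value (independent_estimator OPT)) 0.718 \<and>
    (\<forall>A. is_ocs A \<longrightarrow>
      (\<forall>G t. valid_osm G \<and> t \<in> set_pmf (types_law G) \<longrightarrow>
        (\<forall>M\<in>set_pmf (rounded_law A (independent_estimator OPT) G t). is_matching G t M)) \<and>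
      competitive OPT (rounded_value A (independent_estimator OPT)) 0.666) \<and>
    (\<forall>G t. valid_osm G \<and> t \<in> set_pmf (types_law G) \<longrightarrow>
      (\<forall>j\<in>{1..arrivals G}.
        independent_estimator OPT G j t = subset_estimator OPT (\<lambda>n j. {j}) G j t)) \<and>
    (\<forall>S. valid_index_sets S \<longrightarrow>
      competitive_ratio OPT (fractional_value (subset_estimator OPT S))
        \<le> competitive_ratio OPT (fractional_value (independent_estimator OPT)))"
proof (intro conjI allI impI ballI)
  have inst: "matching_instance OPT G" if "valid_osm G" for G
    using assms that by unfold_locales
  show "fractional_online (independent_estimator OPT)"
    using assms by (rule fractional_online_independent_estimator)
  show "competitive OPT (fractional_value (independent_estimator OPT)) 0.718"
    unfolding competitive_def
    using matching_instance.fractional_value_ge[OF inst shortfall_718] by blast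
  show "is_matching G t M" if "is_ocs A" "valid_osm G \<and> t \<in> set_pmf (types_law G)"
    "M \<in> set_pmf (rounded_law A (independent_estimator OPT) G t)" for A G t M
    using that matching_instance.rounded_is_matching[OF inst] by blast
  show "competitive OPT (rounded_value A (independent_estimator OPT)) 0.666" if "is_ocs A" for A
    unfolding competitive_def
    using matching_instance.rounded_value_ge[OF inst that] by blast
  show "independent_estimator OPT G j t = subset_estimator OPT (\<lambda>n j. {j}) G j t"
    if "valid_osm G \<and> t \<in> set_pmf (types_law G)" "j \<in> {1..arrivals G}" for G t j
    using that by (intro independent_eq_subset_singleton) auto
  fix S :: "nat \<Rightarrow> nat \<Rightarrow> nat set" assume S: "valid_index_sets S"
  show "competitive_ratio OPT (fractional_value (subset_estimator OPT S))
      \<le> competitive_ratio OPT (fractional_value (independent_estimator OPT))"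
    unfolding competitive_ratio_def
  \<comment> \<open>The comparison is between sets of attained ratios, not between values on a
    single instance.\<close>
  proof (rule cSup_subset_mono)
    have "0 \<le> fractional_value (subset_estimator OPT S) G" if "valid_osm G" for G
    proof -
      have "0 \<le> subset_estimator OPT S G j t u" for j t u
        by (simp add: subset_estimator_def cond_prob_def)
      then show ?thesis
        unfolding fractional_value_def load_def using that
        by (auto simp: valid_osm_def intro!: integral_nonneg_AE AE_I2 sum_nonneg mult_nonneg_nonneg)
    qed
    then have "competitive OPT (fractional_value (subset_estimator OPT S)) 0"
      by (simp add: competitive_def)
    then show "{\<Gamma>. competitive OPT (fractional_value (subset_estimator OPT S)) \<Gamma>} \<noteq> {}" by blast
    show "bdd_above {\<Gamma>. competitive OPT (fractional_value (independent_estimator OPT)) \<Gamma>}"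
      using independent_competitive_bounded[OF assms] by (intro bdd_aboveI[where M = "3/2"]) blast
    show "{\<Gamma>. competitive OPT (fractional_value (subset_estimator OPT S)) \<Gamma>} \<subseteq>
        {\<Gamma>. competitive OPT (fractional_value (independent_estimator OPT)) \<Gamma>}"
    proof (intro subsetI, elim CollectE, intro CollectI)
      fix \<Gamma> assume "competitive OPT (fractional_value (subset_estimator OPT S)) \<Gamma>"
      from subset_competitive_imp_list_bound[OF assms S this]
      show "competitive OPT (fractional_value (independent_estimator OPT)) \<Gamma>"
        unfolding competitive_def
        using matching_instance.fractional_value_ge[OF inst] by blast
    qed
  qed
qed

end
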